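(* There is a randomized Monte Carlo algorithm solving Vector Multiple Knapsack with Few Small Items in time $2^k\cdot n^{O(1)}$ on instances whose item profits are bounded by a polynomial in $n$, where $k$ is the number of small items and $n$ the input size.
   Context: Vector Multiple Knapsack with Few Small Items: the input is a set of $n$ items $V=\{v_1,\dots,v_n\}\subseteq\mathbb{Q}_{\geqslant 0}^d$ with profits $p(v_1),\dots,p(v_n)\in\mathbb{Z}_+$, a subset $V_S\subseteq V$ of $k$ items (the small items) such that $V_L=V\setminus V_S$ is 3-incompatible, an integer $\ell\in\mathbb{Z}_+$ (number of unit-sized bins), and a goal profit $P\in\mathbb{Z}_+$. A set $V'\subseteq V$ is 3-incompatible if for every three distinct $u,v,w\in V'$ there is a coordinate $i\in[d]$ with $u[i]+v[i]+w[i]>1$. The question is whether some subset $V'\subseteq V$ can be partitioned into $\ell$ bins $B_1\cup\dots\cup B_\ell=V'$ with $\sum_{v\in B_i}v[j]\leqslant 1$ for all $i\in[\ell]$, $j\in[d]$, and $\sum_{v\in V'}p(v)\geqslant P$. The parameter is $k$. *)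

theory Defs
  imports
    "HOL-Probability.Probability"
    "HOL-Library.Discrete_Functions"
    "HOL-Computational_Algebra.Polynomial"
begin

section \<open>Vector Multiple Knapsack with Few Small Items\<close>

text \<open>
  Items are identified with their positions in the item list, so two different items may have the
  same vector. The field \<open>small\<close> marks the members of the set $V_S$.
\<close>

record item =
  coords :: "rat list"
  profit :: nat
  small :: bool

record vmk =
  vdim :: nat
  items :: "item list"
  bins :: nat
  goal_profit :: nat

definition all_items :: "vmk \<Rightarrow> nat set" where
  "all_items I = {..<length (items I)}"

definition small_items :: "vmk \<Rightarrow> nat set" where
  "small_items I = {v \<in> all_items I. small (items I ! v)}"

definition large_items :: "vmk \<Rightarrow> nat set" where
  "large_items I = all_items I - small_items I"

definition item_coord :: "vmk \<Rightarrow> nat \<Rightarrow> nat \<Rightarrow> rat" where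
  "item_coord I v j = coords (items I ! v) ! j"

definition item_profit :: "vmk \<Rightarrow> nat \<Rightarrow> nat" where
  "item_profit I v = profit (items I ! v)"

definition three_incompatible :: "vmk \<Rightarrow> nat set \<Rightarrow> bool" where
  "three_incompatible I W \<longleftrightarrow>
     (\<forall>u\<in>W. \<forall>v\<in>W. \<forall>w\<in>W. u \<noteq> v \<and> v \<noteq> w \<and> u \<noteq> w \<longrightarrow>
        (\<exists>j<vdim I. item_coord I u j + item_coord I v j + item_coord I w j > 1))"

definition vmk_instance :: "vmk \<Rightarrow> bool" where
  "vmk_instance I \<longleftrightarrow>
     (\<forall>v\<in>all_items I. length (coords (items I ! v)) = vdim I \<and>
        (\<forall>j<vdim I. item_coord I v j \<ge> 0)) \<and>
     three_incompatible I (large_items I)"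

definition num_small :: "vmk \<Rightarrow> nat" where
  "num_small I = card (small_items I)"

definition vmk_yes :: "vmk \<Rightarrow> bool" where
  "vmk_yes I \<longleftrightarrow>
     (\<exists>V' B. V' \<subseteq> all_items I \<and>
        (\<Union>i<bins I. B i) = V' \<and> disjoint_family_on B {..<bins I} \<and>
        (\<forall>i<bins I. \<forall>j<vdim I. (\<Sum>v\<in>B i. item_coord I v j) \<le> 1) \<and>
        (\<Sum>v\<in>V'. item_profit I v) \<ge> goal_profit I)"

section \<open>Encoding of instances\<close>

text \<open>
  An input is a list of natural numbers, measured by the total number of their binary digits
  (the number 0 has one digit).
\<close>

definition bit_len :: "nat \<Rightarrow> nat" where
  "bit_len x = Suc (floor_log x)"

definition encode_rat :: "rat \<Rightarrow> nat list" where
  "encode_rat q = (case quotient_of q of (a, b) \<Rightarrow> [nat a, nat b])"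

definition encode_item :: "item \<Rightarrow> nat list" where
  "encode_item v = [of_bool (small v), profit v] @ concat (map encode_rat (coords v))"

definition encode_vmk :: "vmk \<Rightarrow> nat list" where
  "encode_vmk I =
     [length (items I), vdim I, bins I, goal_profit I] @ concat (map encode_item (items I))"

definition input_size :: "nat list \<Rightarrow> nat" where
  "input_size xs = sum_list (map bit_len xs)"

section \<open>Randomized random access machines with logarithmic cost\<close>

text \<open>
  A program has finitely many registers (those it mentions) and an unbounded memory, both holding
  natural numbers. Every evaluated subexpression is charged the bit length of its value; in
  particular each operand, each memory address and each stored value is charged its length.
  This is the logarithmic cost criterion, under which arithmetic on long numbers is not free.
\<close>

datatype arith_op = Plus | Minus | Times | Quot | Rem

datatype expr =
    Const nat
  | Reg nat
  | Load expr
  | Arith arith_op expr expr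

datatype prog =
    Skip
  | Assign nat expr
  | Store expr expr
  | Flip nat
  | Seq prog prog
  | Cond expr prog prog
  | Loop expr prog

type_synonym mstate = "(nat \<Rightarrow> nat) \<times> (nat \<Rightarrow> nat)"

text \<open>On natural numbers subtraction is truncated, and \<open>x div 0 = 0\<close>, \<open>x mod 0 = x\<close>.\<close>

fun arith :: "arith_op \<Rightarrow> nat \<Rightarrow> nat \<Rightarrow> nat" where
  "arith Plus x y = x + y"
| "arith Minus x y = x - y"
| "arith Times x y = x * y"
| "arith Quot x y = x div y"
| "arith Rem x y = x mod y"

fun eval_expr :: "expr \<Rightarrow> mstate \<Rightarrow> nat" where
  "eval_expr (Const x) s = x"
| "eval_expr (Reg r) s = fst s r"
| "eval_expr (Load e) s = snd s (eval_expr e s)"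
| "eval_expr (Arith f e1 e2) s = arith f (eval_expr e1 s) (eval_expr e2 s)"

fun cost_expr :: "expr \<Rightarrow> mstate \<Rightarrow> nat" where
  "cost_expr (Const x) s = bit_len x"
| "cost_expr (Reg r) s = bit_len (fst s r)"
| "cost_expr (Load e) s = cost_expr e s + bit_len (eval_expr (Load e) s)"
| "cost_expr (Arith f e1 e2) s =
     cost_expr e1 s + cost_expr e2 s + bit_len (eval_expr (Arith f e1 e2) s)"

text \<open>
  \<open>exec c s \<omega> t \<omega>' m\<close>: started in state \<open>s\<close> with coin tosses \<open>\<omega>\<close>, the program \<open>c\<close> halts in state
  \<open>t\<close> after total cost \<open>m\<close>, with \<open>\<omega>'\<close> the coin tosses not yet consumed.
\<close>

inductive exec ::
  "prog \<Rightarrow> mstate \<Rightarrow> bool stream \<Rightarrow> mstate \<Rightarrow> bool stream \<Rightarrow> nat \<Rightarrow> bool" where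
  Skip: "exec Skip s \<omega> s \<omega> 1"
| Assign: "exec (Assign r e) (R, M) \<omega> (R(r := eval_expr e (R, M)), M) \<omega> (cost_expr e (R, M))"
| Store: "exec (Store a e) (R, M) \<omega> (R, M(eval_expr a (R, M) := eval_expr e (R, M))) \<omega>
            (cost_expr a (R, M) + cost_expr e (R, M))"
| Flip: "exec (Flip r) (R, M) \<omega> (R(r := of_bool (shd \<omega>)), M) (stl \<omega>) 1"
| Seq: "\<lbrakk>exec c1 s \<omega> t \<omega>' m; exec c2 t \<omega>' u \<omega>'' n\<rbrakk> \<Longrightarrow> exec (Seq c1 c2) s \<omega> u \<omega>'' (m + n)"
| CondTrue: "\<lbrakk>eval_expr e s \<noteq> 0; exec c1 s \<omega> t \<omega>' m\<rbrakk>
     \<Longrightarrow> exec (Cond e c1 c2) s \<omega> t \<omega>' (cost_expr e s + m)"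
| CondFalse: "\<lbrakk>eval_expr e s = 0; exec c2 s \<omega> t \<omega>' m\<rbrakk>
     \<Longrightarrow> exec (Cond e c1 c2) s \<omega> t \<omega>' (cost_expr e s + m)"
| LoopTrue: "\<lbrakk>eval_expr e s \<noteq> 0; exec c s \<omega> t \<omega>' m; exec (Loop e c) t \<omega>' u \<omega>'' n\<rbrakk>
     \<Longrightarrow> exec (Loop e c) s \<omega> u \<omega>'' (cost_expr e s + m + n)"
| LoopFalse: "eval_expr e s = 0 \<Longrightarrow> exec (Loop e c) s \<omega> s \<omega> (cost_expr e s)"

lemma exec_deterministic:
  assumes "exec c s \<omega> t \<omega>' m" "exec c s \<omega> u \<omega>'' n"
  shows "t = u \<and> \<omega>' = \<omega>'' \<and> m = n"
  using assms
proof (induction arbitrary: u \<omega>'' n rule: exec.induct)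
  case (Seq c1 s \<omega> t \<omega>' m c2 u' \<omega>2 n')
  from Seq.prems show ?case
    by cases (use Seq.IH in blast)
next
  case (CondTrue e s c1 \<omega> t \<omega>' m c2)
  from CondTrue.prems CondTrue.hyps show ?case
    by cases (use CondTrue.IH in blast)+
next
  case (CondFalse e s c2 \<omega> t \<omega>' m c1)
  from CondFalse.prems CondFalse.hyps show ?case
    by cases (use CondFalse.IH in blast)+
next
  case (LoopTrue e s c \<omega> t \<omega>' m u' \<omega>2 n')
  from LoopTrue.prems LoopTrue.hyps show ?case
    by cases (use LoopTrue.IH in blast)+
next
  case (LoopFalse e s c \<omega>)
  from LoopFalse.prems LoopFalse.hyps show ?case
    by cases auto
qed (auto elim: exec.cases)

definition init_state :: "nat list \<Rightarrow> mstate" where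
  "init_state xs = (\<lambda>_. 0, \<lambda>i. if i < length xs then xs ! i else 0)"

text \<open>The answer is read off register 0: nonzero means yes.\<close>

definition answers :: "prog \<Rightarrow> nat list \<Rightarrow> bool stream \<Rightarrow> bool \<Rightarrow> bool" where
  "answers A xs \<omega> b \<longleftrightarrow>
     (\<exists>t \<omega>' m. exec A (init_state xs) \<omega> t \<omega>' m \<and> (fst t 0 \<noteq> 0 \<longleftrightarrow> b))"

definition halts_within :: "prog \<Rightarrow> nat list \<Rightarrow> bool stream \<Rightarrow> nat \<Rightarrow> bool" where
  "halts_within A xs \<omega> T \<longleftrightarrow> (\<exists>t \<omega>' m. exec A (init_state xs) \<omega> t \<omega>' m \<and> m \<le> T)"

definition coin_space :: "bool stream measure" where
  "coin_space = stream_space (measure_pmf (bernoulli_pmf (1/2)))"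

text \<open>
  Monte Carlo: the running time bound holds for every outcome of the coin tosses, and the answer
  is correct with probability at least 2/3, whether it is yes or no.
\<close>

definition monte_carlo_decides :: "prog \<Rightarrow> nat list \<Rightarrow> bool \<Rightarrow> nat \<Rightarrow> bool" where
  "monte_carlo_decides A xs b T \<longleftrightarrow>
     (\<forall>\<omega>. halts_within A xs \<omega> T) \<and>
     measure coin_space {\<omega>. answers A xs \<omega> b} \<ge> 2/3"

end

theory Submission
  imports
    Defs
    "HOL-Library.Z2"
    "HOL-Library.Nat_Bijection"
    "HOL-Combinatorics.Permutations"
begin

text \<open>
  A bin holds at most two large items, so a packing is an involution of a vertex set together with a
  distribution of the small items over its cycles: a large item is a vertex that contributes itself,
  a small item is also a vertex and serves as a bin without large items, one more vertex is a dummy,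
  and a fixed point may also be declared unused, which discards the small items assigned to it.

  Over a ring of characteristic two, the permanent of a symmetric matrix is a sum over involutions,
  because a permutation and its inverse cancel. The entry at \<open>a, b\<close> sums, over the sets \<open>T\<close> of small
  items that fit together with \<open>a\<close> and \<open>b\<close>, monomials whose exponent records the size of \<open>T\<close>, the number
  of bins, the profit and a random weight. Restricting the entries to sets \<open>T \<subseteq> X\<close> and summing the
  permanents over all sets \<open>X\<close> of small items keeps, modulo 2, exactly the choices that use every small
  item; looking only at monomials with total size \<open>k\<close>, every small item is used once. By the isolation
  lemma the lightest solution is unique with probability at least 2/3, and then its coefficient is odd.

  Signs do not matter modulo 2, so Bird's division-free determinant recursion computes the permanent.
  All polynomials are evaluated at a power of two that exceeds every coefficient, and the parities are
  read off as bits of one natural number. The factor \<open>2\<^sup>k\<close> is the number of sets \<open>X\<close>; the entries for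
  all \<open>X\<close> come from a fast zeta transform.
\<close>

section \<open>Bird's recursion in characteristic two\<close>

text \<open>The factor \<open>2 ^ num_small I\<close> may enter only as a number of table cells; the
  work per cell must be polynomial. Programs are therefore built from a small expression language
  whose loops run at most \<open>L\<close> rounds. The cost of every expression is bounded by a
  fixed power of \<open>L\<close>, and only the loop that fills a table may run longer. One
  quantity, \<open>vbound I\<close>, bounds the lengths of all stored numbers and all loops inside
  expressions. The table entries are long: their length is governed by exponents of monomials, hence
  by the profits themselves and not by the lengths of the profits. This is why the profits have to
  be polynomial in the input size. The machine computes with natural numbers, the algebra lives in
  \<open>bit poly\<close>. They meet in \<open>nat poly\<close>: Bird's recursion without signs uses
  only sums and products, so it commutes with evaluation at \<open>2 ^ B\<close> and with reduction
  modulo 2. Random weights belong to pairs of a cycle representative and a slot,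
  \<open>2 * N * N\<close> pairs for \<open>N\<close> vertices. Weights below some
  \<open>W > 6 * N * N\<close> thus fail to isolate with probability at most 1/3, and taking
  \<open>W\<close> a power of two lets fair coins produce them exactly.\<close>

lemma bit_poly_add_self: "(p :: bit poly) + p = 0"
proof (rule poly_eqI)
  show "coeff (p + p) n = coeff 0 n" for n
    unfolding coeff_add by (cases "coeff p n") auto
qed

text \<open>Cross terms come in equal pairs and cancel. Hence a squared entry expands into one
  choice per 2-cycle, not into two independent ones.\<close>

lemma square_sum_bit_poly:
  "(\<Sum>x\<in>S. f x :: bit poly)\<^sup>2 = (\<Sum>x\<in>S. (f x)\<^sup>2)"
proof (induction S rule: infinite_finite_induct)
  case (insert x F)
  have "(f x + sum f F)\<^sup>2 = (f x)\<^sup>2 + (sum f F)\<^sup>2 + (f x * sum f F + f x * sum f F)"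
    by (simp add: power2_eq_square algebra_simps)
  then show ?case
    using insert bit_poly_add_self[of "f x * sum f F"] by simp
qed auto

text \<open>Two distinct points exchanged by \<open>\<phi>\<close> contribute equal terms, which
  cancel. The later cancellations (repeated columns, inverse permutations, supersets) are all
  instances of this.\<close>

lemma sum_involution:
  fixes f :: "'a \<Rightarrow> bit poly"
  assumes "finite S"
    and "\<And>x. x \<in> S \<Longrightarrow> \<phi> x \<in> S" and "\<And>x. x \<in> S \<Longrightarrow> \<phi> (\<phi> x) = x"
    and "\<And>x. x \<in> S \<Longrightarrow> f (\<phi> x) = f x"
  shows "sum f S = sum f {x \<in> S. \<phi> x = x}"
  using assms
proof (induction "card S" arbitrary: S rule: less_induct)
  case less
  show ?case
  proof (cases "\<forall>x\<in>S. \<phi> x = x")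
    case True
    then have "{x \<in> S. \<phi> x = x} = S" by blast
    then show ?thesis by simp
  next
    case False
    then obtain x where x: "x \<in> S" "\<phi> x \<noteq> x" by blast
    define T where "T = S - {x, \<phi> x}"
    have fx: "\<phi> x \<in> S" using less x by blast
    have T: "finite T" "x \<notin> T" "\<phi> x \<notin> T" and S: "S = insert x (insert (\<phi> x) T)"
      using less.prems(1) x fx by (auto simp: T_def)
    have "card T < card S"
      using less.prems(1) x by (intro psubset_card_mono) (auto simp: T_def)
    moreover have "\<phi> y \<in> T" if "y \<in> T" for y
      using that less.prems(2,3) x fx unfolding T_def
      by (metis DiffD1 DiffD2 DiffI insert_iff singletonD)
    ultimately have IH: "sum f T = sum f {x \<in> T. \<phi> x = x}"
      using less.prems T by (intro less.hyps) (auto simp: T_def)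
    have "sum f S = (f x + f x) + sum f T"
      using T x less.prems(4)[OF x(1)] unfolding S by (simp add: add.assoc)
    also have "\<dots> = sum f T" by (simp add: bit_poly_add_self)
    also have "sum f T = sum f {x \<in> T. \<phi> x = x}" by (rule IH)
    also have "{x \<in> T. \<phi> x = x} = {x \<in> S. \<phi> x = x}"
      using x less.prems(3)[OF x(1)] by (auto simp: T_def)
    finally show ?thesis .
  qed
qed

text \<open>Bird's step multiplies \<open>A\<close> from the left by a matrix made from the previous
  one: the part strictly above the diagonal is kept, and each diagonal entry becomes minus the sum
  of the later diagonal entries. Dropping the sign makes the recursion meaningful over any
  commutative semiring.\<close>

fun bird :: "nat \<Rightarrow> (nat \<Rightarrow> nat \<Rightarrow> 'a::comm_semiring_1) \<Rightarrow> nat \<Rightarrow> nat \<Rightarrow> nat \<Rightarrow> 'a" where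
  "bird N A 0 i j = A i j"
| "bird N A (Suc m) i j =
     (\<Sum>l<N. if i < l then bird N A m i l * A l j + bird N A m l l * A i j else 0)"

definition per :: "(nat \<Rightarrow> nat \<Rightarrow> 'a::comm_semiring_1) \<Rightarrow> nat set \<Rightarrow> 'a" where
  "per A C = (\<Sum>p | p permutes C. \<Prod>a\<in>C. A a (p a))"

text \<open>
  The permanent of the submatrix with rows \<open>insert i C\<close> and columns \<open>insert j C\<close>; for \<open>j \<in> C\<close> column
  \<open>j\<close> occurs twice.
\<close>

definition minor :: "(nat \<Rightarrow> nat \<Rightarrow> 'a::comm_semiring_1) \<Rightarrow> nat \<Rightarrow> nat \<Rightarrow> nat set \<Rightarrow> 'a" where
  "minor A i j C =
     (\<Sum>p | p permutes insert i C. \<Prod>a\<in>insert i C. A a (if p a = i then j else p a))"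

lemma minor_empty: "minor A i j {} = A i j"
  by (simp add: minor_def)

lemma per_eq_minor:
  assumes "r \<in> C"
  shows "per A C = minor A r r (C - {r})"
proof -
  have "(if p a = r then r else p a) = p a" for p :: "nat \<Rightarrow> nat" and a by simp
  then show ?thesis using assms by (simp add: per_def minor_def insert_absorb)
qed

text \<open>The values \<open>i\<close> and \<open>j\<close> of \<open>p\<close> both select column
  \<open>j\<close>, so composing \<open>p\<close> with their transposition keeps the product. No
  \<open>p\<close> is fixed by this, since it attains the value \<open>i\<close>.\<close>

lemma minor_repeated_column:
  fixes A :: "nat \<Rightarrow> nat \<Rightarrow> bit poly"
  assumes "finite C" "i \<notin> C" "j \<in> C"
  shows "minor A i j C = 0"
proof -
  let ?S = "{p. p permutes insert i C}" and ?\<phi> = "\<lambda>p. Transposition.transpose i j \<circ> p"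
  let ?f = "\<lambda>p. \<Prod>a\<in>insert i C. A a (if p a = i then j else p a)"
  have ij: "i \<noteq> j" using assms by auto
  have "sum ?f ?S = sum ?f {p \<in> ?S. ?\<phi> p = p}"
  proof (rule sum_involution)
    show "finite ?S" using assms by (simp add: finite_permutations)
    fix p assume "p \<in> ?S"
    then show "?\<phi> p \<in> ?S"
      using assms by (auto intro!: permutes_compose permutes_swap_id)
    show "?\<phi> (?\<phi> p) = p" by (simp add: fun_eq_iff)
    show "?f (?\<phi> p) = ?f p"
      using ij by (intro prod.cong) (auto simp: Transposition.transpose_def)
  qed
  also have "{p \<in> ?S. ?\<phi> p = p} = {}"
  proof -
    have False if p: "p permutes insert i C" "?\<phi> p = p" for p
    proof -
      have "p (inv p i) = i" using p(1) by (rule permutes_inverses)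
      then show False using fun_cong[OF p(2), of "inv p i"] ij by simp
    qed
    then show ?thesis by blast
  qed
  finally show ?thesis by (simp add: minor_def)
qed

text \<open>Expansion along column \<open>j\<close>, which is used by the row \<open>l\<close> with
  \<open>p l = i\<close>. For \<open>l = i\<close> a permutation of \<open>C\<close> remains;
  otherwise row \<open>l\<close> disappears and column \<open>l\<close> becomes the one that
  replaces column \<open>i\<close>.\<close>

lemma minor_expand:
  fixes A :: "nat \<Rightarrow> nat \<Rightarrow> 'a::comm_semiring_1"
  assumes "finite C" "i \<notin> C"
  shows "minor A i j C = A i j * per A C + (\<Sum>l\<in>C. A l j * minor A i l (C - {l}))"
proof -
  let ?S = "{p. p permutes insert i C}"
  let ?f = "\<lambda>p. \<Prod>a\<in>insert i C. A a (if p a = i then j else p a)"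
  have fin: "finite ?S" using assms by (simp add: finite_permutations)
  have *: "{p \<in> ?S. inv p i = l} = {p \<in> ?S. p l = i}" for l
    by (auto simp: permutes_inverses permutes_inv_eq)
  have "minor A i j C = (\<Sum>l\<in>insert i C. sum ?f {p \<in> ?S. inv p i = l})"
    unfolding minor_def
  proof (intro sum.group[symmetric] fin)
    show "finite (insert i C)" using assms by simp
    show "(\<lambda>p. inv p i) ` ?S \<subseteq> insert i C"
      using permutes_in_image[OF permutes_inv, of _ "insert i C" i] by blast
  qed
  also have "\<dots> = sum ?f {p \<in> ?S. p i = i} + (\<Sum>l\<in>C. sum ?f {p \<in> ?S. p l = i})"
    unfolding * using assms by (subst sum.insert) auto
  also have "sum ?f {p \<in> ?S. p i = i} = A i j * per A C"
  proof -
    have "{p \<in> ?S. p i = i} = {p. p permutes C}"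
      using assms by (auto intro: permutes_superset permutes_subset simp: permutes_not_in)
    moreover have "?f p = A i j * (\<Prod>a\<in>C. A a (p a))" if "p permutes C" for p
    proof -
      have "p i = i" using that assms by (simp add: permutes_not_in)
      moreover have "p a \<noteq> i" if "a \<in> C" for a
        using that \<open>p permutes C\<close> assms by (metis permutes_in_image)
      ultimately show ?thesis using assms by simp
    qed
    ultimately show ?thesis by (simp add: per_def sum_distrib_left)
  qed
  also have "(\<Sum>l\<in>C. sum ?f {p \<in> ?S. p l = i}) = (\<Sum>l\<in>C. A l j * minor A i l (C - {l}))"
  proof (rule sum.cong[OF refl])
    fix l assume l: "l \<in> C"
    let ?D = "insert i (C - {l})" and ?t = "Transposition.transpose i l"
    have il: "i \<noteq> l" using l assms by auto
    \<comment> \<open>Composing with the transposition turns \<open>p l = i\<close> into a fixed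
      point \<open>l\<close>; the row sent to \<open>l\<close> by \<open>p\<close> is now sent to
      \<open>i\<close>, which \<open>minor A i l\<close> reads as column \<open>l\<close>.\<close>
    have "sum ?f {p \<in> ?S. p l = i}
        = (\<Sum>p | p permutes ?D. A l j * (\<Prod>a\<in>?D. A a (if p a = i then l else p a)))"
    proof (rule sum.reindex_bij_witness[of _ "\<lambda>p. ?t \<circ> p" "\<lambda>p. ?t \<circ> p"])
      fix p assume p: "p \<in> {p \<in> ?S. p l = i}"
      show "?t \<circ> (?t \<circ> p) = p" by (simp add: fun_eq_iff)
      have "?t \<circ> p permutes insert i C"
        using p l by (auto intro!: permutes_compose permutes_swap_id)
      moreover have "(?t \<circ> p) l = l" using p by simp
      ultimately have "?t \<circ> p permutes ?D"
        by (rule_tac permutes_superset) (use l in auto)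
      then show "?t \<circ> p \<in> {p. p permutes ?D}" by simp
      have inj: "p a = i \<longleftrightarrow> a = l" for a
        using p by (metis (mono_tags, lifting) mem_Collect_eq permutes_inverses(2))
      have C: "insert i C = insert l ?D" using l by auto
      have "?f p = A l j * (\<Prod>a\<in>?D. A a (if p a = i then j else p a))"
        unfolding C using assms il inj by (subst prod.insert) auto
      also have "(\<Prod>a\<in>?D. A a (if p a = i then j else p a))
          = (\<Prod>a\<in>?D. A a (if (?t \<circ> p) a = i then l else (?t \<circ> p) a))"
        using il by (intro prod.cong) (auto simp: inj Transposition.transpose_def)
      finally show "A l j * (\<Prod>a\<in>?D. A a (if (?t \<circ> p) a = i then l else (?t \<circ> p) a)) = ?f p"
        by simp
    next
      fix p assume p: "p \<in> {p. p permutes ?D}"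
      show "?t \<circ> (?t \<circ> p) = p" by (simp add: fun_eq_iff)
      have "p permutes insert i C" using p by (auto intro: permutes_subset)
      then have "?t \<circ> p permutes insert i C"
        using l by (auto intro!: permutes_compose permutes_swap_id)
      moreover have "p l = l" using p il by (auto simp: permutes_not_in)
      ultimately show "?t \<circ> p \<in> {p \<in> ?S. p l = i}" by simp
    qed
    then show "sum ?f {p \<in> ?S. p l = i} = A l j * minor A i l (C - {l})"
      by (simp add: minor_def sum_distrib_left)
  qed
  finally show ?thesis .
qed

text \<open>Expanding every minor of size \<open>m + 1\<close> yields both halves of the recursion:
  the permanents of \<open>C\<close> come from the diagonal entries at \<open>Min C\<close>, the
  remaining terms \<open>minor A i l (C - {l})\<close> from row \<open>i\<close>.\<close>

lemma bird_eq_minors: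
  fixes A :: "nat \<Rightarrow> nat \<Rightarrow> bit poly"
  shows "bird N A m i j = (\<Sum>C | C \<subseteq> {i<..<N} \<and> card C = m. minor A i j C)"
proof (induction m arbitrary: i j)
  case 0
  have "{C. C \<subseteq> {i<..<N} \<and> card C = 0} = {{}}"
    using finite_subset[of _ "{i<..<N}"] by auto
  then show ?case by (simp add: minor_empty)
next
  case (Suc m)
  let ?P = "\<lambda>i m. {C. C \<subseteq> {i<..<N} \<and> card C = m}"
  have fP: "finite (?P i m)" for i m by simp
  have fC': "finite C" if "C \<subseteq> {i<..<N}" for C i using that finite_subset by blast
  have fC: "finite C" if "C \<in> ?P i m" for C i m using that finite_subset by blast
  have "(\<Sum>C\<in>?P i (Suc m). minor A i j C)
      = (\<Sum>C\<in>?P i (Suc m). A i j * per A C) +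
        (\<Sum>C\<in>?P i (Suc m). \<Sum>l\<in>C. A l j * minor A i l (C - {l}))"
    unfolding sum.distrib[symmetric] using fC
    by (intro sum.cong refl minor_expand) (auto dest: fC)
  also have "(\<Sum>C\<in>?P i (Suc m). A i j * per A C)
      = (\<Sum>l\<in>{i<..<N}. bird N A m l l * A i j)"
  proof -
    have "(\<Sum>C\<in>?P i (Suc m). per A C)
        = (\<Sum>(l, D)\<in>(SIGMA l:{i<..<N}. ?P l m). minor A l l D)"
    proof (rule sum.reindex_bij_witness[of _ "\<lambda>(l, D). insert l D" "\<lambda>C. (Min C, C - {Min C})"])
      fix C assume C: "C \<in> ?P i (Suc m)"
      then have ne: "C \<noteq> {}" "finite C" using fC[OF C] by auto
      then have M: "Min C \<in> C" "\<And>x. x \<in> C \<Longrightarrow> Min C \<le> x" by auto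
      show "(case (Min C, C - {Min C}) of (l, D) \<Rightarrow> insert l D) = C"
        using M(1) by (simp add: insert_absorb)
      have "C - {Min C} \<subseteq> {Min C<..<N}"
        using C M(2) by (auto simp: subset_iff order_less_le)
      then show "(Min C, C - {Min C}) \<in> (SIGMA l:{i<..<N}. ?P l m)"
        using C M(1) ne by (simp add: subset_iff)
      show "(case (Min C, C - {Min C}) of (l, D) \<Rightarrow> minor A l l D) = per A C"
        by (simp only: case_prod_conv per_eq_minor[OF M(1)])
    next
      fix x assume x: "x \<in> (SIGMA l:{i<..<N}. ?P l m)"
      obtain l D where [simp]: "x = (l, D)" by (cases x)
      have D: "l \<in> {i<..<N}" "D \<subseteq> {l<..<N}" "card D = m" "finite D"
        using x finite_subset[of D "{l<..<N}"] by auto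
      have "Min (insert l D) = l" using D by (intro Min_eqI) auto
      then show "(\<lambda>C. (Min C, C - {Min C})) (case x of (l, D) \<Rightarrow> insert l D) = x"
        using D by auto
      show "(case x of (l, D) \<Rightarrow> insert l D) \<in> ?P i (Suc m)"
        using D by (auto simp: card_insert_if)
    qed
    also have "\<dots> = (\<Sum>l\<in>{i<..<N}. \<Sum>D\<in>?P l m. minor A l l D)"
      by (intro sum.Sigma[symmetric]) auto
    finally show ?thesis
      by (simp add: Suc.IH sum_distrib_left[symmetric] sum_distrib_right[symmetric] mult.commute)
  qed
  also have "(\<Sum>C\<in>?P i (Suc m). \<Sum>l\<in>C. A l j * minor A i l (C - {l}))
      = (\<Sum>l\<in>{i<..<N}. bird N A m i l * A l j)"
  proof -
    have "(\<Sum>C\<in>?P i (Suc m). \<Sum>l\<in>C. A l j * minor A i l (C - {l}))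
        = (\<Sum>(C, l)\<in>(SIGMA C:?P i (Suc m). C). A l j * minor A i l (C - {l}))"
      by (intro sum.Sigma ballI fP fC)
    also have "\<dots> = (\<Sum>(l, D)\<in>(SIGMA l:{i<..<N}. {D \<in> ?P i m. l \<notin> D}). A l j * minor A i l D)"
    proof (rule sum.reindex_bij_witness[of _ "\<lambda>(l, D). (insert l D, l)" "\<lambda>(C, l). (l, C - {l})"])
      fix x assume "x \<in> (SIGMA C:?P i (Suc m). C)"
      then obtain C l where "x = (C, l)" "C \<in> ?P i (Suc m)" "l \<in> C" "finite C" by (auto dest: fC')
      then show "(case (case x of (C, l) \<Rightarrow> (l, C - {l})) of (l, D) \<Rightarrow> (insert l D, l)) = x"
        "(case x of (C, l) \<Rightarrow> (l, C - {l})) \<in> (SIGMA l:{i<..<N}. {D \<in> ?P i m. l \<notin> D})"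
        "(case (case x of (C, l) \<Rightarrow> (l, C - {l})) of (l, D) \<Rightarrow> A l j * minor A i l D) =
          (case x of (C, l) \<Rightarrow> A l j * minor A i l (C - {l}))"
        by auto
    next
      fix x assume "x \<in> (SIGMA l:{i<..<N}. {D \<in> ?P i m. l \<notin> D})"
      then obtain D l where D: "x = (l, D)" "l \<in> {i<..<N}" "D \<in> ?P i m" "l \<notin> D"
        by auto
      moreover have "finite D" using fC[OF D(3)] .
      ultimately show "(case (case x of (l, D) \<Rightarrow> (insert l D, l)) of (C, l) \<Rightarrow> (l, C - {l})) = x"
        "(case x of (l, D) \<Rightarrow> (insert l D, l)) \<in> (SIGMA C:?P i (Suc m). C)"
        by auto
    qed
    also have "\<dots> = (\<Sum>l\<in>{i<..<N}. \<Sum>D\<in>{D \<in> ?P i m. l \<notin> D}. A l j * minor A i l D)"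
      by (intro sum.Sigma[symmetric]) auto
    \<comment> \<open>Sets \<open>D\<close> containing \<open>l\<close> may be added because column
      \<open>l\<close> then occurs twice. So the recursion can sum without a side condition.\<close>
    also have "\<dots> = (\<Sum>l\<in>{i<..<N}. \<Sum>D\<in>?P i m. A l j * minor A i l D)"
    proof (intro sum.cong[OF refl] sum.mono_neutral_left[OF fP])
      fix l show "\<forall>D\<in>?P i m - {D \<in> ?P i m. l \<notin> D}. A l j * minor A i l D = 0"
        by (auto intro!: minor_repeated_column intro: fC')
    qed auto
    finally show ?thesis by (simp add: Suc.IH sum_distrib_left sum_distrib_right mult.commute)
  qed
  finally have "(\<Sum>C\<in>?P i (Suc m). minor A i j C) =
      (\<Sum>l\<in>{i<..<N}. bird N A m i l * A l j + bird N A m l l * A i j)"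
    by (simp add: sum.distrib add.commute)
  also have "\<dots> = bird N A (Suc m) i j"
  proof -
    have "{i<..<N} = {l \<in> {..<N}. i < l}" by auto
    then show ?thesis by (simp only: bird.simps sum.inter_filter[OF finite_lessThan])
  qed
  finally show ?case ..
qed

theorem bird_eq_per:
  fixes A :: "nat \<Rightarrow> nat \<Rightarrow> bit poly"
  assumes "N \<ge> 1"
  shows "bird N A (N - 1) 0 0 = per A {..<N}"
proof -
  have "{C. C \<subseteq> {0<..<N} \<and> card C = N - 1} = {{0<..<N}}"
    using card_subset_eq[of "{0<..<N}"] by auto
  moreover have "{..<N} - {0} = {0<..<N}" by auto
  ultimately show ?thesis
    using per_eq_minor[of 0 "{..<N}" A] assms by (simp add: bird_eq_minors)
qed

text \<open>By symmetry a permutation and its inverse have equal products and cancel unless they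
  coincide. In an involution the two rows of a 2-cycle contribute the same entry, hence the
  square.\<close>

theorem per_symmetric:
  fixes A :: "nat \<Rightarrow> nat \<Rightarrow> bit poly"
  assumes sym: "\<And>a b. A a b = A b a"
  shows "per A {..<N} = (\<Sum>p | p permutes {..<N} \<and> p \<circ> p = id.
     \<Prod>a | a < N \<and> a \<le> p a. if p a = a then A a a else (A a (p a))\<^sup>2)"
proof -
  let ?f = "\<lambda>p. \<Prod>a<N. A a (p a)"
  have "per A {..<N} = sum ?f {p \<in> {p. p permutes {..<N}}. inv p = p}"
    unfolding per_def
  proof (rule sum_involution)
    show "finite {p. p permutes {..<N}}" by (simp add: finite_permutations)
    fix p :: "nat \<Rightarrow> nat" assume "p \<in> {p. p permutes {..<N}}"
    then have p: "p permutes {..<N}" by simp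
    show "inv p \<in> {p. p permutes {..<N}}" using p by (simp add: permutes_inv)
    show "inv (inv p) = p" using p by (simp add: permutes_inv_inv)
    show "?f (inv p) = ?f p"
      using prod.permute[OF p, of "\<lambda>a. A a (inv p a)"] sym
      by (simp add: comp_def permutes_inverses[OF p])
  qed
  also have "{p \<in> {p. p permutes {..<N}}. inv p = p} = {p. p permutes {..<N} \<and> p \<circ> p = id}"
  proof -
    have "inv p = p \<longleftrightarrow> p \<circ> p = id" if "p permutes {..<N}" for p
      using permutes_inv_o[OF that] permutes_bij[OF that]
      by (metis bij_is_inj inv_unique_comp)
    then show ?thesis by blast
  qed
  also have "sum ?f \<dots> = (\<Sum>p | p permutes {..<N} \<and> p \<circ> p = id.
     \<Prod>a | a < N \<and> a \<le> p a. if p a = a then A a a else (A a (p a))\<^sup>2)"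
  proof (rule sum.cong[OF refl])
    fix p assume "p \<in> {p. p permutes {..<N} \<and> p \<circ> p = id}"
    then have p: "p permutes {..<N}" and pp: "\<And>a. p (p a) = a" by (auto simp: fun_eq_iff)
    have pN: "p a < N \<longleftrightarrow> a < N" for a using permutes_in_image[OF p] by simp
    let ?L = "{a. a < N \<and> a < p a}" and ?E = "{a. a < N \<and> p a = a}" and ?G = "{a. a < N \<and> p a < a}"
    have "{..<N} = ?L \<union> (?E \<union> ?G)" by auto
    then have "?f p = prod (\<lambda>a. A a (p a)) (?L \<union> (?E \<union> ?G))" by simp
    also have "\<dots> = prod (\<lambda>a. A a (p a)) ?L * (prod (\<lambda>a. A a (p a)) ?E * prod (\<lambda>a. A a (p a)) ?G)"
      by (subst prod.union_disjoint; (subst prod.union_disjoint)?) auto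
    also have "prod (\<lambda>a. A a (p a)) ?G = prod (\<lambda>a. A a (p a)) ?L"
      by (rule prod.reindex_bij_witness[of _ p p]) (auto simp: pp pN sym)
    also have "prod (\<lambda>a. A a (p a)) ?L * (prod (\<lambda>a. A a (p a)) ?E * prod (\<lambda>a. A a (p a)) ?L)
       = prod (\<lambda>a. (A a (p a))\<^sup>2) ?L * prod (\<lambda>a. A a a) ?E"
      by (simp add: power2_eq_square prod.distrib algebra_simps)
    also have "prod (\<lambda>a. (A a (p a))\<^sup>2) ?L =
        prod (\<lambda>a. if p a = a then A a a else (A a (p a))\<^sup>2) ?L" by (intro prod.cong) auto
    also have "prod (\<lambda>a. A a a) ?E =
        prod (\<lambda>a. if p a = a then A a a else (A a (p a))\<^sup>2) ?E" by (intro prod.cong) auto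
    also have "prod (\<lambda>a. if p a = a then A a a else (A a (p a))\<^sup>2) ?L *
       prod (\<lambda>a. if p a = a then A a a else (A a (p a))\<^sup>2) ?E =
       prod (\<lambda>a. if p a = a then A a a else (A a (p a))\<^sup>2) (?L \<union> ?E)"
      by (subst prod.union_disjoint) auto
    also have "?L \<union> ?E = {a. a < N \<and> a \<le> p a}" by auto
    finally show "?f p = (\<Prod>a | a < N \<and> a \<le> p a. if p a = a then A a a else (A a (p a))\<^sup>2)" .
  qed
  finally show ?thesis .
qed

section \<open>Sieving by inclusion and exclusion\<close>

lemma prod_monom_1: "(\<Prod>x\<in>A. monom (1::'a::comm_semiring_1) (f x)) = monom 1 (\<Sum>x\<in>A. f x)"
  by (induction A rule: infinite_finite_induct) (auto simp: mult_monom)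

text \<open>Toggling an element of \<open>S - U\<close> pairs up the supersets of
  \<open>U\<close>.\<close>

lemma sum_supersets_bit_poly:
  assumes "finite S" "U \<subseteq> S"
  shows "(\<Sum>X | X \<subseteq> S \<and> U \<subseteq> X. c) = (if U = S then c else (0 :: bit poly))"
proof (cases "U = S")
  case True
  then have "{X. X \<subseteq> S \<and> U \<subseteq> X} = {S}" by auto
  then show ?thesis using True by simp
next
  case False
  then obtain s where s: "s \<in> S" "s \<notin> U" using assms by auto
  let ?\<phi> = "\<lambda>X. if s \<in> X then X - {s} else insert s X"
  have "(\<Sum>X | X \<subseteq> S \<and> U \<subseteq> X. c)
      = (\<Sum>X \<in> {X \<in> {X. X \<subseteq> S \<and> U \<subseteq> X}. ?\<phi> X = X}. c)"
    using assms s by (intro sum_involution) auto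
  also have "{X \<in> {X. X \<subseteq> S \<and> U \<subseteq> X}. ?\<phi> X = X} = {}" by auto
  finally show ?thesis using False by simp
qed

text \<open>
  A cycle of an involution \<open>p\<close> of the vertices is represented by its smaller element.
  Every cycle \<open>(a, p a)\<close> chooses an option \<open>(m, T)\<close>, where \<open>T\<close> is a set of labels.
\<close>

definition reps :: "nat \<Rightarrow> (nat \<Rightarrow> nat) \<Rightarrow> nat set" where
  "reps N p = {a. a < N \<and> a \<le> p a}"

lemma finite_reps [simp]: "finite (reps N p)"
  by (simp add: reps_def)

definition opts :: "(nat \<Rightarrow> nat \<Rightarrow> bool \<Rightarrow> nat set \<Rightarrow> bool) \<Rightarrow> nat set \<Rightarrow> nat \<Rightarrow> nat \<Rightarrow> (bool \<times> nat set) set" where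
  "opts ok X a b = {(m, T). T \<subseteq> X \<and> ok a b m T}"

lemma finite_opts: "finite X \<Longrightarrow> finite (opts ok X a b)"
  by (rule finite_subset[of _ "UNIV \<times> Pow X"]) (auto simp: opts_def)

text \<open>Off-diagonal entries will be squared, which doubles their exponents; the factor 2 on the
  diagonal makes fixed points and 2-cycles alike.\<close>

definition entry :: "(nat \<Rightarrow> nat \<Rightarrow> bool \<Rightarrow> nat set \<Rightarrow> bool) \<Rightarrow> (nat \<Rightarrow> nat \<Rightarrow> bool \<Rightarrow> nat set \<Rightarrow> nat)
    \<Rightarrow> nat set \<Rightarrow> nat \<Rightarrow> nat \<Rightarrow> 'a::comm_semiring_1 poly" where
  "entry ok ex X a b =
     (\<Sum>(m, T)\<in>opts ok X a b. monom 1 ((if a = b then 2 else 1) * ex a b m T))"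

text \<open>The label sets may overlap, for inclusion and exclusion controls only their union.
  Disjointness is enforced later by the total number of labels.\<close>

definition covers :: "(nat \<Rightarrow> nat \<Rightarrow> bool \<Rightarrow> nat set \<Rightarrow> bool) \<Rightarrow> nat \<Rightarrow> nat set \<Rightarrow>
    ((nat \<Rightarrow> nat) \<times> (nat \<Rightarrow> bool \<times> nat set)) set" where
  "covers ok N S = {(p, g). p permutes {..<N} \<and> p \<circ> p = id \<and>
     g \<in> (\<Pi>\<^sub>E a\<in>reps N p. opts ok S a (p a)) \<and> (\<Union>a\<in>reps N p. snd (g a)) = S}"

definition cycle_sum :: "nat \<Rightarrow> (nat \<Rightarrow> nat \<Rightarrow> bool \<Rightarrow> nat set \<Rightarrow> nat) \<Rightarrow>
    (nat \<Rightarrow> nat) \<times> (nat \<Rightarrow> bool \<times> nat set) \<Rightarrow> nat" where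
  "cycle_sum N f = (\<lambda>(p, g). \<Sum>a\<in>reps N p. f a (p a) (fst (g a)) (snd (g a)))"

lemma finite_covers:
  assumes "finite S"
  shows "finite (covers ok N S)"
proof -
  have "covers ok N S \<subseteq>
    (SIGMA p:{p. p permutes {..<N}}. \<Pi>\<^sub>E a\<in>reps N p. opts ok S a (p a))"
    by (auto simp: covers_def)
  moreover have "finite \<dots>"
    using assms by (intro finite_SigmaI finite_PiE) (auto simp: finite_permutations finite_opts)
  ultimately show ?thesis by (rule finite_subset)
qed

text \<open>A choice of options whose labels have union \<open>U\<close> occurs in the permanents of
  exactly those \<open>X\<close> that contain \<open>U\<close>; summing over these \<open>X\<close>
  removes it unless \<open>U = S\<close>.\<close>

theorem sum_per_entry:
  assumes ok: "\<And>a b m T. ok a b m T = ok b a m T" and ex: "\<And>a b m T. ex a b m T = ex b a m T"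
    and S: "finite S"
  shows "(\<Sum>X | X \<subseteq> S. per (entry ok ex X) {..<N})
    = (\<Sum>x\<in>covers ok N S. monom (1::bit) (2 * cycle_sum N ex x))"
proof -
  let ?I = "{p. p permutes {..<N} \<and> p \<circ> p = id}"
  let ?G = "\<lambda>X p. \<Pi>\<^sub>E a\<in>reps N p. opts ok X a (p a)"
  let ?U = "\<lambda>p g. \<Union>a\<in>reps N p. snd (g a) :: nat set"
  have fI: "finite ?I" by (rule finite_subset[of _ "{p. p permutes {..<N}}"]) (auto simp: finite_permutations)
  have fG: "finite (?G S p)" for p using S by (intro finite_PiE) (auto simp: finite_opts)
  have opts_sym: "opts ok X a b = opts ok X b a" for X a b using ok by (auto simp: opts_def)
  have per: "per (entry ok ex X) {..<N}
    = (\<Sum>p\<in>?I. \<Sum>g\<in>{g \<in> ?G S p. ?U p g \<subseteq> X}. monom (1::bit) (2 * cycle_sum N ex (p, g)))"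
    if X: "X \<subseteq> S" for X
  proof -
    have fX: "finite X" using X S finite_subset by blast
    have "per (entry ok ex X) {..<N} = (\<Sum>p\<in>?I. \<Prod>a | a < N \<and> a \<le> p a.
        if p a = a then entry ok ex X a a else (entry ok ex X a (p a) :: bit poly)\<^sup>2)"
      by (rule per_symmetric) (auto simp: entry_def opts_sym ex)
    also have "\<dots> = (\<Sum>p\<in>?I. \<Sum>g\<in>?G X p. monom (1::bit) (2 * cycle_sum N ex (p, g)))"
    proof (rule sum.cong[OF refl])
      fix p assume "p \<in> ?I"
      have e: "(if p a = a then entry ok ex X a a else (entry ok ex X a (p a) :: bit poly)\<^sup>2)
         = (\<Sum>y\<in>opts ok X a (p a). monom 1 (2 * ex a (p a) (fst y) (snd y)))" for a
        by (auto simp: entry_def square_sum_bit_poly case_prod_beta' monom_power mult.commute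
            intro!: sum.cong)
      have "(\<Prod>a\<in>reps N p. \<Sum>y\<in>opts ok X a (p a). monom (1::bit) (2 * ex a (p a) (fst y) (snd y)))
         = (\<Sum>g\<in>?G X p. \<Prod>a\<in>reps N p. monom (1::bit) (2 * ex a (p a) (fst (g a)) (snd (g a))))"
        using fX by (intro prod_sum_PiE) (auto simp: finite_opts)
      then show "(\<Prod>a | a < N \<and> a \<le> p a. if p a = a then entry ok ex X a a
            else (entry ok ex X a (p a) :: bit poly)\<^sup>2)
          = (\<Sum>g\<in>?G X p. monom (1::bit) (2 * cycle_sum N ex (p, g)))"
        by (simp add: e prod_monom_1 cycle_sum_def sum_distrib_left reps_def)
    qed
    also have "?G X = (\<lambda>p. {g \<in> ?G S p. ?U p g \<subseteq> X})"
    proof (rule ext)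
      fix p show "?G X p = {g \<in> ?G S p. ?U p g \<subseteq> X}"
    proof (intro set_eqI iffI)
      fix g assume "g \<in> ?G X p"
      then have g: "\<And>a. a \<in> reps N p \<Longrightarrow> g a \<in> opts ok X a (p a)" "g \<in> extensional (reps N p)"
        unfolding PiE_iff by blast+
      have "g a \<in> opts ok S a (p a) \<and> snd (g a) \<subseteq> X" if "a \<in> reps N p" for a
        using g(1)[OF that] X unfolding opts_def by auto
      then show "g \<in> {g \<in> ?G S p. ?U p g \<subseteq> X}"
        using g(2) unfolding PiE_iff by blast
    next
      fix g assume g: "g \<in> {g \<in> ?G S p. ?U p g \<subseteq> X}"
      have "g a \<in> opts ok X a (p a)" if a: "a \<in> reps N p" for a
      proof -
        have "g a \<in> opts ok S a (p a)" "snd (g a) \<subseteq> X" using g a unfolding PiE_iff by blast+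
        then show ?thesis unfolding opts_def by auto
      qed
      then show "g \<in> ?G X p" using g unfolding PiE_iff by blast
    qed
    qed
    finally show ?thesis .
  qed
  have "(\<Sum>X | X \<subseteq> S. per (entry ok ex X) {..<N}) =
    (\<Sum>X | X \<subseteq> S. \<Sum>p\<in>?I. \<Sum>g\<in>{g \<in> ?G S p. ?U p g \<subseteq> X}. monom (1::bit) (2 * cycle_sum N ex (p, g)))"
    using per by (intro sum.cong) auto
  also have "\<dots> = (\<Sum>p\<in>?I. \<Sum>X | X \<subseteq> S. \<Sum>g\<in>{g \<in> ?G S p. ?U p g \<subseteq> X}. monom (1::bit) (2 * cycle_sum N ex (p, g)))"
    by (rule sum.swap)
  also have "\<dots> = (\<Sum>p\<in>?I. \<Sum>g\<in>?G S p. \<Sum>X\<in>{X \<in> {X. X \<subseteq> S}. ?U p g \<subseteq> X}. monom (1::bit) (2 * cycle_sum N ex (p, g)))"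
    using S fG by (intro sum.cong[OF refl] sum.swap_restrict) auto
  also have "\<dots> = (\<Sum>p\<in>?I. \<Sum>g\<in>?G S p. if ?U p g = S then monom (1::bit) (2 * cycle_sum N ex (p, g)) else 0)"
  proof (intro sum.cong[OF refl])
    fix p g assume "g \<in> ?G S p"
    then have "?U p g \<subseteq> S" by (fastforce simp: PiE_iff opts_def)
    then show "(\<Sum>X\<in>{X \<in> {X. X \<subseteq> S}. ?U p g \<subseteq> X}. monom (1::bit) (2 * cycle_sum N ex (p, g))) =
       (if ?U p g = S then monom (1::bit) (2 * cycle_sum N ex (p, g)) else 0)"
      using sum_supersets_bit_poly[OF S, of "?U p g"] by simp
  qed
  also have "\<dots> = (\<Sum>p\<in>?I. \<Sum>g\<in>{g \<in> ?G S p. ?U p g = S}. monom (1::bit) (2 * cycle_sum N ex (p, g)))"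
    by (intro sum.cong[OF refl] sum.inter_filter[symmetric] fG)
  also have "\<dots> = (\<Sum>(p, g)\<in>(SIGMA p:?I. {g \<in> ?G S p. ?U p g = S}). monom (1::bit) (2 * cycle_sum N ex (p, g)))"
    using fI fG by (intro sum.Sigma) auto
  also have "(SIGMA p:?I. {g \<in> ?G S p. ?U p g = S}) = covers ok N S"
    by (auto simp: covers_def)
  finally show ?thesis by (simp add: case_prod_beta')
qed

corollary coeff_sum_per_entry:
  assumes "\<And>a b m T. ok a b m T = ok b a m T" "\<And>a b m T. ex a b m T = ex b a m T" "finite S"
  shows "coeff (\<Sum>X | X \<subseteq> S. per (entry ok ex X) {..<N} :: bit poly) (2 * e)
    = of_nat (card {x \<in> covers ok N S. cycle_sum N ex x = e})"
proof -
  have "(\<Sum>x\<in>covers ok N S. if cycle_sum N ex x = e then 1 else (0::bit))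
      = (\<Sum>x\<in>{x \<in> covers ok N S. cycle_sum N ex x = e}. 1)"
    by (rule sum.inter_filter[symmetric]) (simp add: finite_covers assms)
  then show ?thesis
    by (simp add: sum_per_entry[OF assms] coeff_sum)
qed

section \<open>The isolation lemma\<close>

definition isolated :: "nat set set \<Rightarrow> (nat \<Rightarrow> nat) \<Rightarrow> bool" where
  "isolated F w \<longleftrightarrow> (\<exists>A\<in>F. \<forall>B\<in>F. B \<noteq> A \<longrightarrow> sum w A < sum w B)"

text \<open>If the lightest set is not unique, some \<open>x\<close> lies in one lightest set but
  not in another. Then the weight of \<open>x\<close> is determined by the other weights, so each of
  the \<open>u\<close> possible \<open>x\<close> accounts for at most \<open>W ^ (u - 1)\<close>
  weightings.\<close>

lemma card_not_isolated:
  assumes F: "F \<noteq> {}" "F \<subseteq> Pow {..<u}"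
  shows "card {w \<in> {..<u} \<rightarrow>\<^sub>E {..<W}. \<not> isolated F w} \<le> u * W ^ (u - 1)"
proof -
  define minimal where "minimal w A \<longleftrightarrow> A \<in> F \<and> (\<forall>C\<in>F. sum w A \<le> sum w C)" for w :: "nat \<Rightarrow> nat" and A
  define bad where "bad x = {w \<in> {..<u} \<rightarrow>\<^sub>E {..<W}. \<exists>A B. minimal w A \<and> minimal w B \<and> x \<in> A \<and> x \<notin> B}"
    for x
  have finF: "finite A" if "A \<in> F" for A using that F(2) finite_subset[of A "{..<u}"] by auto
  have fin: "finite F" using F(2) finite_subset by blast
  have "{w \<in> {..<u} \<rightarrow>\<^sub>E {..<W}. \<not> isolated F w} \<subseteq> (\<Union>x<u. bad x)"
  proof
    fix w assume w: "w \<in> {w \<in> {..<u} \<rightarrow>\<^sub>E {..<W}. \<not> isolated F w}"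
    have "Min (sum w ` F) \<in> sum w ` F" using F(1) fin by (intro Min_in) auto
    then obtain A where "A \<in> F" "sum w A = Min (sum w ` F)" by auto
    then have A: "minimal w A" using fin by (simp add: minimal_def)
    have AF: "A \<in> F" using A by (simp add: minimal_def)
    have "\<not> isolated F w" using w by blast
    then have "\<exists>B\<in>F. B \<noteq> A \<and> \<not> sum w A < sum w B" using AF unfolding isolated_def by blast
    then obtain B where B: "B \<in> F" "B \<noteq> A" "\<not> sum w A < sum w B" by blast
    have B': "minimal w B" using A B(1,3) unfolding minimal_def by fastforce
    from B(2) obtain x where x: "x \<in> A \<and> x \<notin> B \<or> x \<in> B \<and> x \<notin> A" by blast
    then have "x < u" using AF B(1) F(2) by blast
    moreover have "w \<in> bad x"
    proof -
      have "\<exists>A B. minimal w A \<and> minimal w B \<and> x \<in> A \<and> x \<notin> B" using x A B' by blast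
      then show ?thesis using w unfolding bad_def by blast
    qed
    ultimately show "w \<in> (\<Union>x<u. bad x)" by blast
  qed
  moreover have fb: "finite (bad x)" for x
    by (rule finite_subset[of _ "{..<u} \<rightarrow>\<^sub>E {..<W}"]) (auto simp: bad_def intro!: finite_PiE)
  moreover have "card (bad x) \<le> W ^ (u - 1)" if x: "x < u" for x
  proof -
    let ?D = "{..<u} - {x}"
    have "inj_on (\<lambda>w. restrict w ?D) (bad x)"
    proof (rule inj_onI)
      fix w w' assume w: "w \<in> bad x" "w' \<in> bad x" and eq: "restrict w ?D = restrict w' ?D"
      from w obtain A B A' B' where *: "minimal w A" "minimal w B" "x \<in> A" "x \<notin> B"
        "minimal w' A'" "minimal w' B'" "x \<in> A'" "x \<notin> B'" unfolding bad_def by blast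
      have agree: "w i = w' i" if "i < u" "i \<noteq> x" for i
        using fun_cong[OF eq, of i] that by simp
      have s1: "sum w C = sum w' C" if "C \<in> F" "x \<notin> C" for C
        using that F(2) by (intro sum.cong refl agree) auto
      have s2: "sum w C = w x + sum w (C - {x})" "sum w' C = w' x + sum w (C - {x})" if "C \<in> F" "x \<in> C" for C
      proof -
        have "sum w' (C - {x}) = sum w (C - {x})"
          using that F(2) by (intro sum.cong refl agree[symmetric]) auto
        then show "sum w C = w x + sum w (C - {x})" "sum w' C = w' x + sum w (C - {x})"
          using that finF sum.remove[of C x w] sum.remove[of C x w'] by auto
      qed
      have F4: "A \<in> F" "B \<in> F" "A' \<in> F" "B' \<in> F" using * by (auto simp: minimal_def)
      have "sum w A \<le> sum w A'" "sum w' A' \<le> sum w' A" "sum w B \<le> sum w B'" "sum w' B' \<le> sum w' B"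
        "sum w A = sum w B" "sum w' A' = sum w' B'"
        using * unfolding minimal_def by (blast intro: antisym)+
      \<comment> \<open>Sets avoiding \<open>x\<close> weigh the same under \<open>w\<close> and
        \<open>w'\<close>, so both have the same minimum; sets containing \<open>x\<close> vary only
        by the weight of \<open>x\<close>, which is thereby fixed.\<close>
      then have "w x = w' x"
        using s1[OF F4(2)] s1[OF F4(4)] s2[OF F4(1)] s2[OF F4(3)] * by linarith
      then have "w i = w' i" if "i < u" for i using agree that by (cases "i = x") auto
      then show "w = w'" using w unfolding bad_def by (intro PiE_ext[of w "{..<u}" _ w']) auto
    qed
    moreover have "(\<lambda>w. restrict w ?D) ` bad x \<subseteq> ?D \<rightarrow>\<^sub>E {..<W}"
    proof -
      have "bad x \<subseteq> {..<u} \<rightarrow>\<^sub>E {..<W}" unfolding bad_def by blast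
      then have "w i < W" if "w \<in> bad x" "i < u" for w i using that by (auto dest: PiE_mem)
      then show ?thesis by (auto split: if_splits)
    qed
    ultimately have "card (bad x) \<le> card (?D \<rightarrow>\<^sub>E {..<W})"
      by (rule card_inj_on_le) (simp add: finite_PiE)
    also have "\<dots> = W ^ (u - 1)" using x by (simp add: card_PiE card_Diff_singleton)
    finally show ?thesis .
  qed
  ultimately have "card {w \<in> {..<u} \<rightarrow>\<^sub>E {..<W}. \<not> isolated F w} \<le> (\<Sum>x<u. W ^ (u - 1))"
    by (intro order_trans[OF card_mono order_trans[OF card_UN_le sum_mono]]) auto
  then show ?thesis by simp
qed

text \<open>All weights are read off as base-\<open>W\<close> digits of a single random number below
  \<open>W ^ u\<close>.\<close>

definition digit :: "nat \<Rightarrow> nat \<Rightarrow> nat \<Rightarrow> nat" where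
  "digit W R i = R div W ^ i mod W"

lemma digit_inject:
  assumes "R < W ^ u" "R' < W ^ u" "\<And>i. i < u \<Longrightarrow> digit W R i = digit W R' i"
  shows "R = R'"
  using assms
proof (induction u arbitrary: R R')
  case (Suc u)
  then have W: "W > 0" by (cases "W = 0") auto
  have "R div W = R' div W"
  proof (rule Suc.IH)
    show "R div W < W ^ u" "R' div W < W ^ u"
      using Suc.prems(1,2) W by (auto simp: less_mult_imp_div_less mult.commute)
    show "digit W (R div W) i = digit W (R' div W) i" if "i < u" for i
      using Suc.prems(3)[of "Suc i"] that by (simp add: digit_def div_mult2_eq)
  qed
  moreover have "R mod W = R' mod W" using Suc.prems(3)[of 0] by (simp add: digit_def)
  ultimately show ?case by (metis div_mult_mod_eq)
qed auto

lemma isolated_cong: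
  assumes "F \<subseteq> Pow {..<u}" "\<And>i. i < u \<Longrightarrow> w i = w' i"
  shows "isolated F w = isolated F w'"
proof -
  have "sum w A = sum w' A" if "A \<in> F" for A using that assms by (intro sum.cong) auto
  then show ?thesis unfolding isolated_def by simp
qed

theorem isolation_lemma:
  assumes F: "F \<noteq> {}" "F \<subseteq> Pow {..<u}" and W: "W > 0"
  shows "card {R. R < W ^ u \<and> \<not> isolated F (digit W R)} \<le> u * W ^ (u - 1)"
proof -
  let ?f = "\<lambda>R. restrict (digit W R) {..<u}"
  have "card {R. R < W ^ u \<and> \<not> isolated F (digit W R)}
      \<le> card {w \<in> {..<u} \<rightarrow>\<^sub>E {..<W}. \<not> isolated F w}"
  proof (rule card_inj_on_le[of ?f])
    show "inj_on ?f {R. R < W ^ u \<and> \<not> isolated F (digit W R)}"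
    proof (rule inj_onI)
      fix R R' assume *: "R \<in> {R. R < W ^ u \<and> \<not> isolated F (digit W R)}"
        "R' \<in> {R. R < W ^ u \<and> \<not> isolated F (digit W R)}" and eq: "?f R = ?f R'"
      have "digit W R i = digit W R' i" if "i < u" for i using fun_cong[OF eq, of i] that by simp
      then show "R = R'" using * by (intro digit_inject[of R W u R']) auto
    qed
    show "?f ` {R. R < W ^ u \<and> \<not> isolated F (digit W R)} \<subseteq> {w \<in> {..<u} \<rightarrow>\<^sub>E {..<W}. \<not> isolated F w}"
    proof
      fix w assume "w \<in> ?f ` {R. R < W ^ u \<and> \<not> isolated F (digit W R)}"
      then obtain R where R: "w = ?f R" "\<not> isolated F (digit W R)" by auto
      have "isolated F w = isolated F (digit W R)"
        by (rule isolated_cong[OF F(2)]) (simp add: R)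
      moreover have "w \<in> {..<u} \<rightarrow>\<^sub>E {..<W}" using W by (auto simp: R digit_def)
      ultimately show "w \<in> {w \<in> {..<u} \<rightarrow>\<^sub>E {..<W}. \<not> isolated F w}" using R by simp
    qed
    show "finite {w \<in> {..<u} \<rightarrow>\<^sub>E {..<W}. \<not> isolated F w}"
      by (rule finite_subset[of _ "{..<u} \<rightarrow>\<^sub>E {..<W}"]) (auto intro!: finite_PiE)
  qed
  then show ?thesis using card_not_isolated[OF F, of W] by linarith
qed

section \<open>Executions with bounded cost\<close>

lemma bit_len_le_iff: "1 \<le> L \<Longrightarrow> bit_len x \<le> L \<longleftrightarrow> x < 2 ^ L"
proof (cases "x = 0")
  case False
  assume L: "1 \<le> L"
  show ?thesis
  proof
    assume "bit_len x \<le> L"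
    then have "(2::nat) * 2 ^ floor_log x \<le> 2 ^ L"
      unfolding bit_len_def power_Suc[symmetric] by (intro power_increasing) auto
    then show "x < 2 ^ L" using floor_log_exp2_gt[of x] by linarith
  next
    assume "x < 2 ^ L"
    then have "(2::nat) ^ floor_log x < 2 ^ L"
      using floor_log_exp2_le[of x] False by linarith
    then show "bit_len x \<le> L" by (simp add: bit_len_def)
  qed
qed (simp add: bit_len_def)

lemma bit_len_mono: "x \<le> y \<Longrightarrow> bit_len x \<le> bit_len y"
  by (simp add: bit_len_def floor_log_le_iff)

lemma bit_len_pos: "1 \<le> bit_len x"
  by (simp add: bit_len_def)

lemma less_two_power_bit_len: "x < 2 ^ bit_len x"
  using bit_len_le_iff[OF bit_len_pos] by blast

lemma bit_len_le_self: "bit_len x \<le> Suc x"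
  using bit_len_le_iff[of "Suc x" x] less_exp[of "Suc x"] by simp

lemma bit_len_simps [simp]: "bit_len 0 = 1" "bit_len (Suc 0) = 1"
  by (auto simp: bit_len_def)

lemma bit_len_arith: "bit_len (arith f x y) \<le> bit_len x + bit_len y"
proof (cases f)
  let ?a = "bit_len x" and ?b = "bit_len y"
  have *: "x < 2 ^ ?a" "y < 2 ^ ?b" "1 \<le> ?a" "1 \<le> ?b"
    using less_two_power_bit_len bit_len_pos by blast+
  then obtain a b where ab: "?a = Suc a" "?b = Suc b" by (metis Suc_le_D One_nat_def)
  {
    case Plus
    have "(2::nat) ^ Suc a + 2 ^ Suc b \<le> 2 ^ (Suc a + Suc b)"
    proof -
      have "(1::nat) \<le> 2 ^ a" "(1::nat) \<le> 2 ^ b" by auto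
      then have "(2::nat) ^ a * 1 \<le> 2 ^ a * 2 ^ b" "1 * (2::nat) ^ b \<le> 2 ^ a * 2 ^ b"
        by (intro mult_le_mono; simp)+
      then show ?thesis by (simp only: power_add power_Suc)
    qed
    then have "x + y < 2 ^ (?a + ?b)" using * ab by simp
    then show ?thesis using Plus bit_len_le_iff[of "?a + ?b" "x + y"] ab by simp
  next
    case Times
    have "x * y < 2 ^ (?a + ?b)"
      unfolding power_add using * by (intro mult_strict_mono) auto
    then show ?thesis using Times bit_len_le_iff[of "?a + ?b" "x * y"] ab by simp
  next
    case Minus
    then show ?thesis using bit_len_mono[of "x - y" x] by simp
  next
    case Quot
    then show ?thesis using bit_len_mono[of "x div y" x] by simp
  next
    case Rem
    then show ?thesis using bit_len_mono[of "x mod y" x] by simp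
  }
qed

definition runs :: "prog \<Rightarrow> mstate \<Rightarrow> bool stream \<Rightarrow> mstate \<Rightarrow> bool stream \<Rightarrow> nat \<Rightarrow> bool" where
  "runs c s \<omega> t \<omega>' T \<longleftrightarrow> (\<exists>m\<le>T. exec c s \<omega> t \<omega>' m)"

lemma runs_mono: "runs c s \<omega> t \<omega>' T \<Longrightarrow> T \<le> T' \<Longrightarrow> runs c s \<omega> t \<omega>' T'"
  unfolding runs_def by (meson order_trans)

lemma runs_Assign:
  "cost_expr e (R, M) \<le> T \<Longrightarrow> runs (Assign r e) (R, M) \<omega> (R(r := eval_expr e (R, M)), M) \<omega> T"
  by (auto simp: runs_def intro: exec.Assign)

lemma runs_Store:
  "cost_expr a (R, M) + cost_expr e (R, M) \<le> T \<Longrightarrow>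
    runs (Store a e) (R, M) \<omega> (R, M(eval_expr a (R, M) := eval_expr e (R, M))) \<omega> T"
  by (auto simp: runs_def intro: exec.Store)

lemma runs_Flip: "runs (Flip r) (R, M) \<omega> (R(r := of_bool (shd \<omega>)), M) (stl \<omega>) 1"
  unfolding runs_def by (intro exI[of _ 1] conjI exec.Flip order_refl)

lemma runs_Seq:
  "runs c1 s \<omega> t \<omega>' m \<Longrightarrow> runs c2 t \<omega>' u \<omega>'' n \<Longrightarrow> runs (Seq c1 c2) s \<omega> u \<omega>'' (m + n)"
  unfolding runs_def by (meson add_mono exec.Seq)

text \<open>\<open>w i\<close> is the stream of coins left after \<open>i\<close> rounds: constant
  for deterministic loops, \<open>sdrop i \<omega>\<close> for the loop that tosses coins.\<close>

lemma runs_Loop: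
  assumes step: "\<And>i s. i < b \<Longrightarrow> Inv i s \<Longrightarrow> eval_expr e s \<noteq> 0 \<and> cost_expr e s \<le> C \<and>
      (\<exists>s'. Inv (Suc i) s' \<and> runs c s (w i) s' (w (Suc i)) T)"
    and stop: "\<And>s. Inv b s \<Longrightarrow> eval_expr e s = 0 \<and> cost_expr e s \<le> C"
    and "Inv 0 s"
  shows "\<exists>s'. Inv b s' \<and> runs (Loop e c) s (w 0) s' (w b) (b * (C + T) + C)"
proof -
  have "\<exists>s'. Inv b s' \<and> runs (Loop e c) s (w (b - j)) s' (w b) (j * (C + T) + C)"
    if "j \<le> b" "Inv (b - j) s" for j s
    using that
  proof (induction j arbitrary: s)
    case 0
    then show ?case using stop[of s] exec.LoopFalse[of e s c "w b"] by (fastforce simp: runs_def)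
  next
    case (Suc j)
    then have bj: "Suc (b - Suc j) = b - j" by simp
    from step[OF _ Suc.prems(2)] Suc.prems(1) obtain s' where s':
      "eval_expr e s \<noteq> 0" "cost_expr e s \<le> C" "Inv (b - j) s'"
      "runs c s (w (b - Suc j)) s' (w (b - j)) T"
      unfolding bj by auto
    from Suc.IH[OF _ s'(3)] Suc.prems(1) obtain t where t: "Inv b t"
      "runs (Loop e c) s' (w (b - j)) t (w b) (j * (C + T) + C)" by auto
    from s'(4) t(2) obtain m n where mn: "m \<le> T" "n \<le> j * (C + T) + C"
      "exec c s (w (b - Suc j)) s' (w (b - j)) m" "exec (Loop e c) s' (w (b - j)) t (w b) n"
      by (auto simp: runs_def)
    then have "exec (Loop e c) s (w (b - Suc j)) t (w b) (cost_expr e s + m + n)"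
      using s'(1) by (intro exec.LoopTrue)
    moreover have "cost_expr e s + m + n \<le> Suc j * (C + T) + C"
      using mn(1,2) s'(2) by simp
    ultimately show ?case using t(1) unfolding runs_def by blast
  qed
  from this[of b s] assms(3) show ?thesis by simp
qed

section \<open>Expressions with bounded sums and products\<close>

text \<open>Evaluation is total and the only loops are sums and products whose bounds are known on
  entry. This permits one cost analysis for all expressions instead of one for each program.\<close>

datatype xexp =
    XC nat
  | XV nat
  | XL xexp
  | XA arith_op xexp xexp
  | XS nat xexp xexp
  | XP nat xexp xexp

fun xeval :: "xexp \<Rightarrow> (nat \<Rightarrow> nat) \<Rightarrow> (nat \<Rightarrow> nat) \<Rightarrow> nat" where
  "xeval (XC c) \<sigma> M = c"
| "xeval (XV v) \<sigma> M = \<sigma> v"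
| "xeval (XL x) \<sigma> M = M (xeval x \<sigma> M)"
| "xeval (XA f x y) \<sigma> M = arith f (xeval x \<sigma> M) (xeval y \<sigma> M)"
| "xeval (XS v b x) \<sigma> M = (\<Sum>i<xeval b \<sigma> M. xeval x (\<sigma>(v := i)) M)"
| "xeval (XP v b x) \<sigma> M = (\<Prod>i<xeval b \<sigma> M. xeval x (\<sigma>(v := i)) M)"

fun loops_le :: "xexp \<Rightarrow> (nat \<Rightarrow> nat) \<Rightarrow> (nat \<Rightarrow> nat) \<Rightarrow> nat \<Rightarrow> bool" where
  "loops_le (XC c) \<sigma> M L \<longleftrightarrow> True"
| "loops_le (XV v) \<sigma> M L \<longleftrightarrow> True"
| "loops_le (XL x) \<sigma> M L \<longleftrightarrow> loops_le x \<sigma> M L"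
| "loops_le (XA f x y) \<sigma> M L \<longleftrightarrow> loops_le x \<sigma> M L \<and> loops_le y \<sigma> M L"
| "loops_le (XS v b x) \<sigma> M L \<longleftrightarrow> loops_le b \<sigma> M L \<and> xeval b \<sigma> M \<le> L \<and>
     (\<forall>i<xeval b \<sigma> M. loops_le x (\<sigma>(v := i)) M L)"
| "loops_le (XP v b x) \<sigma> M L \<longleftrightarrow> loops_le b \<sigma> M L \<and> xeval b \<sigma> M \<le> L \<and>
     (\<forall>i<xeval b \<sigma> M. loops_le x (\<sigma>(v := i)) M L)"

text \<open>Register \<open>d\<close> holds the bound, \<open>d + 1\<close> the accumulator,
  \<open>d + 2\<close> the index and \<open>d + 3\<close> the current term.\<close>

definition bigc :: "arith_op \<Rightarrow> nat \<Rightarrow> nat \<Rightarrow> prog \<Rightarrow> prog \<Rightarrow> prog" where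
  "bigc f u d cb cx =
     Seq cb (Seq (Assign (d + 1) (Const u)) (Seq (Assign (d + 2) (Const 0)) (Seq
       (Loop (Arith Minus (Reg d) (Reg (d + 2)))
         (Seq cx (Seq (Assign (d + 1) (Arith f (Reg (d + 1)) (Reg (d + 3))))
                      (Assign (d + 2) (Arith Plus (Reg (d + 2)) (Const 1))))))
       (Assign d (Reg (d + 1))))))"

text \<open>
  \<open>xcomp \<rho> d x\<close> leaves the value of \<open>x\<close> in register \<open>d\<close> and changes no register below \<open>d\<close>;
  the variable \<open>v\<close> lives in register \<open>\<rho> v\<close>.
\<close>

fun xcomp :: "(nat \<Rightarrow> nat) \<Rightarrow> nat \<Rightarrow> xexp \<Rightarrow> prog" where
  "xcomp \<rho> d (XC c) = Assign d (Const c)"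
| "xcomp \<rho> d (XV v) = Assign d (Reg (\<rho> v))"
| "xcomp \<rho> d (XL x) = Seq (xcomp \<rho> d x) (Assign d (Load (Reg d)))"
| "xcomp \<rho> d (XA f x y) =
     Seq (xcomp \<rho> d x) (Seq (xcomp \<rho> (d + 1) y) (Assign d (Arith f (Reg d) (Reg (d + 1)))))"
| "xcomp \<rho> d (XS v b x) = bigc Plus 0 d (xcomp \<rho> d b) (xcomp (\<rho>(v := d + 2)) (d + 3) x)"
| "xcomp \<rho> d (XP v b x) = bigc Times 1 d (xcomp \<rho> d b) (xcomp (\<rho>(v := d + 2)) (d + 3) x)"

text \<open>Outside the rounds \<open>6 * Q\<close> pays for two initialisations, the failing test
  (\<open>3 * Q\<close>) and the final copy; in every round the test, the update and the increment
  cost \<open>3 * Q\<close> each.\<close>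

lemma runs_bigc:
  assumes cb: "runs cb (R, M) \<omega> (R1, M) \<omega> T1" "R1 d = b" "\<And>r. r < d \<Longrightarrow> R1 r = R r"
    and cx: "\<And>i R'. i < b \<Longrightarrow> (\<And>r. r < d \<Longrightarrow> R' r = R r) \<Longrightarrow> R' (d + 2) = i \<Longrightarrow>
      \<exists>R''. runs cx (R', M) \<omega> (R'', M) \<omega> T2 \<and> R'' (d + 3) = x i \<and> (\<forall>r<d + 3. R'' r = R' r)"
    and g: "g 0 = u" "\<And>i. i < b \<Longrightarrow> g (Suc i) = arith f (g i) (x i)"
    and Q: "bit_len b \<le> Q" "\<And>i. i \<le> b \<Longrightarrow> bit_len (g i) \<le> Q" "\<And>i. i < b \<Longrightarrow> bit_len (x i) \<le> Q"
  shows "\<exists>R'. runs (bigc f u d cb cx) (R, M) \<omega> (R', M) \<omega> (T1 + 6 * Q + b * (9 * Q + T2)) \<and>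
    R' d = g b \<and> (\<forall>r<d. R' r = R r)"
proof -
  have Q1: "1 \<le> Q" using Q(1) bit_len_pos[of b] by linarith
  have Qi: "bit_len i \<le> Q" if "i \<le> b" for i using bit_len_mono[OF that] Q(1) by linarith
  define Inv where "Inv i s \<longleftrightarrow> (\<exists>R'. s = (R', M) \<and> (\<forall>r<d. R' r = R r) \<and> R' d = b \<and>
    R' (d + 1) = g i \<and> R' (d + 2) = i)" for i and s :: mstate
  let ?e = "Arith Minus (Reg d) (Reg (d + 2))"
  let ?c = "Seq cx (Seq (Assign (d + 1) (Arith f (Reg (d + 1)) (Reg (d + 3))))
                      (Assign (d + 2) (Arith Plus (Reg (d + 2)) (Const 1))))"
  define R2 where "R2 = R1(d + 1 := u, d + 2 := 0)"
  have "\<exists>s'. Inv b s' \<and> runs (Loop ?e ?c) (R2, M) \<omega> s' \<omega> (b * (3 * Q + (T2 + (3 * Q + 3 * Q))) + 3 * Q)"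
  proof (rule runs_Loop[where w = "\<lambda>_. \<omega>" and Inv = Inv])
    show "Inv 0 (R2, M)" using cb g by (auto simp: Inv_def R2_def)
    show "eval_expr ?e s = 0 \<and> cost_expr ?e s \<le> 3 * Q" if "Inv b s" for s
      using that Qi[of b] Qi[of 0] by (auto simp: Inv_def)
    fix i s assume i: "i < b" and "Inv i s"
    then obtain R' where R': "s = (R', M)" "\<And>r. r < d \<Longrightarrow> R' r = R r" "R' d = b"
      "R' (d + 1) = g i" "R' (d + 2) = i" by (auto simp: Inv_def)
    from cx[OF i R'(2,5)] obtain R'' where R'': "runs cx (R', M) \<omega> (R'', M) \<omega> T2"
      "R'' (d + 3) = x i" "\<And>r. r < d + 3 \<Longrightarrow> R'' r = R' r" by blast
    define R3 where "R3 = R''(d + 1 := g (Suc i))"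
    have "runs (Assign (d + 1) (Arith f (Reg (d + 1)) (Reg (d + 3)))) (R'', M) \<omega>
      (R''(d + 1 := eval_expr (Arith f (Reg (d + 1)) (Reg (d + 3))) (R'', M)), M) \<omega> (3 * Q)"
      using R'' R' g(2)[OF i] Q(2)[of i] Q(2)[of "Suc i"] Q(3)[OF i] i by (intro runs_Assign) auto
    moreover have "eval_expr (Arith f (Reg (d + 1)) (Reg (d + 3))) (R'', M) = g (Suc i)"
      using R'' R' g(2)[OF i] by simp
    ultimately have 1: "runs (Assign (d + 1) (Arith f (Reg (d + 1)) (Reg (d + 3)))) (R'', M) \<omega>
      (R3, M) \<omega> (3 * Q)" by (simp add: R3_def)
    define R4 where "R4 = R3(d + 2 := Suc i)"
    have "runs (Assign (d + 2) (Arith Plus (Reg (d + 2)) (Const 1))) (R3, M) \<omega>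
      (R3(d + 2 := eval_expr (Arith Plus (Reg (d + 2)) (Const 1)) (R3, M)), M) \<omega> (3 * Q)"
      using R'' R' Qi[of i] Qi[of "Suc i"] i Q1 by (intro runs_Assign) (auto simp: R3_def)
    moreover have "eval_expr (Arith Plus (Reg (d + 2)) (Const 1)) (R3, M) = Suc i"
      using R'' R' by (simp add: R3_def)
    ultimately have 2: "runs (Assign (d + 2) (Arith Plus (Reg (d + 2)) (Const 1))) (R3, M) \<omega>
      (R4, M) \<omega> (3 * Q)" by (simp add: R4_def)
    have "runs ?c s \<omega> (R4, M) \<omega> (T2 + (3 * Q + 3 * Q))"
      unfolding R'(1) by (intro runs_Seq[OF R''(1)] runs_Seq[OF 1] 2)
    moreover have "Inv (Suc i) (R4, M)"
      using R'' R' by (auto simp: Inv_def R4_def R3_def)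
    moreover have "eval_expr ?e s \<noteq> 0" using R' i by simp
    moreover have "cost_expr ?e s \<le> 3 * Q"
      using R' Qi[of i] Qi[of b] Qi[of "b - i"] i by simp
    ultimately show "eval_expr ?e s \<noteq> 0 \<and> cost_expr ?e s \<le> 3 * Q \<and>
      (\<exists>s'. Inv (Suc i) s' \<and> runs ?c s \<omega> s' \<omega> (T2 + (3 * Q + 3 * Q)))" by blast
  qed
  then obtain R5 where R5: "Inv b (R5, M)"
    "runs (Loop ?e ?c) (R2, M) \<omega> (R5, M) \<omega> (b * (3 * Q + (T2 + (3 * Q + 3 * Q))) + 3 * Q)"
    by (auto simp: Inv_def)
  have 1: "runs (Assign (d + 1) (Const u)) (R1, M) \<omega> (R1(d + 1 := u), M) \<omega> Q"
    using runs_Assign[of "Const u" R1 M Q "d + 1" \<omega>] Q(2)[of 0] g(1) by simp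
  have 2: "runs (Assign (d + 2) (Const 0)) (R1(d + 1 := u), M) \<omega> (R2, M) \<omega> Q"
    using runs_Assign[of "Const 0" "R1(d + 1 := u)" M Q "d + 2" \<omega>] Q1 by (simp add: R2_def)
  have 3: "runs (Assign d (Reg (d + 1))) (R5, M) \<omega> (R5(d := g b), M) \<omega> Q"
    using runs_Assign[of "Reg (d + 1)" R5 M Q d \<omega>] R5(1) Q(2)[of b] by (auto simp: Inv_def)
  have "runs (bigc f u d cb cx) (R, M) \<omega> (R5(d := g b), M) \<omega>
     (T1 + (Q + (Q + ((b * (3 * Q + (T2 + (3 * Q + 3 * Q))) + 3 * Q) + Q))))"
    unfolding bigc_def by (intro runs_Seq[OF cb(1)] runs_Seq[OF 1] runs_Seq[OF 2] runs_Seq[OF R5(2)] 3)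
  moreover have "T1 + (Q + (Q + ((b * (3 * Q + (T2 + (3 * Q + 3 * Q))) + 3 * Q) + Q)))
     = T1 + 6 * Q + b * (9 * Q + T2)" by (simp add: algebra_simps)
  ultimately have "runs (bigc f u d cb cx) (R, M) \<omega> (R5(d := g b), M) \<omega>
     (T1 + 6 * Q + b * (9 * Q + T2))" by (simp only:)
  then show ?thesis using R5(1) by (intro exI[of _ "R5(d := g b)"] conjI) (auto simp: Inv_def)
qed

text \<open>The exponent belongs to the expression alone and not to the state or to
  \<open>L\<close>, so finitely many expressions share one. Bounding the length of the value
  together with the cost is what makes the induction over expressions work.\<close>

definition compiles_in :: "xexp \<Rightarrow> nat \<Rightarrow> bool" where
  "compiles_in x c \<longleftrightarrow> (\<forall>\<rho> d R M \<omega> L. (\<forall>v. \<rho> v < d) \<longrightarrow> 2 \<le> L \<longrightarrow>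
     (\<forall>v. bit_len (R (\<rho> v)) \<le> L) \<longrightarrow> (\<forall>i. bit_len (M i) \<le> L) \<longrightarrow>
     loops_le x (\<lambda>v. R (\<rho> v)) M L \<longrightarrow>
     bit_len (xeval x (\<lambda>v. R (\<rho> v)) M) \<le> L ^ c \<and>
     (\<exists>R'. runs (xcomp \<rho> d x) (R, M) \<omega> (R', M) \<omega> (L ^ c) \<and>
        R' d = xeval x (\<lambda>v. R (\<rho> v)) M \<and> (\<forall>r<d. R' r = R r)))"

lemma compiles_in_mono:
  assumes "compiles_in x c" "c \<le> c'"
  shows "compiles_in x c'"
  unfolding compiles_in_def
proof (intro allI impI)
  fix \<rho> :: "nat \<Rightarrow> nat" and d R M \<omega> and L :: nat
  assume *: "\<forall>v. \<rho> v < d" "2 \<le> L" "\<forall>v. bit_len (R (\<rho> v)) \<le> L" "\<forall>i. bit_len (M i) \<le> L"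
    "loops_le x (\<lambda>v. R (\<rho> v)) M L"
  have "L ^ c \<le> L ^ c'" using assms(2) *(2) by (intro power_increasing) auto
  moreover obtain R' where "bit_len (xeval x (\<lambda>v. R (\<rho> v)) M) \<le> L ^ c"
    "runs (xcomp \<rho> d x) (R, M) \<omega> (R', M) \<omega> (L ^ c)"
    "R' d = xeval x (\<lambda>v. R (\<rho> v)) M" "\<forall>r<d. R' r = R r"
    using assms(1) * unfolding compiles_in_def by blast
  ultimately show "bit_len (xeval x (\<lambda>v. R (\<rho> v)) M) \<le> L ^ c' \<and>
     (\<exists>R'. runs (xcomp \<rho> d x) (R, M) \<omega> (R', M) \<omega> (L ^ c') \<and>
        R' d = xeval x (\<lambda>v. R (\<rho> v)) M \<and> (\<forall>r<d. R' r = R r))"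
    using runs_mono by (meson order_trans)
qed

lemma compiles_inD:
  assumes "compiles_in x c" "\<And>v. \<rho> v < d" "2 \<le> L" "\<And>v. \<sigma> v = R (\<rho> v)"
    "\<And>v. bit_len (\<sigma> v) \<le> L" "\<And>i. bit_len (M i) \<le> L" "loops_le x \<sigma> M L"
  shows "bit_len (xeval x \<sigma> M) \<le> L ^ c"
    "\<exists>R'. runs (xcomp \<rho> d x) (R, M) \<omega> (R', M) \<omega> (L ^ c) \<and> R' d = xeval x \<sigma> M \<and> (\<forall>r<d. R' r = R r)"
proof -
  have "\<sigma> = (\<lambda>v. R (\<rho> v))" using assms(4) by auto
  then show "bit_len (xeval x \<sigma> M) \<le> L ^ c"
    "\<exists>R'. runs (xcomp \<rho> d x) (R, M) \<omega> (R', M) \<omega> (L ^ c) \<and> R' d = xeval x \<sigma> M \<and> (\<forall>r<d. R' r = R r)"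
    using assms unfolding compiles_in_def by blast+
qed

text \<open>Sums and products are treated together: they differ only in the operator, the unit and
  the growth of the accumulator. A loop index stays below \<open>L\<close>, so its length is at most
  \<open>L\<close> and the body is evaluated under the same bounds.\<close>

lemma compiles_in_big:
  fixes u :: nat
  assumes b: "compiles_in b c" and x: "compiles_in x c" and c: "1 \<le> c"
    and z: "z = XS v b x \<and> f = Plus \<and> u = 0 \<or> z = XP v b x \<and> f = Times \<and> u = 1"
  shows "compiles_in z (c + 8)"
  unfolding compiles_in_def
proof (intro allI impI)
  fix \<rho> :: "nat \<Rightarrow> nat" and d R M \<omega> and L :: nat
  assume \<rho>: "\<forall>v. \<rho> v < d" and L: "2 \<le> L" and R: "\<forall>v. bit_len (R (\<rho> v)) \<le> L"
    and M: "\<forall>i. bit_len (M i) \<le> L" and l: "loops_le z (\<lambda>v. R (\<rho> v)) M L"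
  define \<sigma> where "\<sigma> = (\<lambda>v. R (\<rho> v))"
  define B where "B = xeval b \<sigma> M"
  define X where "X i = xeval x (\<sigma>(v := i)) M" for i
  define g where "g i = (if f = Plus then \<Sum>j<i. X j else \<Prod>j<i. X j)" for i :: nat
  have l': "loops_le b \<sigma> M L" "B \<le> L" "\<And>i. i < B \<Longrightarrow> loops_le x (\<sigma>(v := i)) M L"
    using l z by (auto simp: \<sigma>_def[symmetric] B_def)
  have zB: "xeval z \<sigma> M = g B"
    using z by (auto simp: g_def X_def B_def)
  have \<sigma>L: "bit_len (\<sigma> v) \<le> L" for v using R by (simp add: \<sigma>_def)
  obtain R1 where R1: "runs (xcomp \<rho> d b) (R, M) \<omega> (R1, M) \<omega> (L ^ c)" "R1 d = B"
    "\<And>r. r < d \<Longrightarrow> R1 r = R r"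
    using compiles_inD(2)[OF b, where \<rho> = \<rho> and d = d and L = L and \<sigma> = \<sigma> and R = R and M = M and \<omega> = \<omega>] \<rho> L \<sigma>L M l' unfolding \<sigma>_def B_def by blast
  have iL: "bit_len i \<le> L" if "i < B" for i
    using that l'(2) L bit_len_le_self[of i] by linarith
  have step: "bit_len (X i) \<le> L ^ c \<and> (\<exists>R''. runs (xcomp (\<rho>(v := d + 2)) (d + 3) x) (R', M) \<omega> (R'', M) \<omega> (L ^ c) \<and>
      R'' (d + 3) = X i \<and> (\<forall>r<d + 3. R'' r = R' r))"
    if i: "i < B" and R': "\<And>r. r < d \<Longrightarrow> R' r = R r" "R' (d + 2) = i" for i R'
  proof -
    have 1: "(\<rho>(v := d + 2)) w < d + 3" for w using \<rho>[rule_format, of w] by auto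
    have 2: "(\<sigma>(v := i)) w = R' ((\<rho>(v := d + 2)) w)" for w using R' \<rho> by (auto simp: \<sigma>_def)
    have 3: "bit_len ((\<sigma>(v := i)) w) \<le> L" for w using \<sigma>L iL[OF i] by auto
    have M': "bit_len (M i) \<le> L" for i using M by blast
    show ?thesis
      using compiles_inD(1)[OF x 1 L 2 3 M' l'(3)[OF i]]
        compiles_inD(2)[OF x 1 L 2 3 M' l'(3)[OF i], where \<omega> = \<omega>] unfolding X_def by blast
  qed
  have XL: "bit_len (X i) \<le> L ^ c" if "i < B" for i
    using step[of i "R(d + 2 := i)"] that by auto
  have Lc: "L \<le> L ^ c" using c L self_le_power[of L c] by simp
  have Lc1: "1 \<le> L ^ c" using Lc L by linarith
  have X2: "X i < 2 ^ (L ^ c)" if "i < B" for i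
    using XL[OF that] bit_len_le_iff[OF Lc1] by blast
  \<comment> \<open>Room for a sum (\<open>L + L ^ c\<close> bits) and for a product of at most
    \<open>L\<close> factors of \<open>L ^ c\<close> bits each.\<close>
  define Q where "Q = L ^ (c + 2)"
  have pw: "2 ^ k * L ^ m \<le> L ^ (k + m)" for k m
    using power_mono[OF L, of k] by (simp add: power_add mult_le_mono1)
  have gQ: "bit_len (g i) \<le> Q" if "i \<le> B" for i
  proof -
    have iL: "i \<le> L" using that l'(2) by linarith
    show ?thesis
    proof (cases "f = Plus")
      case True
      have "(\<Sum>j<i. X j) < 2 ^ (L + L ^ c)"
      proof -
        have "(\<Sum>j<i. X j) \<le> of_nat (card {..<i}) * 2 ^ (L ^ c)"
          using that X2 by (intro sum_bounded_above) (auto intro!: less_imp_le)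
        also have "\<dots> < 2 ^ L * 2 ^ (L ^ c)"
          using le_less_trans[OF iL less_exp[of L]] by (intro mult_strict_right_mono) auto
        finally show ?thesis by (simp add: power_add)
      qed
      then have "bit_len (g i) \<le> L + L ^ c" using True L by (subst bit_len_le_iff) (auto simp: g_def)
      also have "\<dots> \<le> 2 ^ 2 * L ^ c" using Lc by simp
      also have "\<dots> \<le> Q" using pw[of 2 c] by (simp add: Q_def add.commute)
      finally show ?thesis .
    next
      case False
      have "(\<Prod>j<i. X j) \<le> (\<Prod>j<i. 2 ^ (L ^ c))"
        using that X2 by (intro prod_mono) (auto intro!: less_imp_le)
      also have "\<dots> = 2 ^ (L ^ c * i)" by (simp add: power_mult)
      also have "\<dots> < 2 ^ Suc (L ^ c * L)" using iL by (intro power_strict_increasing) (auto simp: less_Suc_eq_le)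
      finally have "bit_len (g i) \<le> Suc (L ^ c * L)" using False by (subst bit_len_le_iff) (auto simp: g_def)
      also have "\<dots> \<le> 2 * (L ^ c * L)" using L Lc1 by (simp add: Suc_le_eq)
      also have "\<dots> \<le> Q" using pw[of 1 "c + 1"] by (simp add: Q_def mult.commute)
      finally show ?thesis .
    qed
  qed
  have LQ: "L ^ c \<le> Q" unfolding Q_def using L by (intro power_increasing) auto
  have BQ: "bit_len B \<le> Q"
  proof -
    have "B < 2 ^ L" using l'(2) less_exp[of L] by linarith
    then have "bit_len B \<le> L" using L by (subst bit_len_le_iff) auto
    then show ?thesis using Lc LQ by linarith
  qed
  have XQ: "bit_len (X i) \<le> Q" if "i < B" for i using XL[OF that] LQ by linarith
  have "\<exists>R'. runs (bigc f u d (xcomp \<rho> d b) (xcomp (\<rho>(v := d + 2)) (d + 3) x)) (R, M) \<omega> (R', M) \<omega>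
     (L ^ c + 6 * Q + B * (9 * Q + L ^ c)) \<and> R' d = g B \<and> (\<forall>r<d. R' r = R r)"
  proof (rule runs_bigc[OF R1, where x = X])
    show "\<exists>R''. runs (xcomp (\<rho>(v := d + 2)) (d + 3) x) (R', M) \<omega> (R'', M) \<omega> (L ^ c) \<and>
      R'' (d + 3) = X i \<and> (\<forall>r<d + 3. R'' r = R' r)"
      if "i < B" "\<And>r. r < d \<Longrightarrow> R' r = R r" "R' (d + 2) = i" for i R' using step[OF that] by blast
    show "g 0 = u" using z by (auto simp: g_def)
    show "g (Suc i) = arith f (g i) (X i)" for i using z by (auto simp: g_def mult.commute)
  qed (use BQ gQ XQ in auto)
  then obtain R' where R': "runs (xcomp \<rho> d z) (R, M) \<omega> (R', M) \<omega> (L ^ c + 6 * Q + B * (9 * Q + L ^ c))"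
    "R' d = g B" "\<forall>r<d. R' r = R r"
    using z by auto
  have cost: "L ^ c + 6 * Q + B * (9 * Q + L ^ c) \<le> L ^ (c + 8)"
  proof -
    have "B * (9 * Q + L ^ c) \<le> L * (10 * Q)" using l'(2) LQ by (intro mult_le_mono) auto
    then have 1: "B * (9 * Q + L ^ c) \<le> 10 * (L * Q)" by (simp only: mult.left_commute)
    have 2: "L ^ c + 6 * Q \<le> 7 * Q" using LQ by simp
    have 3: "Q \<le> L * Q" using L by simp
    have lin: "y + x \<le> 32 * z" if "x \<le> 10 * z" "y \<le> 7 * q" "q \<le> z" for x y z q :: nat
      using that by linarith
    \<comment> \<open>Constants are absorbed using \<open>L \<ge> 2\<close>: the factor
      \<open>2 ^ 5\<close> becomes \<open>L ^ 5\<close>, and \<open>L * Q = L ^ (c + 3)\<close>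
      accounts for the rest of \<open>c + 8\<close>.\<close>
    have "L ^ c + 6 * Q + B * (9 * Q + L ^ c) \<le> 2 ^ 5 * (L * Q)"
      using lin[OF 1 2 3] by simp
    also have "L * Q = L ^ (c + 3)" by (simp add: Q_def power_add algebra_simps power3_eq_cube power2_eq_square)
    also have "2 ^ 5 * \<dots> \<le> L ^ (c + 8)" using pw[of 5 "c + 3"] by (simp add: add.commute)
    finally show ?thesis .
  qed
  have "bit_len (g B) \<le> L ^ (c + 8)"
    using gQ[of B] power_increasing[of "c + 2" "c + 8" L] L by (simp add: Q_def)
  then show "bit_len (xeval z (\<lambda>v. R (\<rho> v)) M) \<le> L ^ (c + 8) \<and>
     (\<exists>R'. runs (xcomp \<rho> d z) (R, M) \<omega> (R', M) \<omega> (L ^ (c + 8)) \<and>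
        R' d = xeval z (\<lambda>v. R (\<rho> v)) M \<and> (\<forall>r<d. R' r = R r))"
    unfolding \<sigma>_def[symmetric] zB using R'(2,3) runs_mono[OF R'(1) cost] by blast
qed

theorem compiles_in_ex: "\<exists>c\<ge>1. compiles_in x c"
proof (induction x)
  case (XC k)
  \<comment> \<open>A constant may be longer than \<open>L\<close>, but its length \<open>?c\<close>
    is below \<open>2 ^ ?c \<le> L ^ ?c\<close>.\<close>
  let ?c = "bit_len k"
  have "compiles_in (XC k) ?c"
    unfolding compiles_in_def
  proof (intro allI impI)
    fix \<rho> :: "nat \<Rightarrow> nat" and d R M \<omega> and L :: nat
    assume "2 \<le> L"
    then have "2 ^ ?c \<le> L ^ ?c" by (intro power_mono) auto
    then have *: "?c \<le> L ^ ?c" using less_exp[of ?c] by linarith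
    have "runs (xcomp \<rho> d (XC k)) (R, M) \<omega> (R(d := k), M) \<omega> (L ^ ?c)"
      using runs_Assign[of "Const k" R M "L ^ ?c" d \<omega>] * by simp
    then show "bit_len (xeval (XC k) (\<lambda>v. R (\<rho> v)) M) \<le> L ^ ?c \<and>
     (\<exists>R'. runs (xcomp \<rho> d (XC k)) (R, M) \<omega> (R', M) \<omega> (L ^ ?c) \<and>
        R' d = xeval (XC k) (\<lambda>v. R (\<rho> v)) M \<and> (\<forall>r<d. R' r = R r))"
      using * by (intro conjI exI[of _ "R(d := k)"]) auto
  qed
  then show ?case using bit_len_pos by blast
next
  case (XV v)
  have "compiles_in (XV v) 1"
    unfolding compiles_in_def
  proof (intro allI impI)
    fix \<rho> :: "nat \<Rightarrow> nat" and d R M \<omega> and L :: nat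
    assume *: "\<forall>v. bit_len (R (\<rho> v)) \<le> L"
    then have "runs (xcomp \<rho> d (XV v)) (R, M) \<omega> (R(d := R (\<rho> v)), M) \<omega> (L ^ 1)"
      using runs_Assign[of "Reg (\<rho> v)" R M "L ^ 1" d \<omega>] by simp
    then show "bit_len (xeval (XV v) (\<lambda>v. R (\<rho> v)) M) \<le> L ^ 1 \<and>
     (\<exists>R'. runs (xcomp \<rho> d (XV v)) (R, M) \<omega> (R', M) \<omega> (L ^ 1) \<and>
        R' d = xeval (XV v) (\<lambda>v. R (\<rho> v)) M \<and> (\<forall>r<d. R' r = R r))"
      using * by (intro conjI exI[of _ "R(d := R (\<rho> v))"]) auto
  qed
  then show ?case by blast
next
  case (XL x)
  then obtain c where c: "1 \<le> c" "compiles_in x c" by blast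
  have "compiles_in (XL x) (c + 2)"
    unfolding compiles_in_def
  proof (intro allI impI)
    fix \<rho> :: "nat \<Rightarrow> nat" and d R M \<omega> and L :: nat
    assume *: "\<forall>v. \<rho> v < d" "2 \<le> L" "\<forall>v. bit_len (R (\<rho> v)) \<le> L" "\<forall>i. bit_len (M i) \<le> L"
      "loops_le (XL x) (\<lambda>v. R (\<rho> v)) M L"
    let ?a = "xeval x (\<lambda>v. R (\<rho> v)) M"
    obtain R1 where R1: "bit_len ?a \<le> L ^ c" "runs (xcomp \<rho> d x) (R, M) \<omega> (R1, M) \<omega> (L ^ c)"
      "R1 d = ?a" "\<forall>r<d. R1 r = R r"
      using c(2) * unfolding compiles_in_def loops_le.simps by blast
    have Lc: "L \<le> L ^ c" using c *(2) self_le_power[of L c] by simp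
    have "runs (Assign d (Load (Reg d))) (R1, M) \<omega> (R1(d := M ?a), M) \<omega> (L ^ c + L)"
      using runs_Assign[of "Load (Reg d)" R1 M "L ^ c + L" d \<omega>] R1 * by (simp add: add_mono)
    from runs_Seq[OF R1(2) this]
    have "runs (xcomp \<rho> d (XL x)) (R, M) \<omega> (R1(d := M ?a), M) \<omega> (L ^ c + (L ^ c + L))" by simp
    moreover have "2 ^ 2 * L ^ c \<le> L ^ 2 * L ^ c" using *(2) by (intro mult_le_mono power_mono) auto
    then have "4 * L ^ c \<le> L ^ (c + 2)" by (simp only: power_add mult.commute[of "L ^ c"]) simp
    then have "L ^ c + (L ^ c + L) \<le> L ^ (c + 2)" using Lc by linarith
    moreover have "bit_len (M ?a) \<le> L ^ (c + 2)"
      using * Lc calculation(2) by (meson le_add2 order_trans)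
    ultimately show "bit_len (xeval (XL x) (\<lambda>v. R (\<rho> v)) M) \<le> L ^ (c + 2) \<and>
     (\<exists>R'. runs (xcomp \<rho> d (XL x)) (R, M) \<omega> (R', M) \<omega> (L ^ (c + 2)) \<and>
        R' d = xeval (XL x) (\<lambda>v. R (\<rho> v)) M \<and> (\<forall>r<d. R' r = R r))"
      using R1 runs_mono by (intro conjI exI[of _ "R1(d := M ?a)"]) auto
  qed
  then show ?case by (intro exI[of _ "c + 2"]) simp
next
  case (XA f x y)
  then obtain c1 c2 where "1 \<le> c1" "compiles_in x c1" "1 \<le> c2" "compiles_in y c2" by blast
  then obtain c where c: "1 \<le> c" "compiles_in x c" "compiles_in y c"
    using compiles_in_mono[of x c1 "max c1 c2"] compiles_in_mono[of y c2 "max c1 c2"]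
    by (meson max.cobounded1 max.cobounded2 order_trans)
  have "compiles_in (XA f x y) (c + 3)"
    unfolding compiles_in_def
  proof (intro allI impI)
    fix \<rho> :: "nat \<Rightarrow> nat" and d R M \<omega> and L :: nat
    assume *: "\<forall>v. \<rho> v < d" "2 \<le> L" "\<forall>v. bit_len (R (\<rho> v)) \<le> L" "\<forall>i. bit_len (M i) \<le> L"
      "loops_le (XA f x y) (\<lambda>v. R (\<rho> v)) M L"
    define \<sigma> where "\<sigma> = (\<lambda>v. R (\<rho> v))"
    let ?a = "xeval x \<sigma> M" and ?b = "xeval y \<sigma> M"
    obtain R1 where R1: "bit_len ?a \<le> L ^ c" "runs (xcomp \<rho> d x) (R, M) \<omega> (R1, M) \<omega> (L ^ c)"
      "R1 d = ?a" "\<forall>r<d. R1 r = R r"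
      using c(2) * unfolding compiles_in_def loops_le.simps \<sigma>_def by blast
    have 1: "\<rho> v < d + 1" "\<sigma> v = R1 (\<rho> v)" "bit_len (\<sigma> v) \<le> L" for v
      using * R1(4) by (auto simp: \<sigma>_def less_Suc_eq)
    obtain R2 where R2: "bit_len ?b \<le> L ^ c" "runs (xcomp \<rho> (d + 1) y) (R1, M) \<omega> (R2, M) \<omega> (L ^ c)"
      "R2 (d + 1) = ?b" "\<forall>r<d + 1. R2 r = R1 r"
      using compiles_inD(1)[OF c(3), where \<rho> = \<rho> and d = "d + 1" and L = L and \<sigma> = \<sigma> and R = R1 and M = M]
        compiles_inD(2)[OF c(3), where \<rho> = \<rho> and d = "d + 1" and L = L and \<sigma> = \<sigma> and R = R1 and M = M and \<omega> = \<omega>]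
        1 * unfolding \<sigma>_def by (metis loops_le.simps(4))
    let ?v = "arith f ?a ?b"
    have bl: "bit_len ?v \<le> 2 * L ^ c" using bit_len_arith[of f ?a ?b] R1(1) R2(1) by linarith
    have "runs (Assign d (Arith f (Reg d) (Reg (d + 1)))) (R2, M) \<omega> (R2(d := ?v), M) \<omega> (4 * L ^ c)"
      using runs_Assign[of "Arith f (Reg d) (Reg (d + 1))" R2 M "4 * L ^ c" d \<omega>] R1 R2 bl by simp
    from runs_Seq[OF R1(2) runs_Seq[OF R2(2) this]]
    have "runs (xcomp \<rho> d (XA f x y)) (R, M) \<omega> (R2(d := ?v), M) \<omega> (L ^ c + (L ^ c + 4 * L ^ c))" by simp
    moreover have "2 ^ 3 * L ^ c \<le> L ^ 3 * L ^ c" using *(2) by (intro mult_le_mono power_mono) auto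
    then have 8: "8 * L ^ c \<le> L ^ (c + 3)" by (simp add: power_add algebra_simps)
    moreover have "bit_len ?v \<le> L ^ (c + 3)" using bl 8 by linarith
    moreover have "L ^ c + (L ^ c + 4 * L ^ c) \<le> L ^ (c + 3)" using 8 by linarith
    ultimately show "bit_len (xeval (XA f x y) (\<lambda>v. R (\<rho> v)) M) \<le> L ^ (c + 3) \<and>
     (\<exists>R'. runs (xcomp \<rho> d (XA f x y)) (R, M) \<omega> (R', M) \<omega> (L ^ (c + 3)) \<and>
        R' d = xeval (XA f x y) (\<lambda>v. R (\<rho> v)) M \<and> (\<forall>r<d. R' r = R r))"
      using R1 R2 runs_mono unfolding \<sigma>_def[symmetric]
      by (intro conjI exI[of _ "R2(d := ?v)"]) auto
  qed
  then show ?case by (intro exI[of _ "c + 3"]) simp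
next
  case (XS v b x)
  then obtain c1 c2 where "1 \<le> c1" "compiles_in b c1" "1 \<le> c2" "compiles_in x c2" by blast
  then have "compiles_in (XS v b x) (max c1 c2 + 8)"
    using compiles_in_mono by (intro compiles_in_big[of b _ x _ v Plus 0]) auto
  then show ?case by (intro exI[of _ "max c1 c2 + 8"]) simp
next
  case (XP v b x)
  then obtain c1 c2 where "1 \<le> c1" "compiles_in b c1" "1 \<le> c2" "compiles_in x c2" by blast
  then have "compiles_in (XP v b x) (max c1 c2 + 8)"
    using compiles_in_mono by (intro compiles_in_big[of b _ x _ v Times 1]) auto
  then show ?case by (intro exI[of _ "max c1 c2 + 8"]) simp
qed

section \<open>Coin tosses\<close>

text \<open>The number with binary digits \<open>\<omega> !! 0, \<dots>, \<omega> !! (m - 1)\<close>, most significant first.\<close>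

fun coin_value :: "nat \<Rightarrow> bool stream \<Rightarrow> nat" where
  "coin_value 0 \<omega> = 0"
| "coin_value (Suc m) \<omega> = of_bool (shd \<omega>) * 2 ^ m + coin_value m (stl \<omega>)"

lemma coin_value_less: "coin_value m \<omega> < 2 ^ m"
proof (induction m arbitrary: \<omega>)
  case (Suc m)
  show ?case using Suc[of "stl \<omega>"] by (cases "shd \<omega>") (auto intro: order.strict_trans2)
qed auto

lemma space_coin_space [simp]: "space coin_space = UNIV"
  by (simp add: coin_space_def space_stream_space)

interpretation coin: prob_space coin_space
  unfolding coin_space_def
  by (rule prob_space.prob_space_stream_space[OF measure_pmf.prob_space_axioms])

lemma coin_value_measurable [measurable]:
  "coin_value m \<in> measurable (stream_space (measure_pmf p)) (count_space UNIV)"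
proof (induction m)
  case (Suc m)
  note Suc [measurable]
  have [measurable]: "shd \<in> measurable (stream_space (measure_pmf p)) (count_space UNIV)"
    by (rule measurable_compose[OF measurable_shd]) simp
  show ?case unfolding coin_value.simps by measurable
qed simp

lemma emeasure_coin_value:
  "r < 2 ^ m \<Longrightarrow> emeasure coin_space {\<omega>. coin_value m \<omega> = r} = ennreal ((1 / 2) ^ m)"
proof (induction m arbitrary: r)
  case 0
  then show ?case using coin.emeasure_space_1 by simp
next
  case (Suc m)
  let ?p = "measure_pmf (bernoulli_pmf (1/2))"
  have cs: "coin_space = stream_space ?p" by (simp add: coin_space_def)
  have [measurable]: "{\<omega>. coin_value m \<omega> = r} \<in> sets (stream_space ?p)" for m r
  proof -
    have "{\<omega> \<in> space (stream_space ?p). coin_value m \<omega> = r} \<in> sets (stream_space ?p)" by measurable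
    then show ?thesis by (simp add: space_stream_space)
  qed
  \<comment> \<open>The leading binary digit of \<open>r\<close> prescribes the first coin, the
    remainder prescribes the others.\<close>
  have *: "coin_value (Suc m) (b ## \<omega>) = r \<longleftrightarrow>
      b = (2 ^ m \<le> r) \<and> coin_value m \<omega> = r mod 2 ^ m" for b \<omega>
    using coin_value_less[of m \<omega>] Suc.prems
    by (cases "2 ^ m \<le> r"; cases b) (auto simp: le_mod_geq mod_if)
  have "emeasure coin_space {\<omega>. coin_value (Suc m) \<omega> = r}
     = (\<integral>\<^sup>+b. emeasure coin_space {\<omega>. coin_value (Suc m) (b ## \<omega>) = r} \<partial>?p)"
    unfolding cs
    by (subst prob_space.emeasure_stream_space[OF measure_pmf.prob_space_axioms])
       (simp_all add: space_stream_space del: coin_value.simps)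
  also have "\<dots> = (\<integral>\<^sup>+b. (if b = (2 ^ m \<le> r) then ennreal ((1 / 2) ^ m) else 0) \<partial>?p)"
    by (intro nn_integral_cong) (simp add: * Suc.IH del: coin_value.simps)
  also have "\<dots> = ennreal ((1 / 2) ^ Suc m)"
  proof -
    have "inverse (2::ennreal) = ennreal (1 / 2)"
      using inverse_ennreal[of 2] by (simp add: inverse_eq_divide)
    then have "ennreal ((1 / 2) ^ m) * inverse 2 = ennreal ((1 / 2) ^ m / 2)"
      by (metis ennreal_mult' mult.right_neutral times_divide_eq_right zero_le_divide_1_iff
          zero_le_numeral zero_le_power)
    then show ?thesis by (simp add: nn_integral_bernoulli_pmf)
  qed
  finally show ?case .
qed

theorem prob_coin_value:
  assumes "G \<subseteq> {..<2 ^ m}"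
  shows "measure coin_space {\<omega>. coin_value m \<omega> \<in> G} = real (card G) / 2 ^ m"
proof -
  have fin: "finite G" using assms finite_subset by blast
  have sets: "{\<omega>. coin_value m \<omega> = r} \<in> sets coin_space" for r
  proof -
    have "{\<omega> \<in> space coin_space. coin_value m \<omega> = r} \<in> sets coin_space"
      unfolding coin_space_def by measurable
    then show ?thesis by simp
  qed
  have "{\<omega>. coin_value m \<omega> \<in> G} = (\<Union>r\<in>G. {\<omega>. coin_value m \<omega> = r})" by auto
  also have "measure coin_space \<dots> = (\<Sum>r\<in>G. measure coin_space {\<omega>. coin_value m \<omega> = r})"
    using sets fin by (intro coin.finite_measure_finite_Union) (auto simp: disjoint_family_on_def)
  also have "\<dots> = (\<Sum>r\<in>G. (1 / 2) ^ m)"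
    using assms by (intro sum.cong refl) (auto simp: measure_def emeasure_coin_value)
  finally show ?thesis by (simp add: power_one_over field_simps)
qed

section \<open>Reading off solutions\<close>

lemma radix_eq_iff:
  fixes c c' :: nat
  assumes "c < K" "c' < K"
  shows "c + K * x = c' + K * y \<longleftrightarrow> c = c' \<and> x = y"
proof
  assume e: "c + K * x = c' + K * y"
  then have "(c + K * x) mod K = (c' + K * y) mod K" "(c + K * x) div K = (c' + K * y) div K" by simp_all
  then show "c = c' \<and> x = y" using assms by simp
qed simp

text \<open>Isolation and parity do not depend on what fitting and profit mean; symmetry in the two
  vertices is what keeps the matrix symmetric.\<close>

locale knapsack_sieve =
  fixes N k :: nat and fit :: "nat \<Rightarrow> nat \<Rightarrow> nat set \<Rightarrow> bool" and pr :: "nat \<Rightarrow> nat \<Rightarrow> nat set \<Rightarrow> nat"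
  assumes fit_sym: "fit a b T = fit b a T" and pr_sym: "pr a b T = pr b a T" and k_less: "k < N"
begin

definition ok :: "nat \<Rightarrow> nat \<Rightarrow> bool \<Rightarrow> nat set \<Rightarrow> bool" where
  "ok a b m T \<longleftrightarrow> (if m then fit a b T else a = b)"

text \<open>
  The random weights are indexed by \<open>y * N + a\<close>, where \<open>a\<close> represents a cycle and the slot \<open>y\<close> stands
  for the partner \<open>y\<close> of \<open>a\<close> if \<open>y < N\<close>, for \<open>a\<close> being unused if \<open>y = N\<close>, and for label \<open>s\<close> if \<open>y = N + 1 + s\<close>.
\<close>

definition weight :: "(nat \<Rightarrow> nat) \<Rightarrow> nat \<Rightarrow> nat \<Rightarrow> bool \<Rightarrow> nat set \<Rightarrow> nat" where
  "weight w a b m T = w ((if m then max a b else N) * N + min a b) + (\<Sum>s\<in>T. w ((N + 1 + s) * N + min a b))"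

definition gain :: "nat \<Rightarrow> nat \<Rightarrow> bool \<Rightarrow> nat set \<Rightarrow> nat" where
  "gain a b m T = (if m then pr a b T else 0)"

text \<open>Four quantities packed as base-\<open>K\<close> digits into the exponent of one
  variable. They add up over the cycles without carries once \<open>K\<close> exceeds all
  totals.\<close>

definition code :: "nat \<Rightarrow> (nat \<Rightarrow> nat) \<Rightarrow> nat \<Rightarrow> nat \<Rightarrow> bool \<Rightarrow> nat set \<Rightarrow> nat" where
  "code K w a b m T = card T + K * (of_bool m + K * (gain a b m T + K * weight w a b m T))"

lemma ok_sym: "ok a b m T = ok b a m T"
  by (auto simp: ok_def fit_sym)

lemma code_sym: "code K w a b m T = code K w b a m T"
  by (simp add: code_def gain_def weight_def pr_sym max.commute min.commute)

abbreviation "cvs \<equiv> covers ok N {..<k}"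

abbreviation "labels \<equiv> cycle_sum N (\<lambda>a b m T. card T)"
abbreviation "used \<equiv> cycle_sum N (\<lambda>a b m T. of_bool m)"
abbreviation "total_gain \<equiv> cycle_sum N gain"
abbreviation "total_weight w \<equiv> cycle_sum N (weight w)"

lemma cycle_sum_code: "cycle_sum N (code K w) x =
    labels x + K * (used x + K * (total_gain x + K * total_weight w x))"
  by (cases x) (simp add: cycle_sum_def code_def sum.distrib sum_distrib_left[symmetric])

definition slots :: "(nat \<Rightarrow> nat) \<times> (nat \<Rightarrow> bool \<times> nat set) \<Rightarrow> nat \<Rightarrow> nat set" where
  "slots = (\<lambda>(p, g) a. insert (if fst (g a) then p a else N) ((\<lambda>s. N + 1 + s) ` snd (g a)))"

text \<open>Turns a cover into a set, as the isolation lemma requires. There are exponentially many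
  covers, but the ground set has only \<open>2 * N * N\<close> elements.\<close>

definition elements :: "(nat \<Rightarrow> nat) \<times> (nat \<Rightarrow> bool \<times> nat set) \<Rightarrow> nat set" where
  "elements x = (\<Union>a\<in>reps N (fst x). (\<lambda>y. y * N + a) ` slots x a)"

lemma coversD:
  assumes "(p, g) \<in> cvs"
  shows "p permutes {..<N}" "p (p a) = a" "a \<in> reps N p \<Longrightarrow> snd (g a) \<subseteq> {..<k}"
    "a \<in> reps N p \<Longrightarrow> ok a (p a) (fst (g a)) (snd (g a))" "g \<in> extensional (reps N p)"
    "(\<Union>a\<in>reps N p. snd (g a)) = {..<k}"
proof -
  show "p permutes {..<N}" "p (p a) = a" "g \<in> extensional (reps N p)"
    "(\<Union>a\<in>reps N p. snd (g a)) = {..<k}"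
    using assms unfolding covers_def by (auto simp: fun_eq_iff PiE_iff)
  show "snd (g a) \<subseteq> {..<k}" "ok a (p a) (fst (g a)) (snd (g a))" if "a \<in> reps N p"
  proof -
    have "g a \<in> opts ok {..<k} a (p a)" using assms that unfolding covers_def by (auto simp: PiE_iff)
    then show "snd (g a) \<subseteq> {..<k}" "ok a (p a) (fst (g a)) (snd (g a))" by (auto simp: opts_def)
  qed
qed

lemma repsD: "a \<in> reps N p \<Longrightarrow> a < N" "a \<in> reps N p \<Longrightarrow> a \<le> p a"
  by (auto simp: reps_def)

lemma slots_less:
  assumes "x \<in> cvs" "a \<in> reps N (fst x)" "y \<in> slots x a"
  shows "y < 2 * N"
proof -
  obtain p g where [simp]: "x = (p, g)" by (cases x)
  have "a < N" "snd (g a) \<subseteq> {..<k}"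
    using coversD(3)[of p g a] assms by (auto simp: reps_def)
  moreover have "p a < N"
    using permutes_in_image[OF coversD(1)[of p g], of a] assms \<open>a < N\<close> by simp
  ultimately show ?thesis using assms(3) k_less by (auto simp: slots_def split: if_splits)
qed

lemma elements_less: "x \<in> cvs \<Longrightarrow> elements x \<subseteq> {..<2 * N * N}"
proof
  fix i assume x: "x \<in> cvs" and "i \<in> elements x"
  then obtain a y where "a \<in> reps N (fst x)" "y \<in> slots x a" "i = y * N + a"
    by (auto simp: elements_def)
  moreover have "y + 1 \<le> 2 * N" using slots_less[OF x] calculation(1,2) by fastforce
  then have "(y + 1) * N \<le> 2 * N * N" by (rule mult_le_mono1)
  ultimately show "i \<in> {..<2 * N * N}" using repsD(1) by fastforce
qed

lemma elements_iff:
  assumes "x \<in> cvs" "a < N"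
  shows "y * N + a \<in> elements x \<longleftrightarrow> a \<in> reps N (fst x) \<and> y \<in> slots x a"
proof
  assume "y * N + a \<in> elements x"
  then obtain b z where *: "b \<in> reps N (fst x)" "z \<in> slots x b" "y * N + a = z * N + b"
    by (auto simp: elements_def)
  then have "a = b \<and> y = z"
    using radix_eq_iff[of a N b y z] repsD(1)[OF *(1)] assms(2) by (simp add: mult.commute add.commute)
  then show "a \<in> reps N (fst x) \<and> y \<in> slots x a" using * by simp
qed (auto simp: elements_def)

text \<open>Different cycles have different representatives, hence different residues modulo
  \<open>N\<close>, so no ground element is counted twice.\<close>

lemma total_weight_eq:
  assumes "x \<in> cvs"
  shows "total_weight w x = sum w (elements x)"
proof -
  obtain p g where [simp]: "x = (p, g)" by (cases x)
  have fin: "finite (snd (g a))" if "a \<in> reps N p" for a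
    using coversD(3)[of p g a] assms that finite_subset by auto
  have fs: "finite (slots x a)" if "a \<in> reps N p" for a
    using fin[OF that] by (simp add: slots_def)
  have "sum w (elements x) = (\<Sum>a\<in>reps N p. sum w ((\<lambda>y. y * N + a) ` slots x a))"
  proof -
    have "\<forall>a\<in>reps N p. \<forall>b\<in>reps N p. a \<noteq> b \<longrightarrow>
      (\<lambda>y. y * N + a) ` slots x a \<inter> (\<lambda>y. y * N + b) ` slots x b = {}"
    proof (intro ballI impI)
      fix a b assume "a \<in> reps N p" "b \<in> reps N p" "a \<noteq> b"
      then have "y * N + a \<noteq> z * N + b" for y z
        using radix_eq_iff[of a N b y z] repsD(1)[of a] repsD(1)[of b] by (simp add: mult.commute add.commute)
      then show "(\<lambda>y. y * N + a) ` slots x a \<inter> (\<lambda>y. y * N + b) ` slots x b = {}" by fastforce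
    qed
    then have "sum w (\<Union>a\<in>reps N p. (\<lambda>y. y * N + a) ` slots x a) =
        (\<Sum>a\<in>reps N p. sum w ((\<lambda>y. y * N + a) ` slots x a))"
      using fs by (intro sum.UNION_disjoint) auto
    then show ?thesis by (simp add: elements_def)
  qed
  also have "\<dots> = (\<Sum>a\<in>reps N p. \<Sum>y\<in>slots x a. w (y * N + a))"
  proof (rule sum.cong[OF refl])
    fix a assume "a \<in> reps N p"
    have "inj_on (\<lambda>y. y * N + a) (slots x a)" using k_less by (auto intro!: inj_onI)
    then show "sum w ((\<lambda>y. y * N + a) ` slots x a) = (\<Sum>y\<in>slots x a. w (y * N + a))"
      by (simp add: sum.reindex)
  qed
  also have "\<dots> = (\<Sum>a\<in>reps N p. weight w a (p a) (fst (g a)) (snd (g a)))"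
  proof (rule sum.cong[OF refl])
    fix a assume a: "a \<in> reps N p"
    have pa: "p a < N" using permutes_in_image[OF coversD(1)[of p g], of a] assms repsD[OF a] by simp
    have mm: "max a (p a) = p a" "min a (p a) = a" using repsD[OF a] by auto
    have "(\<Sum>y\<in>slots x a. w (y * N + a)) = w ((if fst (g a) then p a else N) * N + a) +
       (\<Sum>y\<in>(\<lambda>s. N + 1 + s) ` snd (g a). w (y * N + a))"
      unfolding slots_def \<open>x = (p, g)\<close> prod.case
      using fin[OF a] pa by (subst sum.insert) auto
    also have "(\<Sum>y\<in>(\<lambda>s. N + 1 + s) ` snd (g a). w (y * N + a)) = (\<Sum>s\<in>snd (g a). w ((N + 1 + s) * N + a))"
      by (subst sum.reindex) (auto intro!: inj_onI)
    finally show "(\<Sum>y\<in>slots x a. w (y * N + a)) = weight w a (p a) (fst (g a)) (snd (g a))"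
      unfolding weight_def mm .
  qed
  finally show ?thesis by (simp add: cycle_sum_def)
qed

text \<open>Isolation yields a unique lightest set, while parity counts covers; this bridges the
  two. Every cycle owns a slot that is at most \<open>N\<close>, so the representatives can be
  recovered, then the label sets, and finally the partners.\<close>

lemma inj_on_elements: "inj_on elements cvs"
proof (rule inj_onI)
  fix x x' assume x: "x \<in> cvs" "x' \<in> cvs" and eq: "elements x = elements x'"
  obtain p g where px: "x = (p, g)" by (cases x)
  obtain p' g' where px': "x' = (p', g')" by (cases x')
  note c = coversD[OF x(1)[unfolded px]] and c' = coversD[OF x(2)[unfolded px']]
  have iff: "a \<in> reps N p \<and> y \<in> slots x a \<longleftrightarrow> a \<in> reps N p' \<and> y \<in> slots x' a" if "a < N" for a y
    using elements_iff[OF x(1) that, of y] elements_iff[OF x(2) that, of y] eq by (simp add: px px')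
  have ne: "slots x a \<noteq> {}" "slots x' a \<noteq> {}" for a
    by (auto simp: slots_def px px')
  have reps: "reps N p = reps N p'"
    using iff ne repsD(1) by blast
  have slots: "slots x a = slots x' a" if "a \<in> reps N p" for a
    using iff[OF repsD(1)[OF that]] that reps by auto
  have pN: "p a < N" "p' a < N" if "a < N" for a
    using that permutes_in_image[OF c(1)] permutes_in_image[OF c'(1)] by auto
  have key: "p a = p' a \<and> g a = g' a" if a: "a \<in> reps N p" for a
  proof -
    have aN: "a < N" using repsD[OF a] by simp
    have T: "s \<in> snd (g a) \<longleftrightarrow> N + 1 + s \<in> slots x a" "s \<in> snd (g' a) \<longleftrightarrow> N + 1 + s \<in> slots x' a" for s
      using pN[OF aN] by (auto simp: slots_def px px' split: if_splits)
    have m: "fst (g a) \<longleftrightarrow> N \<notin> slots x a" "fst (g' a) \<longleftrightarrow> N \<notin> slots x' a"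
      using pN[OF aN] by (auto simp: slots_def px px' split: if_splits)
    have 1: "fst (g a) = fst (g' a)" "snd (g a) = snd (g' a)"
      using T m slots[OF a] by auto
    have "p a = p' a"
    proof (cases "fst (g a)")
      case True
      have "y \<in> slots x a \<and> y < N \<longleftrightarrow> y = p a" "y \<in> slots x' a \<and> y < N \<longleftrightarrow> y = p' a" for y
        using True 1 pN[OF aN] by (auto simp: slots_def px px')
      then show ?thesis using slots[OF a] by auto
    next
      case False
      then show ?thesis using c(4)[OF a] c'(4)[of a] a reps 1 by (simp add: ok_def)
    qed
    then show ?thesis using 1 by (simp add: prod_eq_iff)
  qed
  have "p a = p' a" for a
  proof (cases "a < N")
    case False
    then show ?thesis using c(1) c'(1) by (simp add: permutes_not_in)
  next
    case True
    show ?thesis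
    proof (cases "a \<le> p a")
      case True
      then show ?thesis using key[of a] \<open>a < N\<close> by (simp add: reps_def)
    next
      case False
      then have "p a \<in> reps N p" using c(2)[of a] pN[OF \<open>a < N\<close>] by (simp add: reps_def)
      then have "a = p' (p a)" using key[of "p a"] c(2)[of a] by simp
      then show ?thesis using c'(2)[of "p a"] by simp
    qed
  qed
  then have "p = p'" by auto
  moreover have "g = g'"
    using c(5) c'(5) key reps by (intro extensionalityI[of g "reps N p" g']) auto
  ultimately show "x = x'" by (simp add: px px')
qed

text \<open>The labels of a cover have union \<open>{..<k}\<close>; total size \<open>k\<close> then
  leaves no room for a label to occur twice.\<close>

definition solutions :: "nat \<Rightarrow> nat \<Rightarrow> ((nat \<Rightarrow> nat) \<times> (nat \<Rightarrow> bool \<times> nat set)) set" where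
  "solutions l P = {x \<in> cvs. labels x = k \<and> used x \<le> l \<and> P \<le> total_gain x}"

definition accepts :: "nat \<Rightarrow> (nat \<Rightarrow> nat) \<Rightarrow> nat \<Rightarrow> nat \<Rightarrow> bool" where
  "accepts K w l P \<longleftrightarrow> (\<exists>b<K. \<exists>p<K. \<exists>v<K. b \<le> l \<and> P \<le> p \<and>
     odd (card {x \<in> cvs. cycle_sum N (code K w) x = k + K * (b + K * (p + K * v))}))"

lemma card_reps: "card (reps N p) \<le> N"
  using card_mono[of "{..<N}" "reps N p"] by (auto simp: reps_def)

lemma cycle_sum_le:
  assumes "\<And>a. a \<in> reps N p \<Longrightarrow> f a (p a) (fst (g a)) (snd (g a)) \<le> Q"
  shows "cycle_sum N f (p, g) \<le> N * Q"
proof -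
  have "cycle_sum N f (p, g) \<le> of_nat (card (reps N p)) * Q"
    unfolding cycle_sum_def prod.case using assms by (rule sum_bounded_above)
  then show ?thesis using order_trans[OF _ mult_le_mono1[OF card_reps[of p]]] by simp
qed

text \<open>The weight is bounded through the ground elements, at most \<open>2 * N * N\<close> of
  them with weight at most \<open>W - 1\<close>. This and the total gain dictate the size of
  \<open>K\<close>.\<close>

lemma components_less:
  assumes x: "x \<in> cvs" and K: "2 * N * N * W + N * Q \<le> K"
    and Q: "\<And>a b T. a < N \<Longrightarrow> b < N \<Longrightarrow> T \<subseteq> {..<k} \<Longrightarrow> pr a b T \<le> Q"
    and W: "\<And>i. w i < W"
  shows "labels x < K" "used x < K" "total_gain x < K" "total_weight w x < K"
proof -
  obtain p g where px: "x = (p, g)" by (cases x)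
  note c = coversD[OF x[unfolded px]]
  have W1: "W \<ge> 1" using W[of 0] by simp
  have N1: "N \<ge> 1" using k_less by simp
  have NN: "N * N < 2 * N * N * W" using W1 N1
  proof -
    have "N * N * 1 \<le> N * N * W" "0 < N * N" using W1 N1 by auto
    moreover have "2 * N * N * W = 2 * (N * N * W)" by simp
    ultimately show ?thesis by linarith
  qed
  have 1: "labels x \<le> N * k" unfolding px
    using c(3) by (intro cycle_sum_le) (metis card_lessThan card_mono finite_lessThan)
  have 2: "used x \<le> N * 1" unfolding px by (intro cycle_sum_le) auto
  have 3: "total_gain x \<le> N * Q" unfolding px
  proof (intro cycle_sum_le)
    fix a assume a: "a \<in> reps N p"
    have "p a < N" using permutes_in_image[OF c(1), of a] repsD[OF a] by simp
    then show "gain a (p a) (fst (g a)) (snd (g a)) \<le> Q"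
      using Q[OF repsD(1)[OF a] _ c(3)[OF a]] by (simp add: gain_def)
  qed
  have 4: "total_weight w x \<le> 2 * N * N * (W - 1)"
  proof -
    have "sum w (elements x) \<le> of_nat (card (elements x)) * (W - 1)"
      using W W1 by (intro sum_bounded_above) (metis One_nat_def Suc_pred Suc_le_lessD less_Suc_eq_le)
    also have "\<dots> \<le> 2 * N * N * (W - 1)"
      using card_mono[OF _ elements_less[OF x]] by (intro mult_le_mono1) auto
    finally show ?thesis using total_weight_eq[OF x] by simp
  qed
  have "N * k \<le> N * N" using k_less by simp
  then show "labels x < K" using 1 NN K by linarith
  have "N * 1 \<le> N * N" using N1 by simp
  then show "used x < K" using 2 NN K by linarith
  have "0 < N * N" using N1 by simp
  then show "total_gain x < K" using 3 NN K by linarith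
  have "2 * N * N * (W - 1) < 2 * N * N * W" using W1 N1 by simp
  then show "total_weight w x < K" using 4 K by linarith
qed

text \<open>An odd number of covers is not zero, and the digits of the exponent are unambiguous.
  Hence there are no false positives, whatever the weights.\<close>

theorem accepts_imp_solution:
  assumes K: "2 * N * N * W + N * Q \<le> K"
    and Q: "\<And>a b T. a < N \<Longrightarrow> b < N \<Longrightarrow> T \<subseteq> {..<k} \<Longrightarrow> pr a b T \<le> Q"
    and W: "\<And>i. w i < W"
    and "accepts K w l P"
  shows "solutions l P \<noteq> {}"
proof -
  from assms(4) obtain b p v where *: "b < K" "p < K" "v < K" "b \<le> l" "P \<le> p" and
    odd: "odd (card {x \<in> cvs. cycle_sum N (code K w) x = k + K * (b + K * (p + K * v))})"
    unfolding accepts_def by blast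
  have "{x \<in> cvs. cycle_sum N (code K w) x = k + K * (b + K * (p + K * v))} \<noteq> {}"
  proof
    assume "{x \<in> cvs. cycle_sum N (code K w) x = k + K * (b + K * (p + K * v))} = {}"
    then show False using odd by (simp only: card.empty) simp
  qed
  then obtain x where x: "x \<in> cvs" "cycle_sum N (code K w) x = k + K * (b + K * (p + K * v))" by blast
  note less = components_less[OF x(1) K Q W]
  have "k < K"
  proof -
    have "N * 1 \<le> N * (2 * N * W)" using k_less W[of 0] by (intro mult_le_mono2) auto
    moreover have "2 * N * N * W = N * (2 * N * W)" by simp
    ultimately show ?thesis using K k_less by linarith
  qed
  then have "labels x = k \<and> used x = b \<and> total_gain x = p"
    using x(2) less * unfolding cycle_sum_code by (simp add: radix_eq_iff)
  then show ?thesis using * x(1) unfolding solutions_def by blast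
qed

theorem isolated_imp_accepts:
  assumes K: "2 * N * N * W + N * Q \<le> K"
    and Q: "\<And>a b T. a < N \<Longrightarrow> b < N \<Longrightarrow> T \<subseteq> {..<k} \<Longrightarrow> pr a b T \<le> Q"
    and W: "\<And>i. w i < W"
    and iso: "isolated (elements ` solutions l P) w"
  shows "accepts K w l P"
proof -
  from iso obtain x where x: "x \<in> solutions l P"
    "\<And>y. y \<in> solutions l P \<Longrightarrow> elements y \<noteq> elements x \<Longrightarrow> sum w (elements x) < sum w (elements y)"
    unfolding isolated_def by auto
  have xc: "x \<in> cvs" "labels x = k" "used x \<le> l" "P \<le> total_gain x"
    using x(1) by (auto simp: solutions_def)
  note less = components_less[OF xc(1) K Q W]
  \<comment> \<open>A cover with the same four digits is again a solution and has the same weight,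
    so isolation identifies it with \<open>x\<close>. The count is exactly 1, in particular
    odd.\<close>
  have "{y \<in> cvs. cycle_sum N (code K w) y =
      k + K * (used x + K * (total_gain x + K * total_weight w x))} = {x}"
  proof (intro set_eqI iffI)
    fix y assume "y \<in> {y \<in> cvs. cycle_sum N (code K w) y =
      k + K * (used x + K * (total_gain x + K * total_weight w x))}"
    then have y: "y \<in> cvs" "cycle_sum N (code K w) y = cycle_sum N (code K w) x"
      by (auto simp: cycle_sum_code xc)
    note less' = components_less[OF y(1) K Q W]
    have eq: "labels y = labels x" "used y = used x" "total_gain y = total_gain x" "total_weight w y = total_weight w x"
      using y(2) less less' unfolding cycle_sum_code by (auto simp: radix_eq_iff)
    then have "y \<in> solutions l P" using xc y(1) by (simp add: solutions_def)
    moreover have "sum w (elements y) = sum w (elements x)"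
      using eq(4) total_weight_eq y(1) xc(1) by simp
    ultimately have "elements y = elements x" using x(2)[of y] by force
    then show "y \<in> {x}" using inj_on_elements y(1) xc(1) by (auto dest: inj_onD)
  next
    fix y assume "y \<in> {x}"
    then show "y \<in> {y \<in> cvs. cycle_sum N (code K w) y =
      k + K * (used x + K * (total_gain x + K * total_weight w x))}"
      using xc(1,2) cycle_sum_code[of K w x] by simp
  qed
  then have "odd (card {y \<in> cvs. cycle_sum N (code K w) y =
      k + K * (used x + K * (total_gain x + K * total_weight w x))})" by simp
  then show ?thesis unfolding accepts_def
    using less(2-4) xc(3,4) by (intro exI[of _ "used x"] exI[of _ "total_gain x"] exI[of _ "total_weight w x"] conjI)
qed

end

section \<open>Packings as involutions\<close>

lemma bij_betw_card_less:
  fixes S :: "nat set"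
  assumes "finite S"
  shows "bij_betw (\<lambda>v. card {u \<in> S. u < v}) S {..<card S}"
proof -
  let ?r = "\<lambda>v. card {u \<in> S. u < v}"
  have mono: "?r v < ?r w" if "v \<in> S" "v < w" for v w
    using that assms by (intro psubset_card_mono) auto
  have inj: "inj_on ?r S"
  proof (rule inj_onI)
    fix v w assume "v \<in> S" "w \<in> S" "?r v = ?r w"
    then show "v = w" using mono[of v w] mono[of w v] by (cases v w rule: linorder_cases) auto
  qed
  have "?r v < card S" if "v \<in> S" for v
    using that assms by (intro psubset_card_mono) auto
  then have "?r ` S \<subseteq> {..<card S}" by auto
  then have "?r ` S = {..<card S}"
    using card_image[OF inj] by (intro card_subset_eq) auto
  then show ?thesis using inj by (simp add: bij_betw_def)
qed

text \<open>A common element of two of the sets is counted twice in the sum of the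
  cardinalities.\<close>

lemma disjoint_if_card_UN_eq_sum:
  assumes "finite A" "\<And>a. a \<in> A \<Longrightarrow> finite (T a)" "card (\<Union>a\<in>A. T a) = (\<Sum>a\<in>A. card (T a))"
    and "a \<in> A" "b \<in> A" "a \<noteq> b"
  shows "T a \<inter> T b = {}"
proof (rule ccontr)
  assume "T a \<inter> T b \<noteq> {}"
  then obtain x where x: "x \<in> T a" "x \<in> T b" by blast
  have "(\<Union>c\<in>A. T c) = (\<Union>c\<in>A - {b}. T c) \<union> (T b - {x})" using x assms(4-6) by blast
  also have "card \<dots> \<le> card (\<Union>c\<in>A - {b}. T c) + card (T b - {x})" by (rule card_Un_le)
  also have "\<dots> \<le> (\<Sum>c\<in>A - {b}. card (T c)) + card (T b - {x})"
    using assms(1) by (intro add_right_mono card_UN_le) auto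
  also have "\<dots> < (\<Sum>c\<in>A - {b}. card (T c)) + card (T b)"
    using x assms(2)[OF assms(5)] by (intro add_strict_left_mono psubset_card_mono) auto
  also have "\<dots> = (\<Sum>c\<in>A. card (T c))" using assms(1,5) by (simp add: sum.remove add.commute)
  finally show False using assms(3) by simp
qed

lemma reps_leD: "a \<in> reps N p \<Longrightarrow> a \<le> p a"
  by (simp add: reps_def)

text \<open>Consecutive labels \<open>0, ..., num_small I - 1\<close> are needed, wherever the small
  items stand in the list, so that label sets become numbers below
  \<open>2 ^ num_small I\<close>.\<close>

definition small_rank :: "vmk \<Rightarrow> nat \<Rightarrow> nat" where
  "small_rank I v = card {u \<in> small_items I. u < v}"

definition labelled :: "vmk \<Rightarrow> nat set \<Rightarrow> nat set" where
  "labelled I T = {v \<in> small_items I. small_rank I v \<in> T}"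

text \<open>A vertex contributes its item if it is large; a small item serves as an empty bin.\<close>

definition bin_items :: "vmk \<Rightarrow> nat \<Rightarrow> nat \<Rightarrow> nat set \<Rightarrow> nat set" where
  "bin_items I a b T = {a, b} \<inter> large_items I \<union> labelled I T"

definition fits :: "vmk \<Rightarrow> nat set \<Rightarrow> bool" where
  "fits I B \<longleftrightarrow> (\<forall>j<vdim I. (\<Sum>v\<in>B. item_coord I v j) \<le> 1)"

definition set_profit :: "vmk \<Rightarrow> nat set \<Rightarrow> nat" where
  "set_profit I B = (\<Sum>v\<in>B. item_profit I v)"

text \<open>The additional vertex makes \<open>num_small I < verts I\<close> strict and keeps the
  matrix nonempty even if there are no items.\<close>

definition verts :: "vmk \<Rightarrow> nat" where
  "verts I = length (items I) + 1"

lemma finite_items [simp]: "finite (all_items I)" "finite (small_items I)" "finite (large_items I)"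
  by (auto simp: all_items_def small_items_def large_items_def)

lemma item_less: "v \<in> small_items I \<Longrightarrow> v < length (items I)" "v \<in> large_items I \<Longrightarrow> v < length (items I)"
  by (auto simp: all_items_def small_items_def large_items_def)

lemma num_small_le: "num_small I \<le> length (items I)"
  using card_mono[of "all_items I" "small_items I"]
  by (auto simp: num_small_def small_items_def all_items_def)

lemma bij_betw_rank: "bij_betw (small_rank I) (small_items I) {..<num_small I}"
  using bij_betw_card_less[of "small_items I"] by (simp add: small_rank_def[abs_def] num_small_def)

lemma finite_bin_items [simp]: "finite (bin_items I a b T)"
  by (auto simp: bin_items_def labelled_def)

lemma bin_items_subset: "bin_items I a b T \<subseteq> all_items I"
  by (auto simp: bin_items_def labelled_def large_items_def small_items_def)

lemma bin_items_commute: "bin_items I a b T = bin_items I b a T"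
  by (auto simp: bin_items_def)

global_interpretation ks: knapsack_sieve "verts I" "num_small I"
    "\<lambda>a b T. fits I (bin_items I a b T)" "\<lambda>a b T. set_profit I (bin_items I a b T)" for I
  by standard (auto simp: bin_items_commute verts_def less_Suc_eq_le num_small_le)

lemma labelled_rank_image: "U \<subseteq> small_items I \<Longrightarrow> labelled I (small_rank I ` U) = U"
  using bij_betw_imp_inj_on[OF bij_betw_rank[of I]] by (auto simp: labelled_def dest: inj_onD)

text \<open>The only use of 3-incompatibility. As coordinates are nonnegative, three large items in
  a bin would already exceed its capacity in some coordinate.\<close>

lemma fits_pair:
  assumes "vmk_instance I" "fits I B" "B \<subseteq> all_items I"
    "u \<in> B \<inter> large_items I" "v \<in> B \<inter> large_items I" "w \<in> B \<inter> large_items I"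
  shows "u = v \<or> v = w \<or> u = w"
proof (rule ccontr)
  assume d: "\<not> ?thesis"
  have "three_incompatible I (large_items I)" using assms(1) by (simp add: vmk_instance_def)
  then obtain j where j: "j < vdim I" "item_coord I u j + item_coord I v j + item_coord I w j > 1"
    using d assms(4-6) unfolding three_incompatible_def by blast
  have "(\<Sum>x\<in>{u, v, w}. item_coord I x j) \<le> (\<Sum>x\<in>B. item_coord I x j)"
    using assms(1,3-6) j(1) finite_subset[OF assms(3)]
    by (intro sum_mono2) (auto simp: vmk_instance_def)
  also have "\<dots> \<le> 1" using assms(2) j(1) by (simp add: fits_def)
  finally show False using j(2) d by simp
qed

theorem solution_imp_yes:
  assumes x: "x \<in> ks.solutions I (bins I) (goal_profit I)"
  shows "vmk_yes I"
proof -
  obtain p g where px: "x = (p, g)" by (cases x)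
  let ?N = "verts I" and ?k = "num_small I"
  let ?V = "reps ?N p"
  have xc: "(p, g) \<in> covers (ks.ok I) ?N {..<?k}"
    and lab: "(\<Sum>a\<in>?V. card (snd (g a))) = ?k" and used: "(\<Sum>a\<in>?V. of_bool (fst (g a))) \<le> bins I"
    and gain: "goal_profit I \<le> (\<Sum>a\<in>?V. ks.gain I a (p a) (fst (g a)) (snd (g a)))"
    using x unfolding px ks.solutions_def cycle_sum_def by auto
  note c = ks.coversD[OF xc]
  define A where "A = {a \<in> ?V. fst (g a)}"
  define C where "C a = bin_items I a (p a) (snd (g a))" for a
  have finA: "finite A" by (simp add: A_def)
  have "card A \<le> bins I" using used by (simp add: A_def of_bool_def sum.inter_filter[symmetric])
  from ex_bij_betw_nat_finite[OF finA] obtain h where h: "bij_betw h {..<card A} A"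
    by (auto simp: atLeast0LessThan)
  have hA: "h i \<in> A" if "i < card A" for i using h that by (auto dest: bij_betwE)
  \<comment> \<open>The used cycles fill the first bins; any further bins stay empty.\<close>
  define B where "B i = (if i < card A then C (h i) else {})" for i
  \<comment> \<open>All \<open>?k\<close> labels occur and the sizes add up to \<open>?k\<close>, so
    no small item is packed twice.\<close>
  have T: "snd (g a) \<inter> snd (g b) = {}" if "a \<in> ?V" "b \<in> ?V" "a \<noteq> b" for a b
  proof (rule disjoint_if_card_UN_eq_sum[OF _ _ _ that])
    show "finite (snd (g a))" if "a \<in> ?V" for a using c(3)[OF that] finite_subset by blast
    show "card (\<Union>a\<in>?V. snd (g a)) = (\<Sum>a\<in>?V. card (snd (g a)))" using c(6) lab by simp
  qed simp
  have C_disj: "C a \<inter> C b = {}" if "a \<in> ?V" "b \<in> ?V" "a \<noteq> b" for a b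
  proof -
    have "{a, p a} \<inter> {b, p b} = {}"
      using that c(2) reps_leD[of a ?N p] reps_leD[of b ?N p] by (auto dest: antisym) (metis antisym)+
    moreover have "labelled I (snd (g a)) \<inter> labelled I (snd (g b)) = {}"
      using T[OF that] by (auto simp: labelled_def)
    moreover have "large_items I \<inter> labelled I X = {}" for X
      by (auto simp: labelled_def large_items_def)
    ultimately show ?thesis unfolding C_def bin_items_def by blast
  qed
  have UB: "(\<Union>i<bins I. B i) = (\<Union>a\<in>A. C a)"
  proof
    show "(\<Union>i<bins I. B i) \<subseteq> (\<Union>a\<in>A. C a)" using hA by (auto simp: B_def split: if_splits)
    show "(\<Union>a\<in>A. C a) \<subseteq> (\<Union>i<bins I. B i)"
    proof
      fix v assume "v \<in> (\<Union>a\<in>A. C a)"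
      then obtain a where a: "a \<in> A" "v \<in> C a" by blast
      have "a \<in> h ` {..<card A}" using bij_betw_imp_surj_on[OF h] a(1) by simp
      then obtain i where i: "i < card A" "h i = a" by auto
      then have "v \<in> B i" "i < bins I" using a \<open>card A \<le> bins I\<close> by (auto simp: B_def)
      then show "v \<in> (\<Union>i<bins I. B i)" by blast
    qed
  qed
  show ?thesis
    unfolding vmk_yes_def
  proof (intro exI conjI)
    show "(\<Union>i<bins I. B i) = (\<Union>a\<in>A. C a)" by (rule UB)
    show "(\<Union>a\<in>A. C a) \<subseteq> all_items I" unfolding C_def by (intro UN_least bin_items_subset)
    show "disjoint_family_on B {..<bins I}"
      unfolding disjoint_family_on_def
    proof (intro ballI impI)
      fix i j :: nat assume "i \<noteq> j"
      show "B i \<inter> B j = {}"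
      proof (cases "i < card A \<and> j < card A")
        case True
        then have "h i \<noteq> h j" using h \<open>i \<noteq> j\<close> by (auto simp: bij_betw_def inj_on_def)
        then show ?thesis using C_disj[of "h i" "h j"] hA[of i] hA[of j] True by (auto simp: B_def A_def)
      qed (auto simp: B_def)
    qed
    show "\<forall>i<bins I. \<forall>j<vdim I. (\<Sum>v\<in>B i. item_coord I v j) \<le> 1"
    proof (intro allI impI)
      fix i j assume "i < bins I" "j < vdim I"
      show "(\<Sum>v\<in>B i. item_coord I v j) \<le> 1"
      proof (cases "i < card A")
        case True
        then have "fits I (C (h i))"
          using hA[OF True] c(4)[of "h i"] by (auto simp: A_def ks.ok_def C_def)
        then show ?thesis using True \<open>j < vdim I\<close> by (simp add: B_def fits_def)
      qed (simp add: B_def)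
    qed
    have "(\<Sum>v\<in>(\<Union>a\<in>A. C a). item_profit I v) = (\<Sum>a\<in>A. set_profit I (C a))"
      unfolding set_profit_def using finA C_disj
      by (intro sum.UNION_disjoint) (auto simp: C_def A_def)
    also have "\<dots> = (\<Sum>a\<in>?V. ks.gain I a (p a) (fst (g a)) (snd (g a)))"
      unfolding A_def ks.gain_def C_def by (subst sum.inter_filter) auto
    finally show "goal_profit I \<le> (\<Sum>v\<in>(\<Union>a\<in>A. C a). item_profit I v)" using gain by simp
  qed
qed

theorem yes_imp_solution:
  assumes inst: "vmk_instance I" and yes: "vmk_yes I"
  shows "ks.solutions I (bins I) (goal_profit I) \<noteq> {}"
proof -
  let ?N = "verts I" and ?k = "num_small I" and ?L = "large_items I" and ?S = "small_items I"
  from yes obtain V' B where V': "V' \<subseteq> all_items I" "(\<Union>i<bins I. B i) = V'"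
    and disj: "disjoint_family_on B {..<bins I}"
    and feas: "\<forall>i<bins I. \<forall>j<vdim I. (\<Sum>v\<in>B i. item_coord I v j) \<le> 1"
    and gain: "goal_profit I \<le> (\<Sum>v\<in>V'. item_profit I v)" unfolding vmk_yes_def by blast
  define Z where "Z = {i. i < bins I \<and> B i \<noteq> {}}"
  have finZ: "finite Z" by (simp add: Z_def)
  have fitsB: "fits I (B i)" if "i < bins I" for i using feas that by (simp add: fits_def)
  have BV: "B i \<subseteq> all_items I" if "i < bins I" for i using V' that by blast
  have finB: "finite (B i)" if "i < bins I" for i using finite_subset[OF BV[OF that]] by simp
  have Bdisj: "i = j" if "v \<in> B i" "v \<in> B j" "i < bins I" "j < bins I" for v i j
    using disj that unfolding disjoint_family_on_def by blast
  \<comment> \<open>Large items sharing a bin become 2-cycles; \<open>fits_pair\<close> makes the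
    partner unique.\<close>
  define Pr where "Pr a b \<longleftrightarrow> a \<noteq> b \<and> (\<exists>i<bins I. a \<in> B i \<inter> ?L \<and> b \<in> B i \<inter> ?L)" for a b
  have Pr_sym: "Pr a b \<Longrightarrow> Pr b a" for a b unfolding Pr_def by blast
  have Pr_unique: "b = c" if "Pr a b" "Pr a c" for a b c
  proof -
    obtain i j where i: "i < bins I" "a \<in> B i \<inter> ?L" "b \<in> B i \<inter> ?L"
      and j: "j < bins I" "a \<in> B j \<inter> ?L" "c \<in> B j \<inter> ?L" using \<open>Pr a b\<close> \<open>Pr a c\<close> unfolding Pr_def by blast
    then have "i = j" using Bdisj by blast
    then show ?thesis
      using fits_pair[OF inst fitsB[OF i(1)] BV[OF i(1)] i(2) i(3), of c] j that by (auto simp: Pr_def)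
  qed
  define p where "p a = (if \<exists>b. Pr a b then THE b. Pr a b else a)" for a
  have p1: "p a = b" if "Pr a b" for a b
  proof -
    have "(THE b. Pr a b) = b" using that Pr_unique by blast
    then show ?thesis using that by (auto simp: p_def)
  qed
  have p2: "p a = a" if "\<And>b. \<not> Pr a b" for a using that by (simp add: p_def)
  have pp: "p (p a) = a" for a
    using p1 p2 Pr_sym by metis
  have p_cases: "p a = a \<or> Pr a (p a)" for a using p1 p2 by metis
  have p_perm: "p permutes {..<?N}"
  proof -
    have "p a = a" if "a \<notin> {..<?N}" for a
      using that by (intro p2) (auto simp: Pr_def verts_def dest: item_less(2))
    moreover have "\<exists>!a. p a = b" for b using pp by metis
    ultimately show ?thesis by (simp add: permutes_def)
  qed
  \<comment> \<open>The vertex hosting a bin. The smallest large item is the representative of its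
    cycle; a bin of small items only is hosted by its smallest item, which is a fixed point.\<close>
  define r where "r i = (if B i \<inter> ?L \<noteq> {} then Min (B i \<inter> ?L) else Min (B i))" for i
  have rL: "r i \<in> ?L \<and> (\<forall>b\<in>B i \<inter> ?L. r i \<le> b)" if "i < bins I" "B i \<inter> ?L \<noteq> {}" for i
  proof -
    have "Min (B i \<inter> ?L) \<in> B i \<inter> ?L" using that by (intro Min_in) auto
    then show ?thesis using that by (auto simp: r_def)
  qed
  have rB: "r i \<in> B i" if "i \<in> Z" for i
  proof (cases "B i \<inter> ?L = {}")
    case True
    then show ?thesis using that finB[of i] Min_in[of "B i"] by (auto simp: r_def Z_def)
  next
    case False
    then have "Min (B i \<inter> ?L) \<in> B i \<inter> ?L" using that by (intro Min_in) auto
    then show ?thesis using False by (simp add: r_def)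
  qed
  have r_inj: "inj_on r Z"
    using rB Bdisj unfolding Z_def by (intro inj_onI) (metis (mono_tags, lifting) mem_Collect_eq)
  have Zl: "i < bins I" if "i \<in> Z" for i using that by (simp add: Z_def)
  have pB: "{r i, p (r i)} \<inter> ?L = B i \<inter> ?L \<and> r i \<le> p (r i)" if i: "i \<in> Z" for i
  proof (cases "B i \<inter> ?L = {}")
    case True
    have "r i \<notin> ?L" using True rB[OF i] by blast
    then have "p (r i) = r i" by (intro p2) (auto simp: Pr_def)
    then show ?thesis using True \<open>r i \<notin> ?L\<close> by auto
  next
    case False
    note rL = rL[OF Zl[OF i] False]
    show ?thesis
    proof (cases "\<exists>b. Pr (r i) b")
      case True
      then obtain b where b: "Pr (r i) b" by blast
      then obtain j where j: "j < bins I" "r i \<in> B j" "b \<in> B j \<inter> ?L" "b \<noteq> r i" by (auto simp: Pr_def)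
      then have bi: "b \<in> B i \<inter> ?L" using Bdisj rB[OF i] Zl[OF i] by metis
      have "c \<in> {r i, b}" if "c \<in> B i \<inter> ?L" for c
        using fits_pair[OF inst fitsB BV, of i "r i" b c] Zl[OF i] rL rB[OF i] bi that j by auto
      then have "{r i, b} \<inter> ?L = B i \<inter> ?L" using bi rL rB[OF i] by blast
      then show ?thesis using p1[OF b] rL bi by auto
    next
      case False
      then have pr: "p (r i) = r i" using p2 by blast
      have "c = r i" if "c \<in> B i \<inter> ?L" for c
      proof (rule ccontr)
        assume "c \<noteq> r i"
        then have "Pr (r i) c"
          unfolding Pr_def using that rL rB[OF i] by (intro conjI exI[of _ i] Zl[OF i]) auto
        then show False using False by blast
      qed
      then have "B i \<inter> ?L = {r i}" using rL rB[OF i] by blast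
      then show ?thesis using rL by (simp add: pr)
    qed
  qed
  define inv_r where "inv_r = inv_into Z r"
  have inv_r: "inv_r (r i) = i" if "i \<in> Z" for i unfolding inv_r_def using inv_into_f_f[OF r_inj that] .
  define T where "T a = (if a \<in> r ` Z then small_rank I ` (B (inv_r a) \<inter> ?S)
      else if a \<in> ?S - V' then {small_rank I a} else {})" for a
  let ?V = "reps ?N p"
  define g where "g = (\<lambda>a\<in>?V. (a \<in> r ` Z, T a))"
  have rank_S: "small_rank I v < ?k" if "v \<in> ?S" for v using bij_betw_rank[of I] that by (auto dest: bij_betwE)
  have Tr: "T (r i) = small_rank I ` (B i \<inter> ?S)" if "i \<in> Z" for i using that inv_r by (simp add: T_def)
  have rV: "r i \<in> ?V" if "i \<in> Z" for i
  proof -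
    have "r i < length (items I)" using rB[OF that] BV[OF Zl[OF that]] by (auto simp: all_items_def)
    then show ?thesis using pB[OF that] by (simp add: reps_def verts_def)
  qed
  have T_sub: "T a \<subseteq> {..<?k}" for a using rank_S by (auto simp: T_def)
  have bin_items_r: "bin_items I (r i) (p (r i)) (T (r i)) = B i" if "i \<in> Z" for i
  proof -
    have "bin_items I (r i) (p (r i)) (T (r i)) = B i \<inter> ?L \<union> B i \<inter> ?S"
      unfolding bin_items_def Tr[OF that] using pB[OF that] labelled_rank_image[of "B i \<inter> ?S" I] by simp
    also have "\<dots> = B i" using BV[OF Zl[OF that]] by (auto simp: large_items_def)
    finally show ?thesis .
  qed
  have not_r: "p a = a" if "a \<in> ?V" "a \<notin> r ` Z" for a
  proof (rule ccontr)
    assume "p a \<noteq> a"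
    then have "Pr a (p a)" using p_cases by blast
    then obtain i where i: "i < bins I" "a \<in> B i \<inter> ?L" "p a \<in> B i \<inter> ?L" by (auto simp: Pr_def)
    then have iZ: "i \<in> Z" by (auto simp: Z_def)
    have "a \<in> {r i, p (r i)}" using pB[OF iZ] i(2) by blast
    then have "a = p (r i)" using that iZ by auto
    then have "p a = r i" using pp by simp
    moreover have "r i \<le> a" using rL[OF i(1)] i(2) by blast
    ultimately have "a = r i" using reps_leD[OF that(1)] by simp
    then show False using that iZ by blast
  qed
  have g_simps: "fst (g a) = (a \<in> r ` Z)" "snd (g a) = T a" if "a \<in> ?V" for a
    using that by (auto simp: g_def)
  have T_disj: "T a \<inter> T b = {}" if ab: "a \<noteq> b" for a b
  proof -
    define O' where "O' a = (if a \<in> r ` Z then B (inv_r a) \<inter> ?S else if a \<in> ?S - V' then {a} else {})" for a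
    have TO: "T a = small_rank I ` O' a" "O' a \<subseteq> ?S" for a by (auto simp: T_def O'_def)
    have "O' a \<inter> O' b = {}"
    proof (cases "a \<in> r ` Z \<and> b \<in> r ` Z")
      case True
      then obtain i j where "a = r i" "b = r j" "i \<in> Z" "j \<in> Z" by blast
      moreover have "B i \<inter> B j = {}"
        using ab calculation Bdisj Zl by (metis Int_emptyI)
      ultimately show ?thesis using inv_r by (auto simp: O'_def)
    next
      case False
      have "B (inv_r a) \<subseteq> V'" if "a \<in> r ` Z" for a using that inv_r V'(2) Zl by auto
      then show ?thesis using False ab by (auto simp: O'_def split: if_splits)
    qed
    then show ?thesis
      using TO bij_betw_imp_inj_on[OF bij_betw_rank[of I]] inj_on_image_Int[of "small_rank I" ?S "O' a" "O' b"]
      by auto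
  qed
  have T_UN: "(\<Union>a\<in>?V. T a) = {..<?k}"
  proof
    show "{..<?k} \<subseteq> (\<Union>a\<in>?V. T a)"
    proof
      fix s assume "s \<in> {..<?k}"
      then obtain v where v: "v \<in> ?S" "s = small_rank I v"
        using bij_betw_imp_surj_on[OF bij_betw_rank[of I]] by blast
      show "s \<in> (\<Union>a\<in>?V. T a)"
      proof (cases "v \<in> V'")
        case True
        then obtain i where "i < bins I" "v \<in> B i" using V'(2) by blast
        then have "i \<in> Z" by (auto simp: Z_def)
        then show ?thesis using Tr[of i] rV[of i] \<open>v \<in> B i\<close> v by blast
      next
        case False
        have "v \<notin> ?L" using v(1) by (simp add: large_items_def)
        then have "p v = v" by (intro p2) (auto simp: Pr_def)
        moreover have "v < ?N" using item_less(1)[OF v(1)] by (simp add: verts_def)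
        ultimately have "v \<in> ?V" by (simp add: reps_def)
        moreover have "v \<notin> r ` Z" using rB Zl False V'(2) by blast
        ultimately show ?thesis using False v by (auto simp: T_def intro!: bexI[of _ v])
      qed
    qed
  qed (use T_sub in blast)
  have cov: "(p, g) \<in> covers (ks.ok I) ?N {..<?k}"
  proof -
    have "ks.ok I a (p a) (a \<in> r ` Z) (T a)" if "a \<in> ?V" for a
      using that not_r bin_items_r fitsB Zl by (auto simp: ks.ok_def)
    then have "g \<in> (\<Pi>\<^sub>E a\<in>?V. opts (ks.ok I) {..<?k} a (p a))"
      using T_sub unfolding g_def opts_def by (intro PiE_I) auto
    then show ?thesis using p_perm pp T_UN g_simps by (auto simp: covers_def fun_eq_iff)
  qed
  have VZ: "{a \<in> ?V. a \<in> r ` Z} = r ` Z" using rV by auto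
  have "(\<Sum>a\<in>?V. card (snd (g a))) = card (\<Union>a\<in>?V. T a)"
    using T_disj T_sub finite_subset[of _ "{..<?k}"] by (subst card_UN_disjoint) (auto simp: g_simps)
  then have 1: "(\<Sum>a\<in>?V. card (snd (g a))) = ?k" using T_UN by simp
  have "(\<Sum>a\<in>?V. of_bool (fst (g a))) = (\<Sum>a\<in>?V. if a \<in> r ` Z then 1 else 0 :: nat)"
    by (intro sum.cong) (auto simp: g_simps)
  also have "\<dots> = card (r ` Z)" by (simp only: sum.inter_filter[OF finite_reps, symmetric] VZ) simp
  also have "\<dots> \<le> card Z" using finZ by (rule card_image_le)
  also have "\<dots> \<le> card {..<bins I}" by (rule card_mono) (auto simp: Z_def)
  finally have 2: "(\<Sum>a\<in>?V. of_bool (fst (g a))) \<le> bins I" by simp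
  have "(\<Sum>v\<in>V'. item_profit I v) = (\<Sum>i\<in>Z. set_profit I (B i))"
  proof -
    have "V' = (\<Union>i\<in>Z. B i)" using V'(2) by (auto simp: Z_def)
    then show ?thesis unfolding set_profit_def using finZ finB Zl Bdisj
      by (simp only:) (intro sum.UNION_disjoint; blast)
  qed
  also have "\<dots> = (\<Sum>i\<in>Z. set_profit I (bin_items I (r i) (p (r i)) (T (r i))))"
    using bin_items_r by simp
  also have "\<dots> = (\<Sum>a\<in>r ` Z. set_profit I (bin_items I a (p a) (T a)))"
    using r_inj by (simp add: sum.reindex)
  also have "\<dots> = (\<Sum>a\<in>?V. if a \<in> r ` Z then set_profit I (bin_items I a (p a) (T a)) else 0)"
    by (simp only: sum.inter_filter[OF finite_reps, symmetric] VZ)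
  also have "\<dots> = (\<Sum>a\<in>?V. ks.gain I a (p a) (fst (g a)) (snd (g a)))"
    by (intro sum.cong) (auto simp: ks.gain_def g_simps)
  finally have 3: "goal_profit I \<le> (\<Sum>a\<in>?V. ks.gain I a (p a) (fst (g a)) (snd (g a)))"
    using gain by simp
  have "(p, g) \<in> ks.solutions I (bins I) (goal_profit I)"
    using cov 1 2 3 by (simp add: ks.solutions_def cycle_sum_def)
  then show ?thesis by blast
qed

section \<open>Evaluation at a power of two\<close>

lemma sum_hom:
  assumes "h 0 = 0" "\<And>x y. h (x + y) = h x + h y"
  shows "h (sum f S) = (\<Sum>x\<in>S. h (f x))"
  by (induction S rule: infinite_finite_induct) (auto simp: assms)

text \<open>Used for evaluation at a point and for reduction modulo 2, the two views of one matrix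
  over \<open>nat poly\<close>.\<close>

lemma bird_hom:
  fixes h :: "'a::comm_semiring_1 \<Rightarrow> 'b::comm_semiring_1"
  assumes h0: "h 0 = 0" and ha: "\<And>x y. h (x + y) = h x + h y" and hm: "\<And>x y. h (x * y) = h x * h y"
  shows "h (bird N A m i j) = bird N (\<lambda>a b. h (A a b)) m i j"
proof (induction m arbitrary: i j)
  case (Suc m)
  show ?case unfolding bird.simps sum_hom[of h, OF h0 ha]
    by (intro sum.cong) (auto simp: h0 ha hm Suc.IH)
qed simp

lemma bird_le:
  fixes A :: "nat \<Rightarrow> nat \<Rightarrow> nat"
  assumes A: "\<And>a b. a < N \<Longrightarrow> b < N \<Longrightarrow> A a b \<le> c" and "i < N" "j < N"
  shows "bird N A m i j \<le> (2 * N * c) ^ m * c"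
  using assms(2,3)
proof (induction m arbitrary: i j)
  case (Suc m)
  let ?b = "(2 * N * c) ^ m * c"
  have "bird N A (Suc m) i j \<le> (\<Sum>l<N. 2 * ?b * c)"
    unfolding bird.simps
  proof (rule sum_mono)
    fix l assume "l \<in> {..<N}"
    then have "bird N A m i l * A l j \<le> ?b * c" "bird N A m l l * A i j \<le> ?b * c"
      using Suc A by (auto intro!: mult_le_mono)
    then show "(if i < l then bird N A m i l * A l j + bird N A m l l * A i j else 0) \<le> 2 * ?b * c" by simp
  qed
  also have "\<dots> = (2 * N * c) ^ Suc m * c" by (simp add: algebra_simps)
  finally show ?case .
qed (simp add: A)

lemma poly_digit:
  fixes p :: "nat poly"
  assumes "\<And>i. coeff p i < b"
  shows "poly p b div b ^ e mod b = coeff p e"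
  using assms
proof (induction p arbitrary: e)
  case (pCons a p)
  have b: "a < b" "\<And>i. coeff p i < b"
    using pCons.prems[of 0] pCons.prems[of "Suc _"] by auto
  show ?case
  proof (cases e)
    case 0
    then show ?thesis using b by simp
  next
    case (Suc e')
    have "poly (pCons a p) b div b ^ e = poly (pCons a p) b div b div b ^ e'"
      by (simp add: Suc div_mult2_eq)
    also have "poly (pCons a p) b div b = poly p b" using b(1) by simp
    finally show ?thesis using pCons.IH[of e'] b(2) Suc by simp
  qed
qed simp

lemma coeff_le_poly_1: "coeff p i \<le> poly (p :: nat poly) 1"
proof (cases "i \<le> degree p")
  case True
  then have "coeff p i \<le> (\<Sum>j\<le>degree p. coeff p j)" by (intro member_le_sum) auto
  then show ?thesis by (simp add: poly_altdef)
qed (simp add: coeff_eq_0)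

text \<open>\<open>poly p 1\<close> is the sum of the coefficients, so below \<open>2 ^ B\<close>
  every coefficient fits into its own block of \<open>B\<close> bits, and its parity is the lowest
  bit of that block.\<close>

lemma odd_poly_digit:
  fixes p :: "nat poly"
  assumes "poly p 1 < 2 ^ B" "1 \<le> B"
  shows "odd (poly p (2 ^ B) div 2 ^ (B * e)) \<longleftrightarrow> odd (coeff p e)"
proof -
  have "poly p (2 ^ B) div (2 ^ B) ^ e mod 2 ^ B = coeff p e"
    using assms(1) coeff_le_poly_1[of p] by (intro poly_digit) (meson order_le_less_trans)
  moreover have "(2::nat) dvd 2 ^ B" using assms(2) by simp
  ultimately show ?thesis by (metis dvd_mod_iff power_mult)
qed

definition bit_poly_of :: "nat poly \<Rightarrow> bit poly" where
  "bit_poly_of p = map_poly of_nat p"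

lemma coeff_bit_poly_of: "coeff (bit_poly_of p) i = of_nat (coeff p i)"
  by (simp add: bit_poly_of_def coeff_map_poly)

lemma bit_poly_of_hom:
  "bit_poly_of 0 = 0" "bit_poly_of (p + q) = bit_poly_of p + bit_poly_of q"
  "bit_poly_of (p * q) = bit_poly_of p * bit_poly_of q" "bit_poly_of (monom 1 e) = monom 1 e"
  by (auto intro!: poly_eqI simp: coeff_bit_poly_of coeff_mult simp del: of_nat_add)
    (auto simp: coeff_bit_poly_of)

lemma of_nat_bit: "(of_nat n :: bit) = of_bool (odd n)"
  by (induction n) auto

section \<open>Label sets as numbers and the zeta transform\<close>

lemma set_decode_bij: "bij_betw set_decode {..<2 ^ k} (Pow {..<k})"
proof (rule bij_betwI[where g = set_encode])
  show "set_decode \<in> {..<2 ^ k} \<rightarrow> Pow {..<k}"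
  proof (intro Pi_I PowI subsetI)
    fix X s assume X: "X \<in> {..<2 ^ k}" and s: "s \<in> set_decode X"
    show "s \<in> {..<k}"
    proof (rule ccontr)
      assume "s \<notin> {..<k}"
      then have "(2::nat) ^ k \<le> 2 ^ s" by (intro power_increasing) auto
      then have "X < 2 ^ s" using X less_le_trans by blast
      then have "X div 2 ^ s = 0" by simp
      then show False using s by (simp add: set_decode_def)
    qed
  qed
  show "set_encode \<in> Pow {..<k} \<rightarrow> {..<2 ^ k}"
  proof (intro Pi_I)
    fix A assume A: "A \<in> Pow {..<k}"
    then have "set_encode A \<le> (\<Sum>i<k. 2 ^ i)"
      unfolding set_encode_def by (intro sum_mono2) auto
    also have "\<dots> < 2 ^ k" by (induction k) auto
    finally show "set_encode A \<in> {..<2 ^ k}" by simp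
  qed
qed (auto simp: finite_subset)

lemma in_set_decode: "s \<in> set_decode X \<longleftrightarrow> odd (X div 2 ^ s)"
  by (simp add: set_decode_def)

lemma set_decode_minus_power:
  assumes "s \<in> set_decode X"
  shows "set_decode (X - 2 ^ s) = set_decode X - {s}"
proof -
  have "X = set_encode (insert s (set_decode X - {s}))"
    using assms by (simp add: insert_absorb)
  also have "\<dots> = 2 ^ s + set_encode (set_decode X - {s})" by (subst set_encode_insert) auto
  finally have "X - 2 ^ s = set_encode (set_decode X - {s})" by simp
  then show ?thesis by simp
qed

text \<open>Step \<open>s\<close> decides whether element \<open>s\<close> is dropped:
  \<open>k\<close> layers over \<open>2 ^ k\<close> sets replace the \<open>3 ^ k\<close> pairs of
  nested sets. If bit \<open>s\<close> of \<open>X\<close> is 0, the truncated index is harmless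
  because its summand is multiplied by 0.\<close>

fun zeta :: "(nat \<Rightarrow> nat) \<Rightarrow> nat \<Rightarrow> nat \<Rightarrow> nat" where
  "zeta f 0 X = f X"
| "zeta f (Suc s) X = zeta f s X + (X div 2 ^ s mod 2) * zeta f s (X - 2 ^ s)"

lemma zeta_eq:
  "zeta f s X = (\<Sum>T | set_decode T \<subseteq> set_decode X \<and> set_decode X - {..<s} \<subseteq> set_decode T. f T)"
proof (induction s arbitrary: X)
  case 0
  have "{T. set_decode T \<subseteq> set_decode X \<and> set_decode X - {..<0} \<subseteq> set_decode T} = {X}"
    by auto (metis set_decode_inverse set_eq_subset)
  then show ?case by simp
next
  case (Suc s)
  let ?D = "\<lambda>s X. {T. set_decode T \<subseteq> set_decode X \<and> set_decode X - {..<s} \<subseteq> set_decode T}"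
  have fin: "finite (?D s X)" for s X
    by (rule finite_subset[of _ "{..X}"]) (auto intro: subset_decode_imp_le)
  show ?case
  proof (cases "s \<in> set_decode X")
    case False
    then have "?D (Suc s) X = ?D s X" by (auto simp: lessThan_Suc)
    moreover have "X div 2 ^ s mod 2 = 0" using False by (simp add: in_set_decode)
    ultimately show ?thesis by (simp add: Suc.IH)
  next
    case True
    \<comment> \<open>The first part consists of the sets that keep \<open>s\<close>, the second of
      those that drop it.\<close>
    have "?D (Suc s) X = ?D s X \<union> ?D s (X - 2 ^ s)"
      using True by (auto simp: lessThan_Suc set_decode_minus_power)
    moreover have "?D s X \<inter> ?D s (X - 2 ^ s) = {}"
      using True by (auto simp: set_decode_minus_power)
    ultimately have "sum f (?D (Suc s) X) = sum f (?D s X) + sum f (?D s (X - 2 ^ s))"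
      using fin by (simp add: sum.union_disjoint)
    moreover have "X div 2 ^ s mod 2 = 1" using True by (simp add: in_set_decode odd_iff_mod_2_eq_one)
    ultimately show ?thesis by (simp add: Suc.IH)
  qed
qed

lemma zeta_subsets:
  assumes X: "X < 2 ^ k"
  shows "zeta (\<lambda>T. F (set_decode T)) k X = (\<Sum>T | T \<subseteq> set_decode X. F T)"
proof -
  have dX: "set_decode X \<subseteq> {..<k}" using bij_betw_apply[OF set_decode_bij, of X k] X by auto
  have "zeta (\<lambda>T. F (set_decode T)) k X = (\<Sum>T | set_decode T \<subseteq> set_decode X. F (set_decode T))"
    unfolding zeta_eq using dX by (intro sum.cong) auto
  also have "\<dots> = (\<Sum>T | T \<subseteq> set_decode X. F T)"
    by (rule sum.reindex_bij_witness[of _ set_encode set_decode]) (auto simp: finite_subset[OF _ finite_set_decode])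
  finally show ?thesis .
qed

lemma zeta_le:
  assumes "\<And>T. T \<le> X \<Longrightarrow> f T \<le> c"
  shows "zeta f s X \<le> 2 ^ s * c"
  using assms
proof (induction s arbitrary: X)
  case (Suc s)
  have "zeta f s X \<le> 2 ^ s * c" "zeta f s (X - 2 ^ s) \<le> 2 ^ s * c"
    using Suc by (auto intro!: Suc.IH)
  moreover have "(X div 2 ^ s mod 2) * zeta f s (X - 2 ^ s) \<le> 1 * zeta f s (X - 2 ^ s)"
    by (intro mult_le_mono1) simp
  moreover have "2 ^ Suc s * c = 2 ^ s * c + 2 ^ s * c" by simp
  ultimately show ?case unfolding zeta.simps by linarith
qed simp

definition cell :: "(nat \<Rightarrow> nat \<Rightarrow> bool \<Rightarrow> nat set \<Rightarrow> bool) \<Rightarrow> (nat \<Rightarrow> nat \<Rightarrow> bool \<Rightarrow> nat set \<Rightarrow> nat)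
    \<Rightarrow> nat \<Rightarrow> nat \<Rightarrow> nat \<Rightarrow> nat \<Rightarrow> nat" where
  "cell ok ex B a b T = (\<Sum>m\<in>UNIV. of_bool (ok a b m (set_decode T)) *
     2 ^ (B * ((if a = b then 2 else 1) * ex a b m (set_decode T))))"

lemma poly_entry:
  assumes X: "X < 2 ^ k"
  shows "poly (entry ok ex (set_decode X) a b) (2 ^ B) = zeta (cell ok ex B a b) k X"
proof -
  let ?t = "\<lambda>m T. 2 ^ (B * ((if a = b then 2 else 1) * ex a b m T)) :: nat"
  let ?F = "\<lambda>T. \<Sum>m\<in>UNIV. of_bool (ok a b m T) * ?t m T"
  have fX: "finite {T. T \<subseteq> set_decode X}" by simp
  have "zeta (cell ok ex B a b) k X = (\<Sum>T | T \<subseteq> set_decode X. ?F T)"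
    using zeta_subsets[OF X, of ?F] by (simp only: cell_def[abs_def])
  also have "\<dots> = (\<Sum>m\<in>UNIV. \<Sum>T | T \<subseteq> set_decode X. of_bool (ok a b m T) * ?t m T)"
    by (rule sum.swap)
  also have "\<dots> = (\<Sum>(m, T)\<in>UNIV \<times> {T. T \<subseteq> set_decode X}. of_bool (ok a b m T) * ?t m T)"
    by (rule sum.cartesian_product)
  also have "\<dots> = (\<Sum>(m, T)\<in>opts ok (set_decode X) a b. ?t m T)"
    by (rule sum.mono_neutral_cong_right) (auto simp: opts_def)
  also have "\<dots> = poly (entry ok ex (set_decode X) a b) (2 ^ B)"
    by (simp add: entry_def poly_sum poly_monom case_prod_beta' power_mult)
  finally show ?thesis ..
qed

lemma poly_entry_1_le:
  assumes "X < 2 ^ k"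
  shows "poly (entry ok ex (set_decode X) a b) (1::nat) \<le> 2 ^ (k + 1)"
proof -
  have dX: "set_decode X \<subseteq> {..<k}" using bij_betw_apply[OF set_decode_bij, of X k] assms by auto
  have "poly (entry ok ex (set_decode X) a b) (1::nat) = card (opts ok (set_decode X) a b)"
    by (simp add: entry_def poly_sum poly_monom case_prod_beta')
  also have "\<dots> \<le> card ((UNIV :: bool set) \<times> Pow {..<k})"
    using dX by (intro card_mono) (auto simp: opts_def)
  finally show ?thesis by (simp add: card_Pow)
qed

lemma two_mult_le_power: "2 * N \<le> 2 ^ N" if "1 \<le> N" for N :: nat
  using that
proof (induction N rule: dec_induct)
  case (step N)
  then show ?case using step by simp
qed simp

text \<open>The same polynomial \<open>p\<close> over \<open>nat\<close> is evaluated at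
  \<open>2 ^ B\<close>, which gives the number computed by the machine, and reduced modulo 2, which
  gives the sieved sum of permanents.\<close>

theorem odd_total:
  assumes ok: "\<And>a b m T. ok a b m T = ok b a m T" and ex: "\<And>a b m T. ex a b m T = ex b a m T"
    and N: "k < N" and B: "4 * N * N \<le> B"
  shows "odd ((\<Sum>X<2 ^ k. bird N (\<lambda>a b. zeta (cell ok ex B a b) k X) (N - 1) 0 0) div 2 ^ (B * (2 * e)))
    \<longleftrightarrow> odd (card {x \<in> covers ok N {..<k}. cycle_sum N ex x = e})"
proof -
  let ?E = "\<lambda>X. entry ok ex (set_decode X) :: nat \<Rightarrow> nat \<Rightarrow> nat poly"
  define p where "p = (\<Sum>X<2 ^ k. bird N (?E X) (N - 1) 0 0)"
  have N1: "1 \<le> N" using N by simp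
  have ev: "poly (bird N A m i j) x = bird N (\<lambda>a b. poly (A a b) x) m i j" for A :: "nat \<Rightarrow> nat \<Rightarrow> nat poly" and m i j x
    by (rule bird_hom[of "\<lambda>p. poly p x"]) auto
  have val: "poly p (2 ^ B) = (\<Sum>X<2 ^ k. bird N (\<lambda>a b. zeta (cell ok ex B a b) k X) (N - 1) 0 0)"
    unfolding p_def poly_sum ev by (intro sum.cong refl) (simp add: poly_entry)
  \<comment> \<open>The coefficient sum of an entry is at most \<open>2 ^ (k + 1)\<close>, hence
    that of a permanent at most \<open>2 ^ (2 * N * N)\<close> and the total at most
    \<open>2 ^ (k + 2 * N * N)\<close>; the hypothesis on \<open>B\<close> leaves room since
    \<open>k < N\<close>.\<close>
  have one: "poly p 1 < 2 ^ B"
  proof -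
    have "poly p 1 \<le> (\<Sum>X<(2::nat) ^ k. (2 ^ (2 * N)) ^ N)"
      unfolding p_def poly_sum ev
    proof (rule sum_mono)
      fix X :: nat assume X: "X \<in> {..<2 ^ k}"
      have "bird N (\<lambda>a b. poly (?E X a b) 1) (N - 1) 0 0 \<le> (2 * N * 2 ^ (k + 1)) ^ (N - 1) * 2 ^ (k + 1)"
        using X N1 poly_entry_1_le by (intro bird_le) auto
      also have "\<dots> \<le> (2 * N * 2 ^ (k + 1)) ^ (N - 1) * (2 * N * 2 ^ (k + 1))"
        using N1 by (intro mult_le_mono2) simp
      also have "\<dots> = (2 * N * 2 ^ (k + 1)) ^ N" using N1 by (metis Suc_diff_1 One_nat_def Suc_le_lessD power_Suc2)
      also have "\<dots> \<le> (2 ^ (2 * N)) ^ N"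
      proof (rule power_mono)
        have "2 * N * 2 ^ (k + 1) \<le> 2 ^ N * 2 ^ N"
          using N two_mult_le_power[OF N1] by (intro mult_le_mono power_increasing) auto
        then show "2 * N * 2 ^ (k + 1) \<le> 2 ^ (2 * N)" by (simp add: power_add[symmetric] mult_2)
      qed simp
      finally show "bird N (\<lambda>a b. poly (?E X a b) 1) (N - 1) 0 0 \<le> (2 ^ (2 * N)) ^ N" .
    qed
    also have "\<dots> = 2 ^ (k + 2 * N * N)" by (simp add: power_add power_mult)
    also have "\<dots> < 2 ^ B"
    proof (rule power_strict_increasing)
      have "N * 1 \<le> N * N" using N1 by (intro mult_le_mono2)
      then show "k + 2 * N * N < B" using N B by linarith
    qed simp
    finally show ?thesis .
  qed
  have "1 \<le> B" using B N1 by (metis mult_eq_0_iff le_zero_eq not_less_eq_eq One_nat_def zero_neq_numeral)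
  then have "odd (poly p (2 ^ B) div 2 ^ (B * (2 * e))) \<longleftrightarrow> odd (coeff p (2 * e))"
    by (rule odd_poly_digit[OF one])
  also have "\<dots> \<longleftrightarrow> odd (card {x \<in> covers ok N {..<k}. cycle_sum N ex x = e})"
  proof -
    have be: "bit_poly_of (entry ok ex X a b) = entry ok ex X a b" for X a b
      unfolding entry_def by (subst sum_hom[of bit_poly_of]) (auto simp: bit_poly_of_hom bit_poly_of_hom(4)[unfolded One_nat_def] case_prod_beta')
    have "bit_poly_of p = (\<Sum>X<2 ^ k. bird N (\<lambda>a b. entry ok ex (set_decode X) a b :: bit poly) (N - 1) 0 0)"
      unfolding p_def by (simp add: sum_hom[of bit_poly_of] bird_hom[of bit_poly_of] bit_poly_of_hom be)
    also have "\<dots> = (\<Sum>X<2 ^ k. per (entry ok ex (set_decode X)) {..<N})"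
      using bird_eq_per[OF N1] by simp
    also have "\<dots> = (\<Sum>X | X \<subseteq> {..<k}. per (entry ok ex X) {..<N})"
      using sum.reindex_bij_betw[OF set_decode_bij[of k], of "\<lambda>X. per (entry ok ex X) {..<N} :: bit poly"]
      by (simp add: Pow_def)
    finally have "coeff (bit_poly_of p) (2 * e) = of_nat (card {x \<in> covers ok N {..<k}. cycle_sum N ex x = e})"
      using coeff_sum_per_entry[of ok ex "{..<k}" N e] ok ex by simp
    then show ?thesis by (auto simp: coeff_bit_poly_of of_nat_bit of_bool_def split: if_splits)
  qed
  finally show ?thesis by (simp add: val)
qed

section \<open>Registers and tables\<close>

text \<open>Registers below 19 hold the global variables; register 19 is never written and stays 0.\<close>

definition gl :: "nat \<Rightarrow> nat" where
  "gl v = min v 19"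

lemma gl_less: "gl v < 20"
  by (simp add: gl_def)

text \<open>Only the global registers are described, so whatever \<open>xcomp\<close> leaves behind
  in registers from 20 on never enters a statement.\<close>

definition xruns :: "prog \<Rightarrow> (nat \<Rightarrow> nat) \<Rightarrow> (nat \<Rightarrow> nat) \<Rightarrow> bool stream \<Rightarrow>
    (nat \<Rightarrow> nat) \<Rightarrow> (nat \<Rightarrow> nat) \<Rightarrow> bool stream \<Rightarrow> nat \<Rightarrow> bool" where
  "xruns c \<sigma> M \<omega> \<sigma>' M' \<omega>' T \<longleftrightarrow> (\<forall>R. (\<forall>v. R (gl v) = \<sigma> v) \<longrightarrow>
     (\<exists>R'. (\<forall>v. R' (gl v) = \<sigma>' v) \<and> runs c (R, M) \<omega> (R', M') \<omega>' T))"

lemma xruns_Seq: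
  assumes "xruns c1 \<sigma> M \<omega> \<sigma>1 M1 \<omega>1 T1" "xruns c2 \<sigma>1 M1 \<omega>1 \<sigma>2 M2 \<omega>2 T2"
  shows "xruns (Seq c1 c2) \<sigma> M \<omega> \<sigma>2 M2 \<omega>2 (T1 + T2)"
  unfolding xruns_def
proof (intro allI impI)
  fix R assume "\<forall>v. R (gl v) = \<sigma> v"
  then obtain R1 where "\<forall>v. R1 (gl v) = \<sigma>1 v" "runs c1 (R, M) \<omega> (R1, M1) \<omega>1 T1"
    using assms(1) unfolding xruns_def by blast
  moreover then obtain R2 where "\<forall>v. R2 (gl v) = \<sigma>2 v" "runs c2 (R1, M1) \<omega>1 (R2, M2) \<omega>2 T2"
    using assms(2) unfolding xruns_def by blast
  ultimately show "\<exists>R'. (\<forall>v. R' (gl v) = \<sigma>2 v) \<and> runs (Seq c1 c2) (R, M) \<omega> (R', M2) \<omega>2 (T1 + T2)"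
    using runs_Seq by blast
qed

definition small_vals :: "nat \<Rightarrow> (nat \<Rightarrow> nat) \<Rightarrow> bool" where
  "small_vals L f \<longleftrightarrow> (\<forall>i. bit_len (f i) \<le> L)"

lemma small_vals_upd: "small_vals L f \<Longrightarrow> bit_len x \<le> L \<Longrightarrow> small_vals L (f(v := x))"
  by (simp add: small_vals_def)

lemma compiles_in_xruns:
  assumes c: "compiles_in x c" and L: "2 \<le> L" "small_vals L \<sigma>" "small_vals L M" "loops_le x \<sigma> M L"
    and R: "\<And>v. R (gl v) = \<sigma> v"
  obtains R' where "runs (xcomp gl 20 x) (R, M) \<omega> (R', M) \<omega> (L ^ c)" "R' 20 = xeval x \<sigma> M"
    "\<And>r. r < 20 \<Longrightarrow> R' r = R r" "bit_len (xeval x \<sigma> M) \<le> L ^ c"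
proof -
  have "\<sigma> v = R (gl v)" "bit_len (\<sigma> v) \<le> L" "bit_len (M i) \<le> L" for v i
    using R L by (auto simp: small_vals_def)
  note * = compiles_inD(1)[OF c gl_less L(1) this L(4)] compiles_inD(2)[OF c gl_less L(1) this L(4), of \<omega>]
  then show thesis using that by blast
qed

definition xset :: "nat \<Rightarrow> xexp \<Rightarrow> prog" where
  "xset r x = Seq (xcomp gl 20 x) (Assign r (Reg 20))"

lemma xruns_xset:
  assumes c: "compiles_in x c" and r: "r < 19"
    and L: "2 \<le> L" "small_vals L \<sigma>" "small_vals L M" "loops_le x \<sigma> M L"
  shows "xruns (xset r x) \<sigma> M \<omega> (\<sigma>(r := xeval x \<sigma> M)) M \<omega> (2 * L ^ c)"
  unfolding xruns_def
proof (intro allI impI)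
  fix R assume R: "\<forall>v. R (gl v) = \<sigma> v"
  then have "\<And>v. R (gl v) = \<sigma> v" by simp
  from compiles_in_xruns[OF c L this, of \<omega>] obtain R1 where
    R1: "runs (xcomp gl 20 x) (R, M) \<omega> (R1, M) \<omega> (L ^ c)" "R1 20 = xeval x \<sigma> M"
    "\<And>r. r < 20 \<Longrightarrow> R1 r = R r" "bit_len (xeval x \<sigma> M) \<le> L ^ c" by blast
  have "runs (Assign r (Reg 20)) (R1, M) \<omega> (R1(r := xeval x \<sigma> M), M) \<omega> (L ^ c)"
    using runs_Assign[of "Reg 20" R1 M "L ^ c" r \<omega>] R1 by simp
  from runs_Seq[OF R1(1) this]
  have "runs (xset r x) (R, M) \<omega> (R1(r := xeval x \<sigma> M), M) \<omega> (2 * L ^ c)"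
    by (simp add: xset_def mult_2)
  moreover have "\<forall>v. (R1(r := xeval x \<sigma> M)) (gl v) = (\<sigma>(r := xeval x \<sigma> M)) v"
    using R1(3)[OF gl_less] R r by (auto simp: gl_def min_def)
  ultimately show "\<exists>R'. (\<forall>v. R' (gl v) = (\<sigma>(r := xeval x \<sigma> M)) v) \<and>
     runs (xset r x) (R, M) \<omega> (R', M) \<omega> (2 * L ^ c)" by blast
qed

definition fillmem :: "(nat \<Rightarrow> nat) \<Rightarrow> nat \<Rightarrow> nat \<Rightarrow> (nat \<Rightarrow> nat) \<Rightarrow> nat \<Rightarrow> nat" where
  "fillmem M b s t = (\<lambda>a. if b \<le> a \<and> a < b + s then t (a - b) else M a)"

lemma fillmem_Suc: "(fillmem M b i t)(b + i := t i) = fillmem M b (Suc i) t"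
  by (auto simp: fillmem_def fun_eq_iff)

lemma fillmem_0: "fillmem M b 0 t = M"
  by (auto simp: fillmem_def fun_eq_iff)

lemma small_vals_fillmem:
  "small_vals L M \<Longrightarrow> (\<And>i. i < s \<Longrightarrow> bit_len (t i) \<le> L) \<Longrightarrow> small_vals L (fillmem M b s t)"
  by (auto simp: small_vals_def fillmem_def)

text \<open>Fills the \<open>size\<close> (register 17) cells from \<open>base\<close> (register 16) on, with counter register 13.\<close>

definition xfill :: "xexp \<Rightarrow> prog" where
  "xfill x = Seq (Assign 13 (Const 0)) (Loop (Arith Minus (Reg 17) (Reg 13))
     (Seq (xcomp gl 20 x) (Seq (Store (Arith Plus (Reg 16) (Reg 13)) (Reg 20))
       (Assign 13 (Arith Plus (Reg 13) (Const 1))))))"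

text \<open>The expression for cell \<open>i\<close> may read the cells written before it, which
  gives dynamic programming. The number of rounds \<open>s\<close> may exceed \<open>L\<close>; only
  addresses have to be short.\<close>

lemma xruns_xfill:
  assumes c: "compiles_in x c" and L: "2 \<le> L" "small_vals L \<sigma>" "small_vals L M"
    and b: "\<sigma> 16 = b" "\<sigma> 17 = s" "bit_len (b + s) \<le> L"
    and x: "\<And>i. i < s \<Longrightarrow> xeval x (\<sigma>(13 := i)) (fillmem M b i t) = t i"
      "\<And>i. i < s \<Longrightarrow> loops_le x (\<sigma>(13 := i)) (fillmem M b i t) L"
      "\<And>i. i < s \<Longrightarrow> bit_len (t i) \<le> L"
  shows "xruns (xfill x) \<sigma> M \<omega> (\<sigma>(13 := s)) (fillmem M b s t) \<omega> (s * (10 * L + L ^ c) + 4 * L)"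
  unfolding xruns_def
proof (intro allI impI)
  fix R assume R: "\<forall>v. R (gl v) = \<sigma> v"
  have iL: "bit_len i \<le> L" if "i \<le> b + s" for i using bit_len_mono[OF that] b(3) by linarith
  let ?c = "Seq (xcomp gl 20 x) (Seq (Store (Arith Plus (Reg 16) (Reg 13)) (Reg 20))
       (Assign 13 (Arith Plus (Reg 13) (Const 1))))"
  let ?e = "Arith Minus (Reg 17) (Reg 13)"
  define Inv where "Inv i S \<longleftrightarrow> (\<exists>R'. S = (R', fillmem M b i t) \<and> (\<forall>v. R' (gl v) = (\<sigma>(13 := i)) v))"
    for i and S :: mstate
  have gs: "gl 13 = 13" "gl 16 = 16" "gl 17 = 17" by (auto simp: gl_def)
  have "\<exists>S'. Inv s S' \<and> runs (Loop ?e ?c) (R(13 := 0), M) \<omega> S' \<omega> (s * (3 * L + (L ^ c + (4 * L + 3 * L))) + 3 * L)"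
  proof (rule runs_Loop[where w = "\<lambda>_. \<omega>" and Inv = Inv])
    show "Inv 0 (R(13 := 0), M)" using R by (auto simp: Inv_def fillmem_0 gl_def min_def)
    show "eval_expr ?e S = 0 \<and> cost_expr ?e S \<le> 3 * L" if "Inv s S" for S
    proof -
      obtain R' where "S = (R', fillmem M b s t)" "\<And>v. R' (gl v) = (\<sigma>(13 := s)) v" using \<open>Inv s S\<close> by (auto simp: Inv_def)
      moreover from this(2)[of 13] this(2)[of 17] have "R' 13 = s" "R' 17 = s" using b by (auto simp: gs)
      ultimately show ?thesis using iL[of s] iL[of 0] by simp
    qed
    fix i S assume i: "i < s" and "Inv i S"
    then obtain R' where R': "S = (R', fillmem M b i t)" "\<And>v. R' (gl v) = (\<sigma>(13 := i)) v" by (auto simp: Inv_def)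
    have Rg: "R' 13 = i" "R' 17 = s" "R' 16 = b" using R'(2)[of 13] R'(2)[of 17] R'(2)[of 16] b by (auto simp: gs)
    have sm: "small_vals L (\<sigma>(13 := i))" "small_vals L (fillmem M b i t)"
      using L iL[of i] i x(3) by (auto intro!: small_vals_upd small_vals_fillmem)
    from compiles_in_xruns[OF c L(1) sm x(2)[OF i] R'(2), of \<omega>] obtain R1 where
      R1: "runs (xcomp gl 20 x) (R', fillmem M b i t) \<omega> (R1, fillmem M b i t) \<omega> (L ^ c)" "R1 20 = t i"
        "\<And>r. r < 20 \<Longrightarrow> R1 r = R' r" using x(1)[OF i] by metis
    have R1g: "R1 13 = i" "R1 16 = b" using R1(3) Rg by auto
    have "runs (Store (Arith Plus (Reg 16) (Reg 13)) (Reg 20)) (R1, fillmem M b i t) \<omega>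
      (R1, (fillmem M b i t)(b + i := t i)) \<omega> (4 * L)"
      using runs_Store[of "Arith Plus (Reg 16) (Reg 13)" R1 "fillmem M b i t" "Reg 20" "4 * L" \<omega>]
        R1g R1(2) iL[of b] iL[of i] iL[of "b + i"] x(3)[OF i] i by simp
    then have 2: "runs (Store (Arith Plus (Reg 16) (Reg 13)) (Reg 20)) (R1, fillmem M b i t) \<omega>
      (R1, fillmem M b (Suc i) t) \<omega> (4 * L)" by (simp add: fillmem_Suc)
    have 3: "runs (Assign 13 (Arith Plus (Reg 13) (Const 1))) (R1, fillmem M b (Suc i) t) \<omega>
      (R1(13 := Suc i), fillmem M b (Suc i) t) \<omega> (3 * L)"
      using runs_Assign[of "Arith Plus (Reg 13) (Const 1)" R1 "fillmem M b (Suc i) t" "3 * L" 13 \<omega>]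
        R1g iL[of i] iL[of "Suc i"] i L(1) by simp
    have "runs ?c S \<omega> (R1(13 := Suc i), fillmem M b (Suc i) t) \<omega> (L ^ c + (4 * L + 3 * L))"
      unfolding R'(1) by (intro runs_Seq[OF R1(1)] runs_Seq[OF 2] 3)
    moreover have "(R1(13 := Suc i)) (gl v) = (\<sigma>(13 := Suc i)) v" for v
      using R1(3)[OF gl_less, of v] R'(2)[of v] by (auto simp: gl_def min_def)
    then have "Inv (Suc i) (R1(13 := Suc i), fillmem M b (Suc i) t)" by (auto simp: Inv_def)
    moreover have "bit_len (s - i) \<le> L" by (rule iL) simp
    then have "eval_expr ?e S \<noteq> 0" "cost_expr ?e S \<le> 3 * L"
      using R'(1) Rg i iL[of i] iL[of s] by auto
    ultimately show "eval_expr ?e S \<noteq> 0 \<and> cost_expr ?e S \<le> 3 * L \<and>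
      (\<exists>S'. Inv (Suc i) S' \<and> runs ?c S \<omega> S' \<omega> (L ^ c + (4 * L + 3 * L)))" by blast
  qed
  then obtain R2 where R2: "\<forall>v. R2 (gl v) = (\<sigma>(13 := s)) v"
    "runs (Loop ?e ?c) (R(13 := 0), M) \<omega> (R2, fillmem M b s t) \<omega> (s * (3 * L + (L ^ c + (4 * L + 3 * L))) + 3 * L)"
    by (auto simp: Inv_def)
  have "runs (Assign 13 (Const 0)) (R, M) \<omega> (R(13 := 0), M) \<omega> L"
    using runs_Assign[of "Const 0" R M L 13 \<omega>] L by simp
  from runs_Seq[OF this R2(2)] have "runs (xfill x) (R, M) \<omega> (R2, fillmem M b s t) \<omega>
     (L + (s * (3 * L + (L ^ c + (4 * L + 3 * L))) + 3 * L))" by (simp only: xfill_def)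
  moreover have "L + (s * (3 * L + (L ^ c + (4 * L + 3 * L))) + 3 * L) = s * (10 * L + L ^ c) + 4 * L"
    by (simp add: algebra_simps)
  ultimately show "\<exists>R'. (\<forall>v. R' (gl v) = (\<sigma>(13 := s)) v) \<and>
     runs (xfill x) (R, M) \<omega> (R', fillmem M b s t) \<omega> (s * (10 * L + L ^ c) + 4 * L)"
    using R2(1) by metis
qed

text \<open>Reads as many coins as register 14 says into register 10, which must be 0 before.\<close>

definition xflip :: prog where
  "xflip = Seq (Loop (Reg 14) (Seq (Flip 15) (Seq
       (Assign 10 (Arith Plus (Arith Plus (Reg 10) (Reg 10)) (Reg 15)))
       (Assign 14 (Arith Minus (Reg 14) (Const 1)))))) (Assign 15 (Const 0))"

lemma xruns_xflip:
  assumes L: "2 \<le> L" "m < L" and \<sigma>: "\<sigma> 14 = m" "\<sigma> 10 = 0" "\<sigma> 15 = 0"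
  shows "xruns xflip \<sigma> M \<omega> (\<sigma>(10 := coin_value m \<omega>, 14 := 0)) M (sdrop m \<omega>) (m * (10 * L) + 2 * L)"
  unfolding xruns_def
proof (intro allI impI)
  fix R assume R: "\<forall>v. R (gl v) = \<sigma> v"
  let ?c = "Seq (Flip 15) (Seq
       (Assign 10 (Arith Plus (Arith Plus (Reg 10) (Reg 10)) (Reg 15)))
       (Assign 14 (Arith Minus (Reg 14) (Const 1))))"
  \<comment> \<open>Horner's rule: register 10 holds the number read so far, and shifting it past
    the \<open>m - i\<close> coins still to come gives the final value.\<close>
  define Inv where "Inv i S \<longleftrightarrow> (\<exists>R'. S = (R', M) \<and> R' 14 = m - i \<and> R' 10 < 2 ^ i \<and>
     R' 10 * 2 ^ (m - i) + coin_value (m - i) (sdrop i \<omega>) = coin_value m \<omega> \<and>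
     (\<forall>v. v \<noteq> 10 \<longrightarrow> v \<noteq> 14 \<longrightarrow> v \<noteq> 15 \<longrightarrow> R' v = R v))"
    for i and S :: mstate
  have small: "bit_len j \<le> L" if "j \<le> m" for j
    using bit_len_le_self[of j] L(2) that by linarith
  have bits: "bit_len j \<le> L" if "j < 2 ^ m" for j
  proof -
    have "(2::nat) ^ m \<le> 2 ^ L" using L(2) by (intro power_increasing) auto
    then have "j < 2 ^ L" using that by linarith
    then show ?thesis using L(1) by (subst bit_len_le_iff) auto
  qed
  have "\<exists>S'. Inv m S' \<and> runs (Loop (Reg 14) ?c) (R, M) (sdrop 0 \<omega>) S' (sdrop m \<omega>)
     (m * (L + (1 + (5 * L + 3 * L))) + L)"
  proof (rule runs_Loop[where w = "\<lambda>i. sdrop i \<omega>" and Inv = Inv])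
    have "R 14 = m" "R 10 = 0" using R[rule_format, of 14] R[rule_format, of 10] \<sigma> by (auto simp: gl_def)
    then show "Inv 0 (R, M)" by (simp add: Inv_def)
    show "eval_expr (Reg 14) S = 0 \<and> cost_expr (Reg 14) S \<le> L" if "Inv m S" for S
      using that L(1) by (auto simp: Inv_def)
    fix i S assume i: "i < m" and "Inv i S"
    then obtain R' where R': "S = (R', M)" "R' 14 = m - i" "R' 10 < 2 ^ i"
      "R' 10 * 2 ^ (m - i) + coin_value (m - i) (sdrop i \<omega>) = coin_value m \<omega>"
      "\<And>v. v \<noteq> 10 \<Longrightarrow> v \<noteq> 14 \<Longrightarrow> v \<noteq> 15 \<Longrightarrow> R' v = R v" by (auto simp: Inv_def)
    define y where "y = (of_bool (shd (sdrop i \<omega>)) :: nat)"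
    have y1: "y \<le> 1" by (simp add: y_def)
    have mi: "m - i = Suc (m - Suc i)" using i by simp
    have sd: "sdrop (Suc i) \<omega> = stl (sdrop i \<omega>)" by (simp only: sdrop_stl sdrop.simps)
    have pi: "2 * 2 ^ i \<le> (2::nat) ^ m" using i power_increasing[of "Suc i" m "2::nat"] by simp
    have new: "R' 10 + R' 10 + y < 2 ^ Suc i" using R'(3) y1 by simp
    define R1 where "R1 = R'(15 := y)"
    define R2 where "R2 = R1(10 := R' 10 + R' 10 + y)"
    define R3 where "R3 = R2(14 := m - Suc i)"
    have 1: "runs (Flip 15) (R', M) (sdrop i \<omega>) (R1, M) (sdrop (Suc i) \<omega>) 1"
      using runs_Flip[of 15 R' M "sdrop i \<omega>"] by (simp only: R1_def y_def sd)
    have "bit_len y \<le> L" using y1 bit_len_le_self[of y] L(1) by linarith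
    moreover have "bit_len (R' 10) \<le> L" "bit_len (R' 10 + R' 10) \<le> L" "bit_len (R' 10 + R' 10 + y) \<le> L"
      using new pi R'(3) by (auto intro!: bits)
    ultimately have 2: "runs (Assign 10 (Arith Plus (Arith Plus (Reg 10) (Reg 10)) (Reg 15))) (R1, M) (sdrop (Suc i) \<omega>)
       (R2, M) (sdrop (Suc i) \<omega>) (5 * L)"
      using runs_Assign[of "Arith Plus (Arith Plus (Reg 10) (Reg 10)) (Reg 15)" R1 M "5 * L" 10 "sdrop (Suc i) \<omega>"]
      by (simp add: R1_def R2_def)
    have 3: "runs (Assign 14 (Arith Minus (Reg 14) (Const 1))) (R2, M) (sdrop (Suc i) \<omega>) (R3, M) (sdrop (Suc i) \<omega>) (3 * L)"
      using runs_Assign[of "Arith Minus (Reg 14) (Const 1)" R2 M "3 * L" 14 "sdrop (Suc i) \<omega>"]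
        small[of "m - i"] small[of "m - Suc i"] L(1) R'(2) by (simp add: R1_def R2_def R3_def)
    have "runs ?c S (sdrop i \<omega>) (R3, M) (sdrop (Suc i) \<omega>) (1 + (5 * L + 3 * L))"
      unfolding R'(1) by (intro runs_Seq[OF 1] runs_Seq[OF 2] 3)
    moreover have "Inv (Suc i) (R3, M)"
    proof -
      have "R3 10 * 2 ^ (m - Suc i) + coin_value (m - Suc i) (sdrop (Suc i) \<omega>) = coin_value m \<omega>"
        using R'(4) unfolding mi coin_value.simps sd y_def[symmetric]
        by (simp add: R3_def R2_def algebra_simps)
      then show ?thesis using new R'(5) by (auto simp: Inv_def R3_def R2_def R1_def)
    qed
    moreover have "eval_expr (Reg 14) S \<noteq> 0" "cost_expr (Reg 14) S \<le> L"
      using R' i small[of "m - i"] by auto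
    ultimately show "eval_expr (Reg 14) S \<noteq> 0 \<and> cost_expr (Reg 14) S \<le> L \<and>
      (\<exists>S'. Inv (Suc i) S' \<and> runs ?c S (sdrop i \<omega>) S' (sdrop (Suc i) \<omega>) (1 + (5 * L + 3 * L)))" by blast
  qed
  then obtain R4 where R4: "Inv m (R4, M)"
    "runs (Loop (Reg 14) ?c) (R, M) \<omega> (R4, M) (sdrop m \<omega>) (m * (L + (1 + (5 * L + 3 * L))) + L)"
    by (auto simp: Inv_def)
  have "runs (Assign 15 (Const 0)) (R4, M) (sdrop m \<omega>) (R4(15 := 0), M) (sdrop m \<omega>) L"
    using runs_Assign[of "Const 0" R4 M L 15 "sdrop m \<omega>"] L by simp
  from runs_Seq[OF R4(2) this]
  have "runs xflip (R, M) \<omega> (R4(15 := 0), M) (sdrop m \<omega>) (m * (L + (1 + (5 * L + 3 * L))) + L + L)"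
    by (simp only: xflip_def)
  moreover have "m * (L + (1 + (5 * L + 3 * L))) + L + L \<le> m * (10 * L) + 2 * L"
  proof -
    have "m * (L + (1 + (5 * L + 3 * L))) \<le> m * (10 * L)" using L(1) by (intro mult_le_mono2) simp
    then show ?thesis by simp
  qed
  ultimately have "runs xflip (R, M) \<omega> (R4(15 := 0), M) (sdrop m \<omega>) (m * (10 * L) + 2 * L)"
    by (rule runs_mono)
  moreover have "(R4(15 := 0)) (gl v) = (\<sigma>(10 := coin_value m \<omega>, 14 := 0)) v" for v
  proof -
    have "R4 10 = coin_value m \<omega>" "R4 14 = 0" "\<And>v. v \<noteq> 10 \<Longrightarrow> v \<noteq> 14 \<Longrightarrow> v \<noteq> 15 \<Longrightarrow> R4 v = R v"
      using R4(1) by (auto simp: Inv_def)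
    then show ?thesis using R[rule_format, of v] \<sigma>(3) by (auto simp: gl_def min_def)
  qed
  ultimately show "\<exists>R'. (\<forall>v. R' (gl v) = (\<sigma>(10 := coin_value m \<omega>, 14 := 0)) v) \<and>
     runs xflip (R, M) \<omega> (R', M) (sdrop m \<omega>) (m * (10 * L) + 2 * L)" by blast
qed

section \<open>Tests and powers as expressions\<close>

abbreviation xadd (infixl "|+|" 65) where "x |+| y \<equiv> XA Plus x y"
abbreviation xsub (infixl "|-|" 65) where "x |-| y \<equiv> XA Minus x y"
abbreviation xmul (infixl "|*|" 70) where "x |*| y \<equiv> XA Times x y"
abbreviation xdiv (infixl "|div|" 70) where "x |div| y \<equiv> XA Quot x y"
abbreviation xmod (infixl "|mod|" 70) where "x |mod| y \<equiv> XA Rem x y"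

text \<open>Truncated subtraction gives 0 exactly if \<open>x \<le> y\<close>, so subtracting it
  from 1 yields the truth value.\<close>

definition xle :: "xexp \<Rightarrow> xexp \<Rightarrow> xexp" where
  "xle x y = XC 1 |-| (x |-| y)"

definition xeq :: "xexp \<Rightarrow> xexp \<Rightarrow> xexp" where
  "xeq x y = XC 1 |-| ((x |-| y) |+| (y |-| x))"

text \<open>Bound variables are numbered from 30 on, above all global registers, and distinctly
  wherever loops are nested, so nothing is captured.\<close>

definition xpow2 :: "xexp \<Rightarrow> xexp" where
  "xpow2 x = XP 41 x (XC 2)"

definition xbit :: "xexp \<Rightarrow> xexp \<Rightarrow> xexp" where
  "xbit x s = (x |div| xpow2 s) |mod| XC 2"

lemma xeval_xle [simp]: "xeval (xle x y) \<sigma> M = of_bool (xeval x \<sigma> M \<le> xeval y \<sigma> M)"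
  by (auto simp: xle_def)

lemma xeval_xeq [simp]: "xeval (xeq x y) \<sigma> M = of_bool (xeval x \<sigma> M = xeval y \<sigma> M)"
  by (auto simp: xeq_def)

lemma xeval_xpow2 [simp]: "xeval (xpow2 x) \<sigma> M = 2 ^ xeval x \<sigma> M"
  by (simp add: xpow2_def)

lemma xeval_xbit [simp]: "xeval (xbit x s) \<sigma> M = of_bool (xeval s \<sigma> M \<in> set_decode (xeval x \<sigma> M))"
  by (simp add: xbit_def in_set_decode mod_2_eq_odd)

lemma loops_le_ops [simp]:
  "loops_le (xle x y) \<sigma> M L \<longleftrightarrow> loops_le x \<sigma> M L \<and> loops_le y \<sigma> M L"
  "loops_le (xeq x y) \<sigma> M L \<longleftrightarrow> loops_le x \<sigma> M L \<and> loops_le y \<sigma> M L"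
  "loops_le (xpow2 x) \<sigma> M L \<longleftrightarrow> loops_le x \<sigma> M L \<and> xeval x \<sigma> M \<le> L"
  "loops_le (xbit x s) \<sigma> M L \<longleftrightarrow> loops_le x \<sigma> M L \<and> loops_le s \<sigma> M L \<and> xeval s \<sigma> M \<le> L"
  by (auto simp: xle_def xeq_def xpow2_def xbit_def)

section \<open>Parameters and input\<close>

definition items_profit :: "vmk \<Rightarrow> nat" where
  "items_profit I = (\<Sum>v<length (items I). item_profit I v)"

text \<open>This is \<open>bit_len (6 * verts I * verts I)\<close>, see \<open>wbits_eq\<close>,
  written as a bounded sum because expressions have no logarithm.\<close>

definition wbits :: "vmk \<Rightarrow> nat" where
  "wbits I = (\<Sum>i<6 * verts I * verts I. of_bool (2 ^ i \<le> 6 * verts I * verts I))"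

text \<open>Larger than three times the \<open>2 * verts I * verts I\<close> ground elements, for
  error probability 1/3; a power of two, so that blocks of coins give uniform weights.\<close>

definition wmax :: "vmk \<Rightarrow> nat" where
  "wmax I = 2 ^ wbits I"

definition radix :: "vmk \<Rightarrow> nat" where
  "radix I = 2 * verts I * verts I * wmax I + verts I * items_profit I"

definition base :: "vmk \<Rightarrow> nat" where
  "base I = 4 + length (items I) * (2 + 2 * vdim I)"

definition regs :: "vmk \<Rightarrow> nat \<Rightarrow> (nat \<Rightarrow> nat) \<Rightarrow> bool" where
  "regs I R \<sigma> \<longleftrightarrow> \<sigma> 1 = length (items I) \<and> \<sigma> 2 = vdim I \<and> \<sigma> 3 = 2 + 2 * vdim I \<and>
     \<sigma> 4 = num_small I \<and> \<sigma> 5 = 2 ^ num_small I \<and> \<sigma> 6 = verts I \<and> \<sigma> 7 = wmax I \<and>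
     \<sigma> 8 = radix I \<and> \<sigma> 9 = 4 * verts I * verts I \<and> \<sigma> 10 = R \<and> \<sigma> 11 = base I \<and>
     \<sigma> 12 = verts I * verts I * 2 ^ num_small I"

lemma regs_upd [simp]: "v \<ge> 13 \<Longrightarrow> regs I R (\<sigma>(v := x)) \<longleftrightarrow> regs I R \<sigma>"
  by (simp add: regs_def)

lemma regsD:
  assumes "regs I R \<sigma>"
  shows "\<sigma> (Suc 0) = length (items I)" "\<sigma> 2 = vdim I" "\<sigma> 3 = 2 + 2 * vdim I"
     "\<sigma> 4 = num_small I" "\<sigma> 5 = 2 ^ num_small I" "\<sigma> 6 = verts I" "\<sigma> 7 = wmax I"
     "\<sigma> 8 = radix I" "\<sigma> 9 = 4 * verts I * verts I" "\<sigma> 10 = R" "\<sigma> 11 = base I"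
     "\<sigma> 12 = verts I * verts I * 2 ^ num_small I"
  using assms by (auto simp: regs_def)

definition holds_input :: "vmk \<Rightarrow> (nat \<Rightarrow> nat) \<Rightarrow> bool" where
  "holds_input I M \<longleftrightarrow> (\<forall>a<base I. M a = encode_vmk I ! a)"

section \<open>Reading the encoded instance\<close>

lemma length_concat_uniform:
  "(\<And>x. x \<in> set xs \<Longrightarrow> length x = c) \<Longrightarrow> length (concat xs) = length xs * c"
  by (induction xs) auto

lemma nth_concat_uniform:
  "(\<And>x. x \<in> set xs \<Longrightarrow> length x = c) \<Longrightarrow> i < length xs \<Longrightarrow> j < c \<Longrightarrow> concat xs ! (i * c + j) = xs ! i ! j"
proof (induction xs arbitrary: i)
  case (Cons x xs)
  show ?case
  proof (cases i)
    case 0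
    then show ?thesis using Cons.prems by (simp add: nth_append)
  next
    case (Suc i')
    have "concat (x # xs) ! (i * c + j) = concat xs ! (i' * c + j)"
      using Cons.prems(1)[of x] Suc by (simp add: nth_append add.assoc)
    then show ?thesis using Cons.IH[of i'] Cons.prems Suc by simp
  qed
qed simp

lemma length_encode_rat: "length (encode_rat q) = 2"
  by (simp add: encode_rat_def split: prod.splits)

lemma length_encode_item: "length (encode_item v) = 2 + 2 * length (coords v)"
proof -
  have "length (concat (map encode_rat (coords v))) = length (map encode_rat (coords v)) * 2"
    by (intro length_concat_uniform) (auto simp: length_encode_rat)
  then show ?thesis by (simp add: encode_item_def)
qed

definition numer :: "vmk \<Rightarrow> nat \<Rightarrow> nat \<Rightarrow> nat" where
  "numer I v j = encode_rat (item_coord I v j) ! 0"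

definition denom :: "vmk \<Rightarrow> nat \<Rightarrow> nat \<Rightarrow> nat" where
  "denom I v j = encode_rat (item_coord I v j) ! 1"

context
  fixes I :: vmk
  assumes inst: "vmk_instance I"
begin

lemma length_coords: "v < length (items I) \<Longrightarrow> length (coords (items I ! v)) = vdim I"
  using inst by (simp add: vmk_instance_def all_items_def)

lemma coord_nonneg: "v < length (items I) \<Longrightarrow> j < vdim I \<Longrightarrow> item_coord I v j \<ge> 0"
  using inst by (simp add: vmk_instance_def all_items_def)

lemma uniform: "x \<in> set (map encode_item (items I)) \<Longrightarrow> length x = 2 + 2 * vdim I"
  using length_coords by (auto simp: length_encode_item in_set_conv_nth)

lemma length_encode_vmk: "length (encode_vmk I) = base I"
proof -
  have "length (concat (map encode_item (items I))) = length (map encode_item (items I)) * (2 + 2 * vdim I)"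
    by (rule length_concat_uniform) (rule uniform)
  then show ?thesis by (simp add: encode_vmk_def base_def)
qed

lemma encode_vmk_nth:
  assumes "v < length (items I)" "j < 2 + 2 * vdim I"
  shows "encode_vmk I ! (4 + v * (2 + 2 * vdim I) + j) = encode_item (items I ! v) ! j"
proof -
  have "concat (map encode_item (items I)) ! (v * (2 + 2 * vdim I) + j) = map encode_item (items I) ! v ! j"
    using assms by (intro nth_concat_uniform uniform) auto
  moreover have "4 + v * (2 + 2 * vdim I) + j = Suc (Suc (Suc (Suc (v * (2 + 2 * vdim I) + j))))" by simp
  ultimately show ?thesis using assms(1) by (simp only: encode_vmk_def append_Cons append_Nil nth_Cons_Suc nth_map)
qed

lemma address_less:
  assumes "v < length (items I)" "j < 2 + 2 * vdim I"
  shows "4 + v * (2 + 2 * vdim I) + j < base I"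
proof -
  have "(v + 1) * (2 + 2 * vdim I) \<le> length (items I) * (2 + 2 * vdim I)"
    using assms(1) by (intro mult_le_mono1) simp
  then show ?thesis using assms(2) by (simp add: base_def)
qed

lemma encode_item_nth:
  assumes "v < length (items I)"
  shows "encode_item (items I ! v) ! 0 = of_bool (v \<in> small_items I)"
    "encode_item (items I ! v) ! 1 = item_profit I v"
    "j < vdim I \<Longrightarrow> encode_item (items I ! v) ! (2 + 2 * j) = numer I v j"
    "j < vdim I \<Longrightarrow> encode_item (items I ! v) ! (3 + 2 * j) = denom I v j"
proof -
  show "encode_item (items I ! v) ! 0 = of_bool (v \<in> small_items I)"
    "encode_item (items I ! v) ! 1 = item_profit I v"
    using assms by (auto simp: encode_item_def small_items_def all_items_def item_profit_def)
  assume j: "j < vdim I"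
  have "concat (map encode_rat (coords (items I ! v))) ! (j * 2 + i) = encode_rat (item_coord I v j) ! i" if "i < 2" for i
  proof -
    have "concat (map encode_rat (coords (items I ! v))) ! (j * 2 + i) = map encode_rat (coords (items I ! v)) ! j ! i"
      using j that assms by (intro nth_concat_uniform) (auto simp: length_coords length_encode_rat)
    then show ?thesis using j assms by (simp add: length_coords item_coord_def)
  qed
  from this[of 0] this[of 1]
  show "encode_item (items I ! v) ! (2 + 2 * j) = numer I v j"
    "encode_item (items I ! v) ! (3 + 2 * j) = denom I v j"
    by (auto simp: encode_item_def numer_def denom_def numeral_3_eq_3 mult.commute)
qed

lemma input_item:
  assumes M: "holds_input I M" and v: "v < length (items I)"
  shows "M (4 + v * (2 + 2 * vdim I)) = of_bool (v \<in> small_items I)"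
    "M (5 + v * (2 + 2 * vdim I)) = item_profit I v"
    "j < vdim I \<Longrightarrow> M (6 + v * (2 + 2 * vdim I) + 2 * j) = numer I v j"
    "j < vdim I \<Longrightarrow> M (7 + v * (2 + 2 * vdim I) + 2 * j) = denom I v j"
proof -
  have *: "M (4 + v * (2 + 2 * vdim I) + j) = encode_item (items I ! v) ! j" if "j < 2 + 2 * vdim I" for j
    using M address_less[OF v that] encode_vmk_nth[OF v that] by (simp add: holds_input_def)
  show "M (4 + v * (2 + 2 * vdim I)) = of_bool (v \<in> small_items I)"
    using *[of 0] encode_item_nth(1)[OF v] by simp
  show "M (5 + v * (2 + 2 * vdim I)) = item_profit I v"
    using *[of 1] encode_item_nth(2)[OF v] by (simp add: add.commute add.left_commute)
  assume j: "j < vdim I"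
  have e: "6 + v * (2 + 2 * vdim I) + 2 * j = 4 + v * (2 + 2 * vdim I) + (2 + 2 * j)"
    "7 + v * (2 + 2 * vdim I) + 2 * j = 4 + v * (2 + 2 * vdim I) + (3 + 2 * j)" by auto
  show "M (6 + v * (2 + 2 * vdim I) + 2 * j) = numer I v j" unfolding e(1)
    using *[of "2 + 2 * j"] encode_item_nth(3)[OF v j] j by simp
  show "M (7 + v * (2 + 2 * vdim I) + 2 * j) = denom I v j" unfolding e(2)
    using *[of "3 + 2 * j"] encode_item_nth(4)[OF v j] j by simp
qed

lemma input_header:
  assumes M: "holds_input I M"
  shows "M 0 = length (items I)" "M 1 = vdim I" "M 2 = bins I" "M 3 = goal_profit I"
proof -
  have "M a = encode_vmk I ! a" if "a < 4" for a using M that by (simp add: holds_input_def base_def)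
  from this[of 0] this[of 1] this[of 2] this[of 3]
  show "M 0 = length (items I)" "M 1 = vdim I" "M 2 = bins I" "M 3 = goal_profit I"
    by (simp_all add: encode_vmk_def)
qed

lemma coord_eq:
  assumes "v < length (items I)" "j < vdim I"
  shows "item_coord I v j = of_nat (numer I v j) / of_nat (denom I v j)" "denom I v j > 0"
proof -
  obtain a b where ab: "quotient_of (item_coord I v j) = (a, b)" by (meson surj_pair)
  have b: "b > 0" using quotient_of_denom_pos[OF ab] .
  have q: "item_coord I v j = of_int a / of_int b" using quotient_of_div[OF ab] .
  then have a: "a \<ge> 0" using coord_nonneg[OF assms] b by (simp add: zero_le_divide_iff)
  have nd: "numer I v j = nat a" "denom I v j = nat b"
    by (auto simp: numer_def denom_def encode_rat_def ab)
  show "item_coord I v j = of_nat (numer I v j) / of_nat (denom I v j)" "denom I v j > 0"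
    using q a b by (auto simp: nd)
qed

text \<open>The common denominator \<open>D\<close> is the product over all items, not only those in
  \<open>B\<close>, so it is the same for every bin; every division by a denominator is
  exact.\<close>

lemma fits_numeric:
  assumes B: "B \<subseteq> {..<length (items I)}" and j: "j < vdim I"
  defines "D \<equiv> (\<Prod>v<length (items I). denom I v j)"
  shows "(\<Sum>v\<in>B. item_coord I v j) \<le> 1 \<longleftrightarrow> (\<Sum>v\<in>B. numer I v j * (D div denom I v j)) \<le> D"
proof -
  have D: "D > 0" using coord_eq(2) j by (auto simp: D_def intro!: prod_pos)
  have "(\<Sum>v\<in>B. item_coord I v j) * of_nat D = (\<Sum>v\<in>B. (of_nat (numer I v j * (D div denom I v j)) :: rat))"
    unfolding sum_distrib_right
  proof (rule sum.cong[OF refl])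
    fix v assume "v \<in> B"
    then have v: "v < length (items I)" using B by auto
    have "denom I v j dvd D" unfolding D_def using v by (intro dvd_prodI) auto
    then show "item_coord I v j * of_nat D = (of_nat (numer I v j * (D div denom I v j)) :: rat)"
      using coord_eq[OF v j] by (auto simp: of_nat_div field_simps)
  qed
  then have e: "(\<Sum>v\<in>B. item_coord I v j) * of_nat D = (of_nat (\<Sum>v\<in>B. numer I v j * (D div denom I v j)) :: rat)"
    by simp
  have "(\<Sum>v\<in>B. item_coord I v j) \<le> 1 \<longleftrightarrow> (\<Sum>v\<in>B. item_coord I v j) * of_nat D \<le> 1 * of_nat D"
    using D by (subst mult_le_cancel_right_pos) auto
  also have "\<dots> \<longleftrightarrow> (\<Sum>v\<in>B. numer I v j * (D div denom I v j)) \<le> D"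
    unfolding e by (simp only: mult_1 of_nat_le_iff)
  finally show ?thesis .
qed

end

section \<open>The cell expression\<close>

definition x_flag :: "xexp \<Rightarrow> xexp" where
  "x_flag v = XL (XC 4 |+| v |*| XV 3)"

definition x_profit :: "xexp \<Rightarrow> xexp" where
  "x_profit v = XL (XC 5 |+| v |*| XV 3)"

definition x_numer :: "xexp \<Rightarrow> xexp \<Rightarrow> xexp" where
  "x_numer v j = XL (XC 6 |+| v |*| XV 3 |+| XC 2 |*| j)"

definition x_denom :: "xexp \<Rightarrow> xexp \<Rightarrow> xexp" where
  "x_denom v j = XL (XC 7 |+| v |*| XV 3 |+| XC 2 |*| j)"

definition x_rank :: "xexp \<Rightarrow> xexp" where
  "x_rank v = XS 40 v (x_flag (XV 40))"

text \<open>Register 13 is the index of a table entry; it codes two vertices and a set of labels.\<close>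

definition x_a :: xexp where "x_a = (XV 13 |div| (XV 5 |*| XV 6)) |mod| XV 6"
definition x_b :: xexp where "x_b = (XV 13 |div| XV 5) |mod| XV 6"
definition x_T :: xexp where "x_T = XV 13 |mod| XV 5"

definition ia :: "vmk \<Rightarrow> nat \<Rightarrow> nat" where "ia I i = (i div (2 ^ num_small I * verts I)) mod verts I"
definition ib :: "vmk \<Rightarrow> nat \<Rightarrow> nat" where "ib I i = (i div 2 ^ num_small I) mod verts I"
definition iT :: "vmk \<Rightarrow> nat \<Rightarrow> nat" where "iT I i = i mod 2 ^ num_small I"

text \<open>A small item is tested through its label, a large one against the two vertices. The
  nested subtraction from 1 caps the count at 1 in the case of equal vertices.\<close>

definition x_in :: "xexp \<Rightarrow> xexp" where
  "x_in v = x_flag v |*| xbit x_T (x_rank v) |+|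
     (XC 1 |-| x_flag v) |*| (XC 1 |-| (XC 1 |-| (xeq v x_a |+| xeq v x_b)))"

definition x_D :: "xexp \<Rightarrow> xexp" where
  "x_D j = XP 35 (XV 1) (x_denom (XV 35) j)"

text \<open>
  The dimension is multiplied by \<open>1 - (1 - n)\<close> because without items it is not bounded by the length
  of the input.
\<close>

definition x_fit :: xexp where
  "x_fit = XP 33 (XV 2 |*| (XC 1 |-| (XC 1 |-| XV 1)))
     (xle (XS 34 (XV 1) (x_in (XV 34) |*| (x_numer (XV 34) (XV 33) |*| (x_D (XV 33) |div| x_denom (XV 34) (XV 33)))))
       (x_D (XV 33)))"

definition x_card :: xexp where
  "x_card = XS 36 (XV 4) (xbit x_T (XV 36))"

definition x_gain :: xexp where
  "x_gain = XS 37 (XV 1) (x_in (XV 37) |*| x_profit (XV 37))"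

definition x_digit :: "xexp \<Rightarrow> xexp" where
  "x_digit i = (XV 10 |div| XP 42 i (XV 7)) |mod| XV 7"

definition x_max :: xexp where "x_max = x_a |+| (x_b |-| x_a)"
definition x_min :: xexp where "x_min = x_a |-| (x_a |-| x_b)"

definition x_labels_weight :: xexp where
  "x_labels_weight = XS 38 (XV 4) (xbit x_T (XV 38) |*| x_digit ((XV 6 |+| XC 1 |+| XV 38) |*| XV 6 |+| x_min))"

definition x_weight :: "xexp \<Rightarrow> xexp" where
  "x_weight y = x_digit (y |*| XV 6 |+| x_min) |+| x_labels_weight"

definition x_code_used :: xexp where
  "x_code_used = x_card |+| XV 8 |*| (XC 1 |+| XV 8 |*| (x_gain |+| XV 8 |*| x_weight x_max))"

definition x_code_unused :: xexp where
  "x_code_unused = x_card |+| XV 8 |*| (XC 0 |+| XV 8 |*| (XC 0 |+| XV 8 |*| x_weight (XV 6)))"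

definition x_cell :: xexp where
  "x_cell = x_fit |*| xpow2 (XV 9 |*| ((XC 1 |+| xeq x_a x_b) |*| x_code_used)) |+|
     xeq x_a x_b |*| xpow2 (XV 9 |*| (XC 2 |*| x_code_unused))"

abbreviation wt :: "vmk \<Rightarrow> nat \<Rightarrow> nat \<Rightarrow> nat" where
  "wt I R \<equiv> digit (wmax I) R"

abbreviation kcode :: "vmk \<Rightarrow> nat \<Rightarrow> nat \<Rightarrow> nat \<Rightarrow> bool \<Rightarrow> nat set \<Rightarrow> nat" where
  "kcode I R \<equiv> ks.code I (radix I) (wt I R)"

definition kcell :: "vmk \<Rightarrow> nat \<Rightarrow> nat \<Rightarrow> nat \<Rightarrow> nat \<Rightarrow> nat" where
  "kcell I R = cell (ks.ok I) (kcode I R) (4 * verts I * verts I)"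

lemma verts_pos [simp]: "verts I > 0" "verts I \<noteq> 0"
  by (auto simp: verts_def)

lemma index_less: "ia I i < verts I" "ib I i < verts I" "iT I i < 2 ^ num_small I"
  by (auto simp: ia_def ib_def iT_def)

lemma decode_iT: "set_decode (iT I i) \<subseteq> {..<num_small I}"
  using bij_betw_apply[OF set_decode_bij, of "iT I i" "num_small I"] index_less(3) by blast

lemma small_rank_le: "small_rank I v \<le> num_small I"
  unfolding small_rank_def num_small_def by (intro card_mono) auto

context
  fixes I :: vmk and R :: nat and \<sigma> M :: "nat \<Rightarrow> nat"
  assumes inst: "vmk_instance I" and M: "holds_input I M"
begin

lemma ev_index:
  assumes "regs I R \<sigma>"
  shows "xeval x_a \<sigma> M = ia I (\<sigma> 13)" "xeval x_b \<sigma> M = ib I (\<sigma> 13)" "xeval x_T \<sigma> M = iT I (\<sigma> 13)"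
    "xeval x_max \<sigma> M = max (ia I (\<sigma> 13)) (ib I (\<sigma> 13))" "xeval x_min \<sigma> M = min (ia I (\<sigma> 13)) (ib I (\<sigma> 13))"
  using regsD[OF assms] by (auto simp: x_a_def x_b_def x_T_def x_max_def x_min_def ia_def ib_def iT_def)

lemma ev_item:
  assumes r: "regs I R \<sigma>" and v: "xeval v \<sigma> M < length (items I)"
  shows "xeval (x_flag v) \<sigma> M = of_bool (xeval v \<sigma> M \<in> small_items I)"
    "xeval (x_profit v) \<sigma> M = item_profit I (xeval v \<sigma> M)"
    "xeval j \<sigma> M < vdim I \<Longrightarrow> xeval (x_numer v j) \<sigma> M = numer I (xeval v \<sigma> M) (xeval j \<sigma> M)"
    "xeval j \<sigma> M < vdim I \<Longrightarrow> xeval (x_denom v j) \<sigma> M = denom I (xeval v \<sigma> M) (xeval j \<sigma> M)"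
  using input_item[OF inst M v] regsD(3)[OF r] by (auto simp: x_flag_def x_profit_def x_numer_def x_denom_def)

end

lemma ev_rank:
  assumes I: "vmk_instance I" "holds_input I M" "regs I R \<sigma>" and v: "xeval v \<sigma> M \<le> length (items I)"
  shows "xeval (x_rank v) \<sigma> M = small_rank I (xeval v \<sigma> M)"
proof -
  let ?v = "xeval v \<sigma> M"
  have "xeval (x_rank v) \<sigma> M = (\<Sum>u<?v. xeval (x_flag (XV 40)) (\<sigma>(40 := u)) M)" by (simp add: x_rank_def)
  also have "\<dots> = (\<Sum>u<?v. of_bool (u \<in> small_items I))"
    using v I by (intro sum.cong refl) (subst ev_item(1)[OF I(1,2), where R = R], auto)
  also have "\<dots> = card ({..<?v} \<inter> small_items I)" by (subst sum_of_bool_eq) auto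
  also have "{..<?v} \<inter> small_items I = {u \<in> small_items I. u < ?v}" by auto
  finally show ?thesis by (simp add: small_rank_def)
qed

lemma ev_in:
  assumes I: "vmk_instance I" "holds_input I M" "regs I R \<sigma>" and v: "xeval v \<sigma> M < length (items I)"
  shows "xeval (x_in v) \<sigma> M =
    of_bool (xeval v \<sigma> M \<in> bin_items I (ia I (\<sigma> 13)) (ib I (\<sigma> 13)) (set_decode (iT I (\<sigma> 13))))"
proof -
  have "xeval v \<sigma> M \<in> all_items I" using v by (simp add: all_items_def)
  then show ?thesis
    using ev_rank[OF I order_less_imp_le[OF v]] ev_index(1-3)[OF I] ev_item(1)[OF I v]
    by (auto simp: x_in_def bin_items_def labelled_def large_items_def)
qed

lemma sum_of_bool_mult_subset:
  fixes n :: nat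
  assumes "B \<subseteq> {..<n}"
  shows "(\<Sum>v<n. of_bool (v \<in> B) * f v) = (\<Sum>v\<in>B. f v :: nat)"
proof -
  have "(\<Sum>v<n. of_bool (v \<in> B) * f v) = (\<Sum>v<n. if v \<in> B then f v else 0)" by (intro sum.cong) auto
  also have "\<dots> = sum f {v \<in> {..<n}. v \<in> B}" by (rule sum.inter_filter[symmetric]) simp
  also have "{v \<in> {..<n}. v \<in> B} = B" using assms by auto
  finally show ?thesis .
qed

context
  fixes I :: vmk and R :: nat and \<sigma> M :: "nat \<Rightarrow> nat"
  assumes I: "vmk_instance I" "holds_input I M" "regs I R \<sigma>"
begin

abbreviation (input) "ta \<equiv> ia I (\<sigma> 13)"
abbreviation (input) "tb \<equiv> ib I (\<sigma> 13)"
abbreviation (input) "tT \<equiv> set_decode (iT I (\<sigma> 13))"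

lemma ev_gain: "xeval x_gain \<sigma> M = set_profit I (bin_items I ta tb tT)"
proof -
  have "xeval x_gain \<sigma> M = (\<Sum>v<length (items I). of_bool (v \<in> bin_items I ta tb tT) * item_profit I v)"
    unfolding x_gain_def xeval.simps using regsD(1)[OF I(3)] I
    by (intro sum.cong) (auto simp: ev_in[where R = R] ev_item(2)[where R = R])
  also have "\<dots> = set_profit I (bin_items I ta tb tT)" unfolding set_profit_def
    using bin_items_subset[of I] by (intro sum_of_bool_mult_subset) (simp add: all_items_def)
  finally show ?thesis .
qed

lemma ev_fit: "xeval x_fit \<sigma> M = of_bool (fits I (bin_items I ta tb tT))"
proof -
  let ?n = "length (items I)" and ?B = "bin_items I ta tb tT"
  have Bn: "?B \<subseteq> {..<?n}" using bin_items_subset[of I] by (simp add: all_items_def)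
  let ?D = "\<lambda>j. \<Prod>v<?n. denom I v j"
  have D: "xeval (x_D (XV 33)) \<tau> M = ?D (\<tau> 33)" if "regs I R \<tau>" "\<tau> 33 < vdim I" for \<tau>
    unfolding x_D_def xeval.simps using regsD(1)[OF that(1)] that I
    by (intro prod.cong) (auto simp: ev_item(4)[where R = R])
  have body: "xeval (xle (XS 34 (XV 1) (x_in (XV 34) |*| (x_numer (XV 34) (XV 33) |*|
        (x_D (XV 33) |div| x_denom (XV 34) (XV 33))))) (x_D (XV 33))) (\<sigma>(33 := j)) M
      = of_bool ((\<Sum>v\<in>?B. item_coord I v j) \<le> 1)" if j: "j < vdim I" for j
  proof -
    have "xeval (XS 34 (XV 1) (x_in (XV 34) |*| (x_numer (XV 34) (XV 33) |*|
        (x_D (XV 33) |div| x_denom (XV 34) (XV 33))))) (\<sigma>(33 := j)) M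
      = (\<Sum>v<?n. of_bool (v \<in> ?B) * (numer I v j * (?D j div denom I v j)))"
      unfolding xeval.simps using regsD(1)[OF I(3)] I j
      by (intro sum.cong) (auto simp: ev_in[where R = R] ev_item(3,4)[where R = R] D)
    also have "\<dots> = (\<Sum>v\<in>?B. numer I v j * (?D j div denom I v j))" by (rule sum_of_bool_mult_subset[OF Bn])
    finally show ?thesis using fits_numeric[OF I(1) Bn j] D[of "\<sigma>(33 := j)"] I j by simp
  qed
  have bound: "xeval (XV 2 |*| (XC 1 |-| (XC 1 |-| XV 1))) \<sigma> M = (if ?n = 0 then 0 else vdim I)"
    unfolding xeval.simps arith.simps using regsD(1,2)[OF I(3)]
    by (cases "length (items I)") (simp_all del: length_0_conv)
  have "xeval x_fit \<sigma> M = (\<Prod>j<(if ?n = 0 then 0 else vdim I). of_bool ((\<Sum>v\<in>?B. item_coord I v j) \<le> 1))"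
    unfolding x_fit_def xeval.simps(6) bound
    by (rule prod.cong[OF refl], rule body) (simp split: if_splits)
  also have "\<dots> = of_bool (\<forall>j<(if ?n = 0 then 0 else vdim I). (\<Sum>v\<in>?B. item_coord I v j) \<le> 1)"
    by (auto simp: prod_zero_iff intro!: prod.neutral)
  also have "(\<forall>j<(if ?n = 0 then 0 else vdim I). (\<Sum>v\<in>?B. item_coord I v j) \<le> 1) \<longleftrightarrow> fits I ?B"
    using Bn by (auto simp: fits_def)
  finally show ?thesis .
qed

lemma ev_card: "xeval x_card \<sigma> M = card tT"
proof -
  have "xeval x_card \<sigma> M = (\<Sum>s<num_small I. of_bool (s \<in> tT) * 1)"
    unfolding x_card_def xeval.simps using regsD(4)[OF I(3)] I
    by (intro sum.cong) (auto simp: ev_index[where R = R])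
  also have "\<dots> = card tT" using sum_of_bool_mult_subset[OF decode_iT[of I "\<sigma> 13"], of "\<lambda>_. 1"] by simp
  finally show ?thesis .
qed

lemma ev_digit: "regs I R \<tau> \<Longrightarrow> xeval (x_digit i) \<tau> M = wt I R (xeval i \<tau> M)"
  using regsD(7,10)[of I R \<tau>] by (simp add: x_digit_def digit_def)

lemma ev_weight:
  "xeval (x_weight y) \<sigma> M = wt I R (xeval y \<sigma> M * verts I + min ta tb) +
     (\<Sum>s\<in>tT. wt I R ((verts I + 1 + s) * verts I + min ta tb))"
proof -
  have "xeval x_labels_weight \<sigma> M = (\<Sum>s<num_small I. of_bool (s \<in> tT) *
      wt I R ((verts I + 1 + s) * verts I + min ta tb))"
    unfolding x_labels_weight_def xeval.simps using regsD(4)[OF I(3)] regsD(6)[OF I(3)] I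
    by (intro sum.cong) (auto simp: ev_index[where R = R] ev_digit)
  also have "\<dots> = (\<Sum>s\<in>tT. wt I R ((verts I + 1 + s) * verts I + min ta tb))"
    by (rule sum_of_bool_mult_subset[OF decode_iT])
  finally show ?thesis
    using regsD(6)[OF I(3)] I by (simp add: x_weight_def ev_digit ev_index[where R = R])
qed

lemma ev_code:
  "xeval x_code_used \<sigma> M = kcode I R ta tb True tT"
  "xeval x_code_unused \<sigma> M = kcode I R ta tb False tT"
  using regsD(6,8)[OF I(3)]
  by (auto simp: x_code_used_def x_code_unused_def ks.code_def ks.gain_def ks.weight_def ev_card ev_gain ev_weight
      ev_index[OF I])

lemma ev_cell: "xeval x_cell \<sigma> M = kcell I R ta tb (iT I (\<sigma> 13))"
  using regsD(9)[OF I(3)]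
  by (auto simp: x_cell_def kcell_def cell_def UNIV_bool ev_code ev_fit ev_index[OF I] ks.ok_def)

end

section \<open>The tables\<close>

text \<open>The layers after the first start \<open>XV 12\<close> cells above \<open>XV 11\<close>,
  so \<open>XV 11 |+| XV 13\<close> is the corresponding cell one layer below. Subtracting a power
  of two from an address removes a label from the set.\<close>

definition x_zeta :: xexp where
  "x_zeta = XL (XV 11 |+| XV 13) |+| xbit x_T (XV 13 |div| XV 12) |*|
     XL ((XV 11 |+| XV 13) |-| xpow2 (XV 13 |div| XV 12))"

definition x_row :: xexp where "x_row = (XV 13 |div| XV 6) |mod| XV 6"
definition x_col :: xexp where "x_col = XV 13 |mod| XV 6"
text \<open>Layer and label set together: the layer times \<open>2 ^ num_small I\<close> plus the
  code of the set.\<close>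

definition x_block :: xexp where "x_block = XV 13 |div| (XV 6 |*| XV 6)"
definition x_base3 :: xexp where "x_base3 = XV 11 |+| (XV 4 |+| XC 1) |*| XV 12"
definition x_base4 :: xexp where "x_base4 = x_base3 |+| XV 6 |*| XV 12"

definition x_matrix :: "xexp \<Rightarrow> xexp \<Rightarrow> xexp" where
  "x_matrix i j = XL (XV 11 |+| (XV 4 |*| XV 12 |+| ((i |*| XV 6 |+| j) |*| XV 5 |+| x_block |mod| XV 5)))"

definition x_prev :: "xexp \<Rightarrow> xexp \<Rightarrow> xexp" where
  "x_prev i j = XL (x_base3 |+| (((x_block |-| XV 5) |*| XV 6 |+| i) |*| XV 6 |+| j))"

text \<open>In the first layer \<open>x_prev\<close> reads an arbitrary cell, which is then multiplied by 0.\<close>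

definition x_bird :: xexp where
  "x_bird = xle (XV 12) (XV 13) |*|
       XS 44 (XV 6) (xle (x_row |+| XC 1) (XV 44) |*|
         (x_prev x_row (XV 44) |*| x_matrix (XV 44) x_col |+| x_prev (XV 44) (XV 44) |*| x_matrix x_row x_col))
     |+| (XC 1 |-| xle (XV 12) (XV 13)) |*| x_matrix x_row x_col"

text \<open>Prefix sums over the label sets; cell 0 is the empty sum and cell \<open>X + 1\<close>
  adds the corner entry of the last Bird layer for \<open>X\<close>.\<close>

definition x_total :: xexp where
  "x_total = xle (XC 1) (XV 13) |*| (XL (x_base4 |+| (XV 13 |-| XC 1)) |+|
     XL (x_base3 |+| ((XV 6 |-| XC 1) |*| XV 12 |+| (XV 13 |-| XC 1) |*| (XV 6 |*| XV 6))))"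

text \<open>Tries all digits \<open>b\<close>, \<open>p\<close>, \<open>v\<close> of the exponent
  and adds the parities found. Three loops of \<open>radix I\<close> rounds are affordable only
  because the profits are polynomially bounded.\<close>

definition x_answer :: xexp where
  "x_answer = XS 50 (XV 8) (XS 51 (XV 8) (XS 52 (XV 8)
     (xle (XV 50) (XL (XC 2)) |*| (xle (XL (XC 3)) (XV 51) |*|
       ((XL (x_base4 |+| XV 5) |div| xpow2 (XV 9 |*| (XC 2 |*|
          (XV 4 |+| XV 8 |*| (XV 50 |+| XV 8 |*| (XV 51 |+| XV 8 |*| XV 52)))))) |mod| XC 2)))))"

abbreviation (input) psize :: "vmk \<Rightarrow> nat" where "psize I \<equiv> 2 ^ num_small I"
abbreviation (input) zsize :: "vmk \<Rightarrow> nat" where "zsize I \<equiv> verts I * verts I * 2 ^ num_small I"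

definition kmat :: "vmk \<Rightarrow> nat \<Rightarrow> nat \<Rightarrow> nat \<Rightarrow> nat \<Rightarrow> nat" where
  "kmat I R X a b = zeta (kcell I R a b) (num_small I) X"

text \<open>Digits of an index, least significant first: label set, second vertex, first vertex,
  layer. In \<open>ht\<close> the order is column, row, label set, layer.\<close>

definition zt :: "vmk \<Rightarrow> nat \<Rightarrow> nat \<Rightarrow> nat" where
  "zt I R c = zeta (kcell I R (ia I c) (ib I c)) (c div zsize I) (iT I c)"

definition ht :: "vmk \<Rightarrow> nat \<Rightarrow> nat \<Rightarrow> nat" where
  "ht I R c = bird (verts I) (kmat I R ((c div (verts I * verts I)) mod psize I)) (c div zsize I)
     ((c div verts I) mod verts I) (c mod verts I)"

definition pt :: "vmk \<Rightarrow> nat \<Rightarrow> nat \<Rightarrow> nat" where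
  "pt I R c = (\<Sum>X<c. bird (verts I) (kmat I R X) (verts I - 1) 0 0)"

definition base3 :: "vmk \<Rightarrow> nat" where "base3 I = base I + (num_small I + 1) * zsize I"
definition base4 :: "vmk \<Rightarrow> nat" where "base4 I = base3 I + verts I * zsize I"

lemma fillmem_lt: "a < b \<Longrightarrow> fillmem M b s t a = M a"
  by (simp add: fillmem_def)

lemma fillmem_in: "i < s \<Longrightarrow> fillmem M b s t (b + i) = t i"
  by (simp add: fillmem_def)

lemma holds_input_fillmem: "holds_input I M \<Longrightarrow> base I \<le> b \<Longrightarrow> holds_input I (fillmem M b s t)"
  by (auto simp: holds_input_def fillmem_lt)

lemma fillmem_append:
  "fillmem (fillmem M b s t) (b + s) s' (\<lambda>i. t (s + i)) = fillmem M b (s + s') t"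
  by (auto simp: fillmem_def fun_eq_iff)

lemma zt_first: "c < zsize I \<Longrightarrow> zt I R c = kcell I R (ia I c) (ib I c) (iT I c)"
  by (simp add: zt_def)

lemma index_shift:
  "ia I (zsize I + c) = ia I c" "ib I (zsize I + c) = ib I c" "iT I (zsize I + c) = iT I c"
proof -
  let ?N = "verts I" and ?p = "psize I"
  have e: "zsize I + c = c + ?N * (?p * ?N)" by (simp add: algebra_simps)
  have "(zsize I + c) div (?p * ?N) = ?N + c div (?p * ?N)"
    unfolding e by (subst div_mult_self1) auto
  then show "ia I (zsize I + c) = ia I c" by (simp add: ia_def)
  have "zsize I + c = c + (?N * ?N) * ?p" by simp
  then have *: "(zsize I + c) div ?p = c div ?p + ?N * ?N" "(zsize I + c) mod ?p = c mod ?p" by simp_all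
  then show "ib I (zsize I + c) = ib I c" "iT I (zsize I + c) = iT I c" by (simp_all add: ib_def iT_def)
qed

text \<open>If \<open>s\<close> belongs to the label set, subtracting \<open>2 ^ s\<close> from the
  index borrows nothing from the digits above, so vertices and layer are unchanged.\<close>

lemma zt_step:
  assumes s: "s = c div zsize I"
  shows "zt I R (zsize I + c) = zt I R c + of_bool (s \<in> set_decode (iT I c)) * zt I R (c - 2 ^ s)"
proof -
  have d: "(zsize I + c) div zsize I = Suc s" by (simp add: s)
  have bit: "iT I c div 2 ^ s mod 2 = of_bool (s \<in> set_decode (iT I c))"
    by (simp add: in_set_decode mod_2_eq_odd)
  have "zt I R (c - 2 ^ s) = zeta (kcell I R (ia I c) (ib I c)) s (iT I c - 2 ^ s)" if "s \<in> set_decode (iT I c)"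
  proof -
    let ?p = "psize I" and ?N = "verts I"
    have le: "2 ^ s \<le> iT I c"
    proof (rule ccontr)
      assume "\<not> ?thesis"
      then show False using that by (simp add: in_set_decode)
    qed
    have "c = c div ?p * ?p + iT I c" by (simp only: iT_def div_mult_mod_eq)
    then have e: "c - 2 ^ s = (iT I c - 2 ^ s) + c div ?p * ?p" using le by linarith
    have lt: "iT I c - 2 ^ s < ?p" using index_less(3)[of I c] by linarith
    have q: "(c - 2 ^ s) div ?p = c div ?p" "(c - 2 ^ s) mod ?p = iT I c - 2 ^ s"
      unfolding e using lt by simp_all
    have dp: "(c - 2 ^ s) div (?p * x) = c div (?p * x)" for x by (simp add: div_mult2_eq q(1))
    have "ia I (c - 2 ^ s) = ia I c" "ib I (c - 2 ^ s) = ib I c" "iT I (c - 2 ^ s) = iT I c - 2 ^ s"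
      using dp q by (simp_all add: ia_def ib_def iT_def)
    moreover have "(c - 2 ^ s) div zsize I = s"
      using dp[of "?N * ?N"] s by (simp add: mult.commute)
    ultimately show ?thesis by (simp add: zt_def)
  qed
  then show ?thesis using s bit by (simp add: zt_def[of I R "zsize I + c"] d index_shift) (simp add: zt_def)
qed

lemma zt_last:
  assumes "i < verts I" "j < verts I" "X < psize I"
  shows "zt I R (num_small I * zsize I + ((i * verts I + j) * psize I + X)) = kmat I R X i j"
proof -
  let ?N = "verts I" and ?p = "psize I" and ?k = "num_small I"
  let ?r = "(i * ?N + j) * ?p + X"
  have ij: "i * ?N + j < ?N * ?N"
  proof -
    have "(i + 1) * ?N \<le> ?N * ?N" using assms(1) by (intro mult_le_mono1) simp
    then show ?thesis using assms(2) by simp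
  qed
  have r: "?r < zsize I"
  proof -
    have "(i * ?N + j + 1) * ?p \<le> ?N * ?N * ?p" using ij by (intro mult_le_mono1) simp
    then show ?thesis using assms(3) by (simp add: algebra_simps)
  qed
  have e: "?k * zsize I + ?r = (?k * (?N * ?N) + (i * ?N + j)) * ?p + X" by (simp add: algebra_simps)
  have p: "(?k * zsize I + ?r) div ?p = ?k * (?N * ?N) + (i * ?N + j)"
    "(?k * zsize I + ?r) mod ?p = X" unfolding e using assms(3) by simp_all
  have "ib I (?k * zsize I + ?r) = j" unfolding ib_def p(1)
  proof -
    have e: "?k * (?N * ?N) + (i * ?N + j) = j + (?k * ?N + i) * ?N" by (simp add: algebra_simps)
    show "(?k * (?N * ?N) + (i * ?N + j)) mod ?N = j" unfolding e using assms(2) by simp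
  qed
  moreover have "ia I (?k * zsize I + ?r) = i" unfolding ia_def div_mult2_eq p(1)
  proof -
    have e: "?k * (?N * ?N) + (i * ?N + j) = j + (?k * ?N + i) * ?N" by (simp add: algebra_simps)
    have "(?k * (?N * ?N) + (i * ?N + j)) div ?N = ?k * ?N + i" unfolding e using assms(2) by simp
    then show "(?k * (?N * ?N) + (i * ?N + j)) div ?N mod ?N = i" using assms(1) by simp
  qed
  moreover have "(?k * zsize I + ?r) div zsize I = ?k"
  proof -
    have "zsize I \<noteq> 0" by simp
    then have "(?k * zsize I + ?r) div zsize I = ?k + ?r div zsize I" by (rule div_mult_self3)
    then show ?thesis by (simp only: div_less[OF r])
  qed
  ultimately show ?thesis using p(2) by (simp add: zt_def kmat_def iT_def)
qed

lemma ht_index: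
  assumes "i < verts I" "j < verts I"
  shows "ht I R ((q * verts I + i) * verts I + j) =
    bird (verts I) (kmat I R (q mod psize I)) (q div psize I) i j"
proof -
  let ?N = "verts I" and ?p = "psize I" and ?c = "(q * verts I + i) * verts I + j"
  have 1: "?c div ?N = q * ?N + i" "?c mod ?N = j" using assms by simp_all
  have 2: "?c div (?N * ?N) = q" unfolding div_mult2_eq 1(1) using assms by simp
  have "?c div zsize I = q div ?p" by (simp only: div_mult2_eq[of _ "?N * ?N"] 2)
  then show ?thesis using 1 2 assms by (simp add: ht_def)
qed

lemma ev_bases:
  assumes "regs I R \<sigma>"
  shows "xeval x_base3 \<sigma> M = base3 I" "xeval x_base4 \<sigma> M = base4 I"
  using regsD[OF assms] by (auto simp: x_base3_def x_base4_def base3_def base4_def)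

lemma base_le: "base I \<le> base3 I" "base3 I \<le> base4 I"
  by (auto simp: base3_def base4_def)

lemma ev_zeta:
  assumes r: "regs I R \<sigma>" and i: "\<sigma> 13 < num_small I * zsize I"
  shows "xeval x_zeta \<sigma> (fillmem (fillmem M (base I) (zsize I) (zt I R)) (base I + zsize I) (\<sigma> 13)
      (\<lambda>i. zt I R (zsize I + i))) = zt I R (zsize I + \<sigma> 13)"
proof -
  let ?c = "\<sigma> 13"
  let ?s = "?c div zsize I"
  have T: "xeval x_T \<sigma> M' = iT I ?c" for M' using regsD(5)[OF r] by (simp add: x_T_def iT_def)
  have "zsize I > 0" by simp
  then have "fillmem M (base I) (zsize I + ?c) (zt I R) (base I + ?c) = zt I R ?c" by (intro fillmem_in) linarith
  moreover have "fillmem M (base I) (zsize I + ?c) (zt I R) (base I + ?c - 2 ^ ?s) = zt I R (?c - 2 ^ ?s)"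
    if "?s \<in> set_decode (iT I ?c)"
  proof -
    have "2 ^ ?s \<le> iT I ?c"
    proof (rule ccontr)
      assume "\<not> ?thesis"
      then show False using that by (simp add: in_set_decode)
    qed
    also have "iT I ?c \<le> ?c" by (simp add: iT_def)
    finally have "base I + ?c - 2 ^ ?s = base I + (?c - 2 ^ ?s)" by simp
    then show ?thesis using \<open>zsize I > 0\<close> by (simp only:) (rule fillmem_in, linarith)
  qed
  ultimately have "xeval x_zeta \<sigma> (fillmem M (base I) (zsize I + ?c) (zt I R)) =
      zt I R ?c + of_bool (?s \<in> set_decode (iT I ?c)) * zt I R (?c - 2 ^ ?s)"
    using regsD(11,12)[OF r] T by (auto simp: x_zeta_def)
  then show ?thesis unfolding fillmem_append using zt_step[OF refl, of I R ?c] by metis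
qed

lemma ev_matrix:
  assumes r: "regs I R \<sigma>" and i: "xeval i \<sigma> M < verts I" and j: "xeval j \<sigma> M < verts I"
    and M: "\<And>c. c < (num_small I + 1) * zsize I \<Longrightarrow> M (base I + c) = zt I R c"
  shows "xeval (x_matrix i j) \<sigma> M =
    kmat I R ((\<sigma> 13 div (verts I * verts I)) mod psize I) (xeval i \<sigma> M) (xeval j \<sigma> M)"
proof -
  let ?N = "verts I" and ?p = "psize I" and ?k = "num_small I" and ?i = "xeval i \<sigma> M" and ?j = "xeval j \<sigma> M"
  define X where "X = (\<sigma> 13 div (?N * ?N)) mod ?p"
  have X: "X < ?p" by (simp add: X_def)
  have ij: "?i * ?N + ?j < ?N * ?N"
  proof -
    have "(?i + 1) * ?N \<le> ?N * ?N" using i by (intro mult_le_mono1) simp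
    then show ?thesis using j by simp
  qed
  have "(?i * ?N + ?j + 1) * ?p \<le> ?N * ?N * ?p" using ij by (intro mult_le_mono1) simp
  then have "?k * zsize I + ((?i * ?N + ?j) * ?p + X) < (?k + 1) * zsize I"
    using X unfolding add_mult_distrib by linarith
  from M[OF this] zt_last[OF i j X, of R]
  show ?thesis using regsD(4,5,6,11,12)[OF r] by (simp add: x_matrix_def x_block_def X_def)
qed

lemma ev_bird:
  assumes r: "regs I R \<sigma>" and c: "\<sigma> 13 < verts I * zsize I"
    and M: "\<And>c. c < (num_small I + 1) * zsize I \<Longrightarrow> M (base I + c) = zt I R c"
  shows "xeval x_bird \<sigma> (fillmem M (base3 I) (\<sigma> 13) (ht I R)) = ht I R (\<sigma> 13)"
proof -
  let ?N = "verts I" and ?p = "psize I" and ?k = "num_small I"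
  define M' where "M' = fillmem M (base3 I) (\<sigma> 13) (ht I R)"
  define q where "q = \<sigma> 13 div (?N * ?N)"
  define i where "i = (\<sigma> 13 div ?N) mod ?N"
  define j where "j = \<sigma> 13 mod ?N"
  have ij: "i < ?N" "j < ?N" by (simp_all add: i_def j_def)
  have ce: "\<sigma> 13 = (q * ?N + i) * ?N + j"
    unfolding q_def i_def j_def div_mult2_eq by simp
  have M1: "M' (base I + c) = zt I R c" if "c < (num_small I + 1) * zsize I" for c
    using M[OF that] that by (simp add: M'_def base3_def fillmem_lt)
  have ht: "ht I R (\<sigma> 13) = bird ?N (kmat I R (q mod ?p)) (q div ?p) i j"
    by (subst ce) (rule ht_index[OF ij])
  have row: "xeval x_row \<tau> M' = i" "xeval x_col \<tau> M' = j" "xeval x_block \<tau> M' = q" if "regs I R \<tau>" "\<tau> 13 = \<sigma> 13" for \<tau>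
    using that regsD(6)[OF that(1)] by (simp_all add: x_row_def x_col_def x_block_def i_def j_def q_def)
  have mat: "xeval (x_matrix u v) \<tau> M' = kmat I R (q mod ?p) (xeval u \<tau> M') (xeval v \<tau> M')"
    if "regs I R \<tau>" "\<tau> 13 = \<sigma> 13" "xeval u \<tau> M' < ?N" "xeval v \<tau> M' < ?N" for u v \<tau>
    using ev_matrix[OF that(1,3,4) M1] that(2) by (simp add: q_def)
  have test: "zsize I \<le> \<sigma> 13 \<longleftrightarrow> ?p \<le> q"
  proof -
    have "?p \<le> q \<longleftrightarrow> ?p * (?N * ?N) \<le> \<sigma> 13" unfolding q_def by (subst less_eq_div_iff_mult_less_eq) auto
    then show ?thesis by (simp add: mult.commute)
  qed
  have "xeval x_bird \<sigma> M' = ht I R (\<sigma> 13)"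
  proof (cases "?p \<le> q")
    case False
    then have "q div ?p = 0" by simp
    then show ?thesis using False test regsD(12)[OF r] r ij
      by (simp add: x_bird_def ht mat row)
  next
    case True
    have prev: "xeval (x_prev u v) \<tau> M' = bird ?N (kmat I R (q mod ?p)) (q div ?p - 1) (xeval u \<tau> M') (xeval v \<tau> M')"
      if \<tau>: "regs I R \<tau>" "\<tau> 13 = \<sigma> 13" and u: "xeval u \<tau> M' < ?N" and v: "xeval v \<tau> M' < ?N" for u v \<tau>
    proof -
      let ?u = "xeval u \<tau> M'" and ?v = "xeval v \<tau> M'"
      \<comment> \<open>Everything in the previous layer lies before row 0 of the current block,
        hence has already been written.\<close>
      have "((q - ?p) * ?N + ?u) * ?N + ?v < q * ?N * ?N"
      proof -
        have "((q - ?p) * ?N + ?u) + 1 \<le> (q - ?p) * ?N + ?N" using u by simp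
        also have "\<dots> = (q - ?p + 1) * ?N" by simp
        also have "\<dots> \<le> q * ?N"
        proof (intro mult_le_mono1)
          have "1 \<le> ?p" by simp
          then show "q - ?p + 1 \<le> q" using True by linarith
        qed
        finally have "(((q - ?p) * ?N + ?u) + 1) * ?N \<le> q * ?N * ?N" by (rule mult_le_mono1)
        then show ?thesis using v by simp
      qed
      also have "\<dots> \<le> \<sigma> 13" unfolding ce by (simp add: algebra_simps)
      finally have "M' (base3 I + (((q - ?p) * ?N + ?u) * ?N + ?v)) = ht I R (((q - ?p) * ?N + ?u) * ?N + ?v)"
        unfolding M'_def by (rule fillmem_in)
      also have "\<dots> = bird ?N (kmat I R ((q - ?p) mod ?p)) ((q - ?p) div ?p) ?u ?v"
        by (rule ht_index[OF u v])
      finally have "M' (base3 I + (((q - ?p) * ?N + ?u) * ?N + ?v)) =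
          bird ?N (kmat I R ((q - ?p) mod ?p)) ((q - ?p) div ?p) ?u ?v" .
      moreover have "(q - ?p) mod ?p = q mod ?p" "(q - ?p) div ?p = q div ?p - 1"
        using True by (simp_all add: le_mod_geq le_div_geq)
      ultimately show ?thesis
        using regsD(5,6)[OF \<tau>(1)] ev_bases(1)[OF \<tau>(1)] row(3)[OF \<tau>] by (simp add: x_prev_def)
    qed
    obtain m where m: "q div ?p = Suc m" using True div_greater_zero_iff[of q ?p]
      by (cases "q div ?p") auto
    have "xeval x_bird \<sigma> M' = (\<Sum>l<?N. of_bool (i + 1 \<le> l) *
       (bird ?N (kmat I R (q mod ?p)) m i l * kmat I R (q mod ?p) l j +
        bird ?N (kmat I R (q mod ?p)) m l l * kmat I R (q mod ?p) i j))"
      using True test regsD(6,12)[OF r] r ij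
      by (auto simp: x_bird_def mat row prev m intro!: sum.cong)
    also have "\<dots> = ht I R (\<sigma> 13)"
      unfolding ht m bird.simps by (intro sum.cong) auto
    finally show ?thesis .
  qed
  then show ?thesis by (simp add: M'_def)
qed

lemma ev_total:
  assumes r: "regs I R \<sigma>" and c: "\<sigma> 13 \<le> psize I"
    and M: "\<And>c. c < verts I * zsize I \<Longrightarrow> M (base3 I + c) = ht I R c"
  shows "xeval x_total \<sigma> (fillmem M (base4 I) (\<sigma> 13) (pt I R)) = pt I R (\<sigma> 13)"
proof (cases "\<sigma> 13")
  case 0
  then show ?thesis by (simp add: x_total_def pt_def)
next
  case (Suc X)
  let ?N = "verts I" and ?p = "psize I"
  define q where "q = (?N - 1) * ?p + X"
  have X: "X < ?p" using c Suc by simp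
  have q: "q mod ?p = X" "q div ?p = ?N - 1" using X by (simp_all add: q_def)
  have "q + 1 \<le> ?N * ?p"
  proof -
    have "?N * ?p = (?N - 1) * ?p + ?p" using verts_pos(1)[of I] by (cases ?N) auto
    then show ?thesis using X by (simp add: q_def)
  qed
  then have "(q + 1) * (?N * ?N) \<le> ?N * ?p * (?N * ?N)" by (rule mult_le_mono1)
  moreover have "?N * ?p * (?N * ?N) = ?N * zsize I" "(q * ?N + 0) * ?N + 0 = q * (?N * ?N)" by simp_all
  moreover have "0 < ?N * ?N" by simp
  ultimately have lt: "(q * ?N + 0) * ?N + 0 < ?N * zsize I"
    unfolding add_mult_distrib by linarith
  have e: "(q * ?N + 0) * ?N + 0 = (?N - 1) * zsize I + X * (?N * ?N)"
    unfolding q_def by (simp add: algebra_simps)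
  have "fillmem M (base4 I) (\<sigma> 13) (pt I R) (base3 I + ((q * ?N + 0) * ?N + 0)) = ht I R ((q * ?N + 0) * ?N + 0)"
    using M[OF lt] lt by (simp add: fillmem_lt base4_def)
  also have "\<dots> = bird ?N (kmat I R X) (?N - 1) 0 0"
    using ht_index[of 0 I 0 R q] q by simp
  finally have 1: "fillmem M (base4 I) (\<sigma> 13) (pt I R) (base3 I + ((?N - 1) * zsize I + X * (?N * ?N)))
      = bird ?N (kmat I R X) (?N - 1) 0 0" unfolding e .
  have 2: "fillmem M (base4 I) (\<sigma> 13) (pt I R) (base4 I + X) = pt I R X"
    by (rule fillmem_in) (simp add: Suc)
  show ?thesis using 1 2 regsD(6,12)[OF r] ev_bases[OF r] Suc
    by (simp add: x_total_def pt_def add.commute)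
qed

theorem ev_answer:
  assumes I: "vmk_instance I" "holds_input I M" and r: "regs I R \<sigma>" and M: "M (base4 I + psize I) = pt I R (psize I)"
  shows "xeval x_answer \<sigma> M \<noteq> 0 \<longleftrightarrow> ks.accepts I (radix I) (wt I R) (bins I) (goal_profit I)"
proof -
  let ?N = "verts I" and ?k = "num_small I" and ?K = "radix I"
  have odd: "pt I R (psize I) div 2 ^ (4 * ?N * ?N * (2 * e)) mod 2 =
      of_bool (odd (card {x \<in> covers (ks.ok I) ?N {..<?k}. cycle_sum ?N (kcode I R) x = e}))" for e
    using odd_total[of "ks.ok I" "kcode I R" ?k ?N "4 * ?N * ?N" e, OF ks.ok_sym ks.code_sym]
    by (simp add: pt_def kmat_def[abs_def] kcell_def[abs_def] ks.k_less mod_2_eq_odd)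
  have "xeval x_answer \<sigma> M = (\<Sum>b<?K. \<Sum>p<?K. \<Sum>v<?K. of_bool (b \<le> bins I) * (of_bool (goal_profit I \<le> p) *
      of_bool (odd (card {x \<in> covers (ks.ok I) ?N {..<?k}.
         cycle_sum ?N (kcode I R) x = ?k + ?K * (b + ?K * (p + ?K * v))}))))"
    unfolding x_answer_def xeval.simps using regsD[OF r] input_header(3,4)[OF I] ev_bases[of I R] r M
    by (intro sum.cong refl) (auto simp: odd[symmetric])
  then show ?thesis by (auto simp: ks.accepts_def)
qed

section \<open>Bounds\<close>

lemma base_le_input_size:
  assumes "vmk_instance I"
  shows "base I \<le> input_size (encode_vmk I)"
proof -
  have "length xs \<le> sum_list (map bit_len xs)" for xs
  proof (induction xs)
    case (Cons x xs)
    then show ?case using bit_len_pos[of x] by simp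
  qed simp
  then show ?thesis using length_encode_vmk[OF assms] by (metis input_size_def)
qed

lemma bit_len_input:
  assumes "x \<in> set xs"
  shows "bit_len x \<le> input_size xs"
  unfolding input_size_def by (rule member_le_sum_list) (use assms in auto)

lemma wbits_eq: "wbits I = bit_len (6 * verts I * verts I)"
proof -
  let ?M = "6 * verts I * verts I"
  have M: "1 \<le> ?M" by (simp add: Suc_le_eq)
  have "(2 ^ i \<le> ?M) = (i < bit_len ?M)" for i
    using bit_len_le_iff[of i ?M] bit_len_pos[of ?M] M by (cases i) auto
  then have "wbits I = (\<Sum>i<?M. of_bool (i < bit_len ?M))" by (simp add: wbits_def)
  also have "\<dots> = card ({..<?M} \<inter> {i. i < bit_len ?M})" by (subst sum_of_bool_eq) auto
  \<comment> \<open>Truncating the sum after \<open>?M\<close> terms loses nothing.\<close>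
  also have "bit_len ?M \<le> ?M" using bit_len_le_iff[OF M] less_exp by blast
  then have "{..<?M} \<inter> {i. i < bit_len ?M} = {..<bit_len ?M}" by auto
  finally show ?thesis by simp
qed

lemma wmax_bounds: "6 * verts I * verts I < wmax I" "wmax I \<le> 12 * verts I * verts I"
proof -
  let ?M = "6 * verts I * verts I"
  show "?M < wmax I" unfolding wmax_def wbits_eq by (rule less_two_power_bit_len)
  have "(2::nat) ^ floor_log ?M \<le> ?M" by (intro floor_log_exp2_le) simp
  then show "wmax I \<le> 12 * verts I * verts I" unfolding wmax_def wbits_eq bit_len_def by simp
qed

text \<open>Bounds all exponents of 2 in a cell: block length \<open>4 * verts I * verts I\<close>,
  the doubling of exponents, and \<open>code\<close> at most \<open>4 * radix I ^ 4\<close>.\<close>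

definition ubound :: "vmk \<Rightarrow> nat" where
  "ubound I = 32 * (verts I * verts I) * radix I ^ 4"

text \<open>The universal \<open>L\<close> of the cost analysis. The second summand exceeds the
  length of every table entry, since Bird's recursion multiplies at most \<open>verts I\<close>
  matrix entries.\<close>

definition vbound :: "vmk \<Rightarrow> nat" where
  "vbound I = input_size (encode_vmk I) + 2 * (verts I * ubound I)"

lemma digits_le:
  fixes K :: nat
  assumes "x \<le> K" "y \<le> K" "z \<le> K" "w \<le> K" "1 \<le> K"
  shows "x + K * (y + K * (z + K * w)) \<le> 4 * K ^ 4"
proof -
  have le: "K ^ i \<le> K ^ 4" if "i \<le> 4" for i using assms(5) that by (rule power_increasing[rotated])
  have "x + K * (y + K * (z + K * w)) \<le> K + K * (K + K * (K + K * K))"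
    using assms by (intro add_mono mult_le_mono) auto
  also have "\<dots> = K ^ 1 + K ^ 2 + K ^ 3 + K ^ 4"
    by (simp add: algebra_simps power2_eq_square power3_eq_cube power4_eq_xxxx)
  also have "\<dots> \<le> 4 * K ^ 4" using le[of 1] le[of 2] le[of 3] by linarith
  finally show ?thesis .
qed

lemma radix_ge:
  "verts I \<le> radix I" "2 * (verts I * verts I) * wmax I \<le> radix I" "verts I * items_profit I \<le> radix I"
  "items_profit I \<le> radix I" "1 \<le> radix I" "wmax I \<le> radix I" "verts I * verts I \<le> radix I"
  "verts I * wmax I \<le> radix I"
proof -
  let ?N = "verts I" and ?W = "wmax I"
  have N: "1 \<le> ?N" by (simp add: Suc_le_eq)
  have W: "1 \<le> ?W" by (simp add: wmax_def)
  show 1: "2 * (?N * ?N) * ?W \<le> radix I" by (simp add: radix_def)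
  have "?N * ?N * 1 \<le> ?N * ?N * ?W" using W by (intro mult_le_mono2)
  then show 2: "?N * ?N \<le> radix I" using 1 by linarith
  have "?N * 1 \<le> ?N * ?N" using N by (intro mult_le_mono2)
  then show "?N \<le> radix I" using 2 by linarith
  then show "1 \<le> radix I" using N by linarith
  show 3: "?N * items_profit I \<le> radix I" by (simp add: radix_def)
  have "1 * items_profit I \<le> ?N * items_profit I" using N by (intro mult_le_mono1)
  then show "items_profit I \<le> radix I" using 3 by linarith
  have "?N * 1 * ?W \<le> ?N * ?N * ?W" "1 * ?W \<le> ?N * ?N * ?W" using N by (intro mult_le_mono1 mult_le_mono2; simp)+
  then show "?W \<le> radix I" "?N * ?W \<le> radix I" using 1 by linarith+
qed

lemma ubound_ge: "32 * radix I \<le> ubound I" "32 * (verts I * verts I) \<le> ubound I"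
proof -
  let ?N = "verts I" and ?K = "radix I"
  have "?K ^ 1 \<le> ?K ^ 4" using radix_ge(5) by (intro power_increasing) auto
  then have "1 * ?K \<le> ?N * ?N * ?K ^ 4" by (intro mult_le_mono) (auto simp: Suc_le_eq)
  then show "32 * ?K \<le> ubound I" by (simp add: ubound_def)
  have "?N * ?N * 1 \<le> ?N * ?N * ?K ^ 4" using radix_ge(5) by (intro mult_le_mono2) simp
  then show "32 * (?N * ?N) \<le> ubound I" by (simp add: ubound_def)
qed

lemma exponent_le: "x \<le> 4 * radix I ^ 4 \<Longrightarrow> 4 * verts I * verts I * (2 * x) \<le> ubound I"
proof -
  assume "x \<le> 4 * radix I ^ 4"
  then have "8 * (verts I * verts I) * x \<le> 8 * (verts I * verts I) * (4 * radix I ^ 4)" by (rule mult_le_mono2)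
  then show ?thesis by (simp add: ubound_def)
qed

lemma wt_less: "wt I R i < wmax I"
  by (simp add: digit_def wmax_def)

lemma set_profit_le: "set_profit I (bin_items I a b T) \<le> items_profit I"
  unfolding set_profit_def items_profit_def using bin_items_subset[of I a b T]
  by (intro sum_mono2) (auto simp: all_items_def)

lemma kcode_le:
  assumes T: "T \<subseteq> {..<num_small I}"
  shows "kcode I R a b m T \<le> 4 * radix I ^ 4"
  unfolding ks.code_def
proof (rule digits_le[OF _ _ _ _ radix_ge(5)])
  have kN: "num_small I < verts I" by (rule ks.k_less)
  have c: "card T \<le> num_small I" using card_mono[OF _ T] by simp
  then show "card T \<le> radix I" using kN radix_ge(1)[of I] by linarith
  show "of_bool m \<le> radix I" using radix_ge(5)[of I] by (cases m) auto
  show "ks.gain I a b m T \<le> radix I"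
    using set_profit_le[of I a b T] radix_ge(4)[of I] by (auto simp: ks.gain_def)
  have "(\<Sum>s\<in>T. wt I R ((verts I + 1 + s) * verts I + min a b)) \<le> of_nat (card T) * wmax I"
    using wt_less by (intro sum_bounded_above) (auto intro: less_imp_le)
  then have "ks.weight I (wt I R) a b m T \<le> wmax I + card T * wmax I"
    unfolding ks.weight_def using wt_less[of I R "(if m then max a b else verts I) * verts I + min a b"]
    by (simp only: of_nat_id)
  also have "\<dots> = (1 + card T) * wmax I" by simp
  also have "\<dots> \<le> verts I * wmax I" using c kN by (intro mult_le_mono1) linarith
  also have "\<dots> \<le> radix I" by (rule radix_ge)
  finally show "ks.weight I (wt I R) a b m T \<le> radix I" .
qed

lemma kcell_le:
  assumes "T < psize I"
  shows "kcell I R a b T \<le> 2 ^ (ubound I + 1)"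
proof -
  have T: "set_decode T \<subseteq> {..<num_small I}"
    using bij_betw_apply[OF set_decode_bij, of T "num_small I"] assms by blast
  have "of_bool (ks.ok I a b m (set_decode T)) * 2 ^ (4 * verts I * verts I *
      ((if a = b then 2 else 1) * kcode I R a b m (set_decode T))) \<le> 1 * (2::nat) ^ ubound I" for m
  proof (intro mult_le_mono power_increasing)
    have "(if a = b then 2 else 1) * kcode I R a b m (set_decode T) \<le> 2 * kcode I R a b m (set_decode T)" by simp
    then have "4 * verts I * verts I * ((if a = b then 2 else 1) * kcode I R a b m (set_decode T))
      \<le> 4 * verts I * verts I * (2 * kcode I R a b m (set_decode T))" by (rule mult_le_mono2)
    also have "\<dots> \<le> ubound I" by (rule exponent_le[OF kcode_le[OF T]])
    finally show "4 * verts I * verts I * ((if a = b then 2 else 1) * kcode I R a b m (set_decode T)) \<le> ubound I" .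
  qed auto
  note le = this
  have sum_bool: "(\<Sum>m\<in>(UNIV :: bool set). f m) = f False + f True" for f :: "bool \<Rightarrow> nat"
    by (simp add: UNIV_bool)
  have "(2::nat) ^ (ubound I + 1) = 2 ^ ubound I + 2 ^ ubound I" by simp
  then show ?thesis
    unfolding kcell_def cell_def sum_bool using le[of True] le[of False] by linarith
qed

lemma zeta_kcell_le:
  assumes X: "X < psize I" and s: "s \<le> num_small I"
  shows "zeta (kcell I R a b) s X \<le> 2 ^ (verts I + ubound I)"
proof -
  have "zeta (kcell I R a b) s X \<le> 2 ^ s * 2 ^ (ubound I + 1)"
    using X by (intro zeta_le kcell_le) simp
  also have "\<dots> \<le> 2 ^ (verts I + ubound I)"
    unfolding power_add[symmetric] using s ks.k_less[of I] by (intro power_increasing) auto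
  finally show ?thesis .
qed

lemma kbird_le:
  assumes X: "X < psize I" and ij: "i < verts I" "j < verts I" and m: "m < verts I"
  shows "bird (verts I) (kmat I R X) m i j \<le> 2 ^ (verts I * (2 * verts I + ubound I))"
proof -
  let ?N = "verts I" and ?U = "ubound I"
  let ?c = "2 ^ (?N + ?U)"
  have N: "1 \<le> ?N" by (simp add: Suc_le_eq)
  have c: "?c \<le> 2 * ?N * ?c" using N by simp
  have "bird ?N (kmat I R X) m i j \<le> (2 * ?N * ?c) ^ m * ?c"
    using X ij by (intro bird_le) (simp_all add: kmat_def zeta_kcell_le)
  also have "\<dots> \<le> (2 * ?N * ?c) ^ m * (2 * ?N * ?c)" using c by (intro mult_le_mono2)
  also have "\<dots> = (2 * ?N * ?c) ^ Suc m" by (simp only: power_Suc2)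
  also have "\<dots> \<le> (2 * ?N * ?c) ^ ?N" using m c by (intro power_increasing) auto
  also have "\<dots> \<le> (2 ^ (2 * ?N + ?U)) ^ ?N"
  proof (rule power_mono)
    have "2 * ?N * ?c \<le> 2 ^ ?N * ?c" by (rule mult_le_mono1[OF two_mult_le_power[OF N]])
    also have "\<dots> = 2 ^ (2 * ?N + ?U)" by (simp add: power_add[symmetric] mult_2 add.assoc)
    finally show "2 * ?N * ?c \<le> 2 ^ (2 * ?N + ?U)" .
  qed simp
  also have "\<dots> = 2 ^ (?N * (2 * ?N + ?U))" by (simp add: power_mult[symmetric] mult.commute)
  finally show ?thesis .
qed

lemma table_exponent: "verts I + verts I * (2 * verts I + ubound I) < 2 * (verts I * ubound I)"
proof -
  let ?N = "verts I" and ?U = "ubound I"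
  have N: "1 \<le> ?N" by (simp add: Suc_le_eq)
  have "?N * 1 \<le> ?N * ?N" using N by (intro mult_le_mono2)
  moreover have "1 \<le> ?N * ?N" using N by (simp add: Suc_le_eq)
  moreover have "32 * (?N * ?N) \<le> ?U" by (rule ubound_ge)
  moreover have "1 * ?U \<le> ?N * ?U" using N by (intro mult_le_mono1)
  moreover have "?N * (2 * ?N + ?U) = 2 * (?N * ?N) + ?N * ?U" by (simp add: algebra_simps)
  ultimately show ?thesis by linarith
qed

lemma bit_len_le_vbound:
  assumes "x \<le> 2 ^ (verts I + verts I * (2 * verts I + ubound I))"
  shows "bit_len x \<le> vbound I"
proof -
  have "(2::nat) ^ (verts I + verts I * (2 * verts I + ubound I)) < 2 ^ vbound I"
    using table_exponent[of I] by (intro power_strict_increasing) (auto simp: vbound_def)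
  then have "x < 2 ^ vbound I" using assms by linarith
  moreover have "1 \<le> vbound I" using table_exponent[of I] unfolding vbound_def by linarith
  ultimately show ?thesis using bit_len_le_iff by blast
qed

lemma bit_len_zt:
  assumes "c < (num_small I + 1) * zsize I"
  shows "bit_len (zt I R c) \<le> vbound I"
proof (rule bit_len_le_vbound)
  have "c div zsize I < num_small I + 1" using assms by (subst div_less_iff_less_mult) auto
  then have "zt I R c \<le> 2 ^ (verts I + ubound I)"
    unfolding zt_def using index_less(3) by (intro zeta_kcell_le) auto
  also have "\<dots> \<le> 2 ^ (verts I + verts I * (2 * verts I + ubound I))"
  proof (intro power_increasing add_left_mono)
    have "1 * ubound I \<le> verts I * (2 * verts I + ubound I)" by (intro mult_le_mono) (auto simp: Suc_le_eq)
    then show "ubound I \<le> verts I * (2 * verts I + ubound I)" by simp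
  qed simp
  finally show "zt I R c \<le> 2 ^ (verts I + verts I * (2 * verts I + ubound I))" .
qed

lemma bit_len_ht:
  assumes "c < verts I * zsize I"
  shows "bit_len (ht I R c) \<le> vbound I"
proof (rule bit_len_le_vbound)
  have "c div zsize I < verts I" using assms by (subst div_less_iff_less_mult) auto
  then have "ht I R c \<le> 2 ^ (verts I * (2 * verts I + ubound I))"
    unfolding ht_def by (intro kbird_le) auto
  also have "\<dots> \<le> 2 ^ (verts I + verts I * (2 * verts I + ubound I))" by (intro power_increasing) auto
  finally show "ht I R c \<le> 2 ^ (verts I + verts I * (2 * verts I + ubound I))" .
qed

lemma bit_len_pt:
  assumes "c \<le> psize I"
  shows "bit_len (pt I R c) \<le> vbound I"
proof (rule bit_len_le_vbound)
  have "pt I R c \<le> of_nat (card {..<c}) * 2 ^ (verts I * (2 * verts I + ubound I))"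
    unfolding pt_def using assms by (intro sum_bounded_above kbird_le) auto
  also have "\<dots> \<le> 2 ^ verts I * 2 ^ (verts I * (2 * verts I + ubound I))"
  proof (rule mult_le_mono1)
    have "psize I \<le> 2 ^ verts I" using ks.k_less[of I] by (intro power_increasing) auto
    then have "c \<le> 2 ^ verts I" using assms by (rule le_trans[rotated])
    then show "of_nat (card {..<c}) \<le> (2::nat) ^ verts I" by simp
  qed
  finally show "pt I R c \<le> 2 ^ (verts I + verts I * (2 * verts I + ubound I))" by (simp add: power_add)
qed

lemma vbound_ge:
  "input_size (encode_vmk I) \<le> vbound I" "ubound I \<le> vbound I" "32 * radix I \<le> vbound I"
  "32 * (verts I * verts I) \<le> vbound I" "verts I \<le> vbound I" "2 \<le> vbound I" "num_small I \<le> vbound I"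
  "verts I * (verts I * verts I) \<le> vbound I"
proof -
  let ?N = "verts I" and ?U = "ubound I"
  have N: "1 \<le> ?N" by (simp add: Suc_le_eq)
  have "1 * ?U \<le> ?N * ?U" using N by (intro mult_le_mono1)
  then show U: "?U \<le> vbound I" unfolding vbound_def by linarith
  show "input_size (encode_vmk I) \<le> vbound I" by (simp add: vbound_def)
  show "32 * radix I \<le> vbound I" "32 * (?N * ?N) \<le> vbound I" using ubound_ge[of I] U by linarith+
  then show "?N \<le> vbound I" "2 \<le> vbound I" "num_small I \<le> vbound I" using radix_ge(1,5)[of I] ks.k_less[of I] by linarith+
  have "?N * (?N * ?N) \<le> ?N * ?U" using ubound_ge(2)[of I] by (intro mult_le_mono2) linarith
  then show "?N * (?N * ?N) \<le> vbound I" unfolding vbound_def by linarith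
qed

lemma bit_len_le_vbound': "x \<le> 32 * radix I \<Longrightarrow> bit_len x \<le> vbound I"
proof -
  assume "x \<le> 32 * radix I"
  then have "x < 2 ^ vbound I" using vbound_ge(3)[of I] less_exp[of "vbound I"] by linarith
  then show ?thesis using vbound_ge(6)[of I] by (subst bit_len_le_iff) auto
qed

text \<open>Addresses are exponential in \<open>num_small I\<close>, so \<open>vbound I\<close>
  cannot bound them, but it bounds their lengths.\<close>

lemma address_bound:
  assumes "vmk_instance I" "x \<le> base4 I + (psize I + 1)"
  shows "bit_len x \<le> vbound I"
proof -
  let ?N = "verts I" and ?p = "psize I" and ?s = "input_size (encode_vmk I)" and ?M = "verts I * (verts I * verts I)"
  have N: "1 \<le> ?N" by (simp add: Suc_le_eq)
  have M: "1 \<le> ?M" using N by (simp add: Suc_le_eq)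
  have "(num_small I + 1) * zsize I \<le> ?N * zsize I" using ks.k_less[of I] by (intro mult_le_mono1) simp
  moreover have "?N * zsize I = ?M * ?p" by simp
  moreover have "1 * ?p \<le> ?M * ?p" by (rule mult_le_mono1[OF M])
  moreover have "1 \<le> ?p" by simp
  \<comment> \<open>Two copies of \<open>?M * ?p\<close> pay for the zeta and the Bird table, two
    more for the prefix sums and the final cell.\<close>
  ultimately have "x \<le> ?s + 4 * (?M * ?p)"
    using base_le_input_size[OF assms(1)] assms(2) unfolding base4_def base3_def by linarith
  also have "\<dots> \<le> ?s + 2 ^ (2 + ?M + ?N)"
  proof (rule add_left_mono)
    have "?M * ?p \<le> 2 ^ ?M * 2 ^ ?N"
      using ks.k_less[of I] by (intro mult_le_mono power_increasing) (auto intro: less_imp_le[OF less_exp])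
    then show "4 * (?M * ?p) \<le> 2 ^ (2 + ?M + ?N)" by (simp add: power_add)
  qed
  also have "\<dots> < 2 ^ ?s + 2 ^ (2 + ?M + ?N)" using less_exp[of ?s] by simp
  also have "\<dots> \<le> 2 ^ (?s + (2 + ?M + ?N))"
  proof -
    have 1: "(2::nat) ^ 1 \<le> 2 ^ ?s" using base_le_input_size[OF assms(1)] by (intro power_increasing) (auto simp: base_def)
    have 2: "(2::nat) ^ 1 \<le> 2 ^ (2 + ?M + ?N)" by (intro power_increasing) auto
    have ab: "a + b \<le> a * b" if "2 \<le> a" "2 \<le> b" for a b :: nat
    proof (cases "a \<le> b")
      case True
      have "2 * b \<le> a * b" using that(1) by (rule mult_le_mono1)
      then show ?thesis using True by linarith
    next
      case False
      have "a * 2 \<le> a * b" using that(2) by (rule mult_le_mono2)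
      then show ?thesis using False by linarith
    qed
    show ?thesis unfolding power_add[of 2 ?s] by (rule ab[OF 1[unfolded power_one_right] 2[unfolded power_one_right]])
  qed
  also have "\<dots> \<le> 2 ^ vbound I"
  proof (rule power_increasing)
    have "?M \<le> ?N * ubound I" using ubound_ge(2)[of I] by (intro mult_le_mono2) linarith
    moreover have "?N * 1 \<le> ?N * ?N" using N by (intro mult_le_mono2)
    moreover have "1 * ubound I \<le> ?N * ubound I" using N by (rule mult_le_mono1)
    moreover have "32 * (?N * ?N) \<le> ubound I" by (rule ubound_ge)
    ultimately show "?s + (2 + ?M + ?N) \<le> vbound I" unfolding vbound_def using N by linarith
  qed simp
  finally show ?thesis using vbound_ge(6)[of I] by (subst bit_len_le_iff) auto
qed

section \<open>Loop bounds\<close>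

lemma loops_le_item [simp]:
  "loops_le (x_flag v) \<sigma> M L \<longleftrightarrow> loops_le v \<sigma> M L" "loops_le (x_profit v) \<sigma> M L \<longleftrightarrow> loops_le v \<sigma> M L"
  "loops_le (x_numer v j) \<sigma> M L \<longleftrightarrow> loops_le v \<sigma> M L \<and> loops_le j \<sigma> M L"
  "loops_le (x_denom v j) \<sigma> M L \<longleftrightarrow> loops_le v \<sigma> M L \<and> loops_le j \<sigma> M L"
  "loops_le (x_rank v) \<sigma> M L \<longleftrightarrow> loops_le v \<sigma> M L \<and> xeval v \<sigma> M \<le> L"
  "loops_le x_a \<sigma> M L" "loops_le x_b \<sigma> M L" "loops_le x_T \<sigma> M L" "loops_le x_max \<sigma> M L" "loops_le x_min \<sigma> M L"
  "loops_le (x_digit v) \<sigma> M L \<longleftrightarrow> loops_le v \<sigma> M L \<and> xeval v \<sigma> M \<le> L"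
  by (auto simp: x_flag_def x_profit_def x_numer_def x_denom_def x_rank_def x_a_def x_b_def x_T_def
      x_max_def x_min_def x_digit_def)

lemma items_le_vbound: "length (items I) \<le> vbound I"
  using vbound_ge(5)[of I] by (simp add: verts_def)

lemma loops_in:
  assumes I: "vmk_instance I" "holds_input I M" "regs I R \<sigma>"
    and v: "xeval v \<sigma> M < length (items I)" "loops_le v \<sigma> M (vbound I)"
  shows "loops_le (x_in v) \<sigma> M (vbound I)"
proof -
  have "xeval (x_rank v) \<sigma> M \<le> vbound I"
    using ev_rank[OF I, of v] v(1) small_rank_le[of I "xeval v \<sigma> M"] vbound_ge(7)[of I] by simp
  then show ?thesis using v items_le_vbound[of I] by (simp add: x_in_def)
qed

lemma index_le_vbound: "y \<le> 2 * verts I - 1 \<Longrightarrow> z < verts I \<Longrightarrow> y * verts I + z \<le> vbound I"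
proof -
  assume y: "y \<le> 2 * verts I - 1" and z: "z < verts I"
  have "(y + 1) * verts I \<le> 2 * verts I * verts I" using y z by (intro mult_le_mono1) linarith
  then have "y * verts I + z \<le> 2 * (verts I * verts I)" using z by simp
  then show ?thesis using vbound_ge(4)[of I] by linarith
qed

lemma loops_fit:
  assumes I: "vmk_instance I" "holds_input I M" "regs I R \<sigma>"
  shows "loops_le x_fit \<sigma> M (vbound I)"
proof -
  have n: "length (items I) \<le> vbound I" by (rule items_le_vbound)
  have d: "vdim I * (Suc 0 - (Suc 0 - length (items I))) \<le> vbound I"
  proof (cases "length (items I)")
    case (Suc m)
    have "vdim I \<le> base I" by (simp add: base_def Suc)
    then show ?thesis using base_le_input_size[OF I(1)] vbound_ge(1)[of I] Suc by simp
  qed simp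
  have D: "loops_le (x_D (XV 33)) \<tau> M (vbound I)" if "regs I R \<tau>" for \<tau>
    using n regsD(1)[OF that] by (simp add: x_D_def)
  show ?thesis using regsD(1,2)[OF I(3)] I n d
    by (auto simp: x_fit_def D loops_in[where R = R])
qed

lemma loops_weight:
  assumes I: "regs I R \<sigma>" and y: "loops_le y \<sigma> M (vbound I)" "xeval y \<sigma> M \<le> verts I"
  shows "loops_le (x_weight y) \<sigma> M (vbound I)"
proof -
  have k: "num_small I < verts I" by (rule ks.k_less)
  have m: "min (ia I (\<sigma> 13)) (ib I (\<sigma> 13)) < verts I" using index_less(1)[of I "\<sigma> 13"] by simp
  have "xeval y \<sigma> M * verts I + min (ia I (\<sigma> 13)) (ib I (\<sigma> 13)) \<le> vbound I"
    using y k m by (intro index_le_vbound) auto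
  moreover have "(verts I + 1 + s) * verts I + min (ia I (\<sigma> 13)) (ib I (\<sigma> 13)) \<le> vbound I" if "s < num_small I" for s
    using k m that by (intro index_le_vbound) auto
  moreover have "s \<le> vbound I" if "s < num_small I" for s using that vbound_ge(7)[of I] by linarith
  moreover have xm: "xeval x_min \<tau> M = min (ia I (\<sigma> 13)) (ib I (\<sigma> 13))" if "regs I R \<tau>" "\<tau> 13 = \<sigma> 13" for \<tau>
    using regsD(5,6)[OF that(1)] that(2) by (auto simp: x_min_def x_a_def x_b_def ia_def ib_def)
  ultimately show ?thesis using regsD(4,6)[OF I] I y vbound_ge(7)[of I]
    by (simp add: x_weight_def x_labels_weight_def)
qed

lemma loops_cell:
  assumes I: "vmk_instance I" "holds_input I M" "regs I R \<sigma>"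
  shows "loops_le x_cell \<sigma> M (vbound I)"
proof -
  have k: "num_small I \<le> vbound I" by (rule vbound_ge)
  have n: "length (items I) \<le> vbound I" by (rule items_le_vbound)
  have r8: "xeval (XV 6) \<sigma> M = verts I" using regsD(6)[OF I(3)] by simp
  have card: "loops_le x_card \<sigma> M (vbound I)"
    using k regsD(4)[OF I(3)] by (auto simp: x_card_def)
  have gain: "loops_le x_gain \<sigma> M (vbound I)"
    using n regsD(1)[OF I(3)] I by (auto simp: x_gain_def loops_in[where R = R])
  have w1: "loops_le (x_weight x_max) \<sigma> M (vbound I)"
    using ev_index(4)[OF I] index_less[of I "\<sigma> 13"] by (intro loops_weight[OF I(3)]) auto
  have w2: "loops_le (x_weight (XV 6)) \<sigma> M (vbound I)"
    using r8 by (intro loops_weight[OF I(3)]) auto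
  have T: "set_decode (iT I (\<sigma> 13)) \<subseteq> {..<num_small I}" by (rule decode_iT)
  have e1: "4 * verts I * verts I * ((1 + of_bool (ia I (\<sigma> 13) = ib I (\<sigma> 13))) *
      kcode I R (ia I (\<sigma> 13)) (ib I (\<sigma> 13)) True (set_decode (iT I (\<sigma> 13)))) \<le> vbound I"
  proof -
    have "(1 + of_bool b) * x \<le> 2 * x" for b and x :: nat by (cases b) auto
    then have "4 * verts I * verts I * ((1 + of_bool (ia I (\<sigma> 13) = ib I (\<sigma> 13))) *
      kcode I R (ia I (\<sigma> 13)) (ib I (\<sigma> 13)) True (set_decode (iT I (\<sigma> 13))))
      \<le> 4 * verts I * verts I * (2 * kcode I R (ia I (\<sigma> 13)) (ib I (\<sigma> 13)) True (set_decode (iT I (\<sigma> 13))))"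
      by (rule mult_le_mono2)
    also have "\<dots> \<le> ubound I" by (rule exponent_le[OF kcode_le[OF T]])
    finally show ?thesis using vbound_ge(2)[of I] by linarith
  qed
  have e2: "4 * verts I * verts I * (2 * kcode I R (ia I (\<sigma> 13)) (ib I (\<sigma> 13)) False (set_decode (iT I (\<sigma> 13)))) \<le> vbound I"
    using exponent_le[OF kcode_le[OF T, of R "ia I (\<sigma> 13)" "ib I (\<sigma> 13)" False]] vbound_ge(2)[of I] by linarith
  have c: "loops_le x_code_used \<sigma> M (vbound I)" "loops_le x_code_unused \<sigma> M (vbound I)"
    using card gain w1 w2 by (simp_all add: x_code_used_def x_code_unused_def)
  show ?thesis
    unfolding x_cell_def using loops_fit[OF I] c e1 e2 regsD(9)[OF I(3)] ev_code[OF I] ev_index[OF I] by simp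
qed

lemma loops_zeta:
  assumes r: "regs I R \<sigma>" and i: "\<sigma> 13 < num_small I * zsize I"
  shows "loops_le x_zeta \<sigma> M (vbound I)"
proof -
  have "\<sigma> 13 div zsize I < num_small I" using i by (subst div_less_iff_less_mult) auto
  then have "\<sigma> 13 div zsize I \<le> vbound I" using vbound_ge(7)[of I] by linarith
  then show ?thesis using regsD(12)[OF r] by (simp add: x_zeta_def)
qed

lemma loops_bird: "regs I R \<sigma> \<Longrightarrow> loops_le x_bird \<sigma> M (vbound I)"
  using vbound_ge(5)[of I] regsD(6)[of I R \<sigma>]
  by (simp add: x_bird_def x_prev_def x_matrix_def x_row_def x_col_def x_block_def x_base3_def)

lemma loops_total: "loops_le x_total \<sigma> M L"
  by (simp add: x_total_def x_base3_def x_base4_def)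

lemma loops_answer:
  assumes "regs I R \<sigma>"
  shows "loops_le x_answer \<sigma> M (vbound I)"
proof -
  have K: "radix I \<le> vbound I" using vbound_ge(3)[of I] by linarith
  have k: "num_small I \<le> radix I" using ks.k_less[of I] radix_ge(1)[of I] by linarith
  have "4 * verts I * verts I * (2 * (num_small I + radix I * (b + radix I * (p + radix I * v)))) \<le> vbound I"
    if "b < radix I" "p < radix I" "v < radix I" for b p v
  proof -
    have "num_small I + radix I * (b + radix I * (p + radix I * v)) \<le> 4 * radix I ^ 4"
      using that k by (intro digits_le radix_ge) auto
    from exponent_le[OF this] show ?thesis using vbound_ge(2)[of I] by linarith
  qed
  then show ?thesis using regsD(4,8,9)[OF assms] K
    by (simp add: x_answer_def x_base4_def x_base3_def)
qed

section \<open>The program\<close>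

definition x_W_bits :: xexp where
  "x_W_bits = XS 30 (XC 6 |*| XV 6 |*| XV 6) (xle (xpow2 (XV 30)) (XC 6 |*| XV 6 |*| XV 6))"

definition x_radix :: xexp where
  "x_radix = XC 2 |*| XV 6 |*| XV 6 |*| XV 7 |+| XV 6 |*| XS 30 (XV 1) (x_profit (XV 30))"

definition prelude :: prog where
  "prelude = Seq (xset 1 (XL (XC 0))) (Seq (xset 2 (XL (XC 1))) (Seq (xset 3 (XC 2 |+| XC 2 |*| XV 2))
     (Seq (xset 4 (XS 30 (XV 1) (x_flag (XV 30)))) (Seq (xset 5 (xpow2 (XV 4))) (Seq (xset 6 (XV 1 |+| XC 1))
     (Seq (xset 18 x_W_bits) (Seq (xset 7 (xpow2 (XV 18))) (Seq (xset 8 x_radix)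
     (Seq (xset 9 (XC 4 |*| XV 6 |*| XV 6)) (Seq (xset 11 (XC 4 |+| XV 1 |*| XV 3))
     (Seq (xset 12 (XV 6 |*| XV 6 |*| XV 5)) (Seq (xset 14 (XV 18 |*| (XC 2 |*| XV 6 |*| XV 6))) xflip))))))))))))"

definition xtable :: "xexp \<Rightarrow> xexp \<Rightarrow> xexp \<Rightarrow> prog" where
  "xtable b s x = Seq (xset 16 b) (Seq (xset 17 s) (xfill x))"

definition alg :: prog where
  "alg = Seq prelude (Seq (xtable (XV 11) (XV 12) x_cell)
     (Seq (xtable (XV 11 |+| XV 12) (XV 4 |*| XV 12) x_zeta)
     (Seq (xtable x_base3 (XV 6 |*| XV 12) x_bird)
     (Seq (xtable x_base4 (XV 5 |+| XC 1) x_total) (xset 0 x_answer)))))"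

text \<open>All expressions compiled into \<open>alg\<close>, collected to obtain one exponent for
  the whole program.\<close>

definition exprs :: "xexp list" where
  "exprs = [XL (XC 0), XL (XC 1), XC 2 |+| XC 2 |*| XV 2, XS 30 (XV 1) (x_flag (XV 30)), xpow2 (XV 4),
     XV 1 |+| XC 1, x_W_bits, xpow2 (XV 18), x_radix, XC 4 |*| XV 6 |*| XV 6, XC 4 |+| XV 1 |*| XV 3,
     XV 6 |*| XV 6 |*| XV 5, XV 18 |*| (XC 2 |*| XV 6 |*| XV 6), XV 11, XV 12, x_cell,
     XV 11 |+| XV 12, XV 4 |*| XV 12, x_zeta, x_base3, XV 6 |*| XV 12, x_bird, x_base4, XV 5 |+| XC 1,
     x_total, x_answer]"

lemma compiles_in_list: "\<exists>C\<ge>2. \<forall>x\<in>set xs. compiles_in x C"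
proof (induction xs)
  case (Cons x xs)
  then obtain C c where C: "2 \<le> C" "\<forall>x\<in>set xs. compiles_in x C" and c: "compiles_in x c"
    using compiles_in_ex by blast
  have "\<forall>y\<in>set (x # xs). compiles_in y (max C c)"
    using C(2) c compiles_in_mono by fastforce
  then show ?case using C(1) by (meson max.coboundedI1)
qed auto

lemma xset_step:
  assumes "compiles_in x C" "r < 19" "2 \<le> L" "small_vals L \<sigma>" "small_vals L M" "loops_le x \<sigma> M L"
    and "xeval x \<sigma> M = v" "bit_len v \<le> L"
  shows "xruns (xset r x) \<sigma> M \<omega> (\<sigma>(r := v)) M \<omega> (2 * L ^ C) \<and> small_vals L (\<sigma>(r := v))"
  using xruns_xset[OF assms(1-6)] assms(7,8) small_vals_upd[OF assms(4)] by auto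

lemma xruns_xtable:
  assumes C: "compiles_in eb C" "compiles_in es C" "compiles_in x C"
    and L: "2 \<le> L" "small_vals L \<sigma>" "small_vals L M" "loops_le eb \<sigma> M L" "\<And>b. loops_le es (\<sigma>(16 := b)) M L"
    and b: "xeval eb \<sigma> M = b" and s: "xeval es (\<sigma>(16 := b)) M = s" and bs: "bit_len (b + s) \<le> L"
    and x: "\<And>i. i < s \<Longrightarrow> xeval x (\<sigma>(16 := b, 17 := s, 13 := i)) (fillmem M b i t) = t i"
      "\<And>i. i < s \<Longrightarrow> loops_le x (\<sigma>(16 := b, 17 := s, 13 := i)) (fillmem M b i t) L"
      "\<And>i. i < s \<Longrightarrow> bit_len (t i) \<le> L"
  shows "xruns (xtable eb es x) \<sigma> M \<omega> (\<sigma>(16 := b, 17 := s, 13 := s)) (fillmem M b s t) \<omega>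
      (2 * L ^ C + (2 * L ^ C + (s * (10 * L + L ^ C) + 4 * L))) \<and>
    small_vals L (\<sigma>(16 := b, 17 := s, 13 := s)) \<and> small_vals L (fillmem M b s t)"
proof -
  have bL: "bit_len b \<le> L" "bit_len s \<le> L" using bit_len_mono[of b "b + s"] bit_len_mono[of s "b + s"] bs by auto
  have 1: "xruns (xset 16 eb) \<sigma> M \<omega> (\<sigma>(16 := b)) M \<omega> (2 * L ^ C) \<and> small_vals L (\<sigma>(16 := b))"
    by (rule xset_step[OF C(1) _ L(1-4) b bL(1)]) simp
  have 2: "xruns (xset 17 es) (\<sigma>(16 := b)) M \<omega> (\<sigma>(16 := b, 17 := s)) M \<omega> (2 * L ^ C) \<and>
      small_vals L (\<sigma>(16 := b, 17 := s))"
    by (rule xset_step[OF C(2) _ L(1) 1[THEN conjunct2] L(3,5) s bL(2)]) simp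
  have 3: "xruns (xfill x) (\<sigma>(16 := b, 17 := s)) M \<omega> (\<sigma>(16 := b, 17 := s, 13 := s)) (fillmem M b s t) \<omega> (s * (10 * L + L ^ C) + 4 * L)"
    using x bs by (intro xruns_xfill[OF C(3) L(1) 2[THEN conjunct2] L(3)]) auto
  have "xruns (xtable eb es x) \<sigma> M \<omega> (\<sigma>(16 := b, 17 := s, 13 := s)) (fillmem M b s t) \<omega>
      (2 * L ^ C + (2 * L ^ C + (s * (10 * L + L ^ C) + 4 * L)))"
    unfolding xtable_def by (rule xruns_Seq[OF 1[THEN conjunct1] xruns_Seq[OF 2[THEN conjunct1] 3]])
  moreover have "small_vals L (\<sigma>(16 := b, 17 := s, 13 := s))" by (rule small_vals_upd[OF 2[THEN conjunct2] bL(2)])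
  moreover have "small_vals L (fillmem M b s t)" using L(3) x(3) by (intro small_vals_fillmem)
  ultimately show ?thesis by blast
qed

lemma xruns_mono: "xruns c \<sigma> M \<omega> \<sigma>' M' \<omega>' T \<Longrightarrow> T \<le> T' \<Longrightarrow> xruns c \<sigma> M \<omega> \<sigma>' M' \<omega>' T'"
  unfolding xruns_def using runs_mono by blast

section \<open>Execution and cost of the whole program\<close>

definition coins :: "vmk \<Rightarrow> nat" where
  "coins I = wbits I * (2 * verts I * verts I)"

definition input_mem :: "vmk \<Rightarrow> nat \<Rightarrow> nat" where
  "input_mem I = (\<lambda>i. if i < length (encode_vmk I) then encode_vmk I ! i else 0)"

context
  fixes I :: vmk and C :: nat
  assumes inst: "vmk_instance I" and C: "2 \<le> C" "\<forall>x\<in>set exprs. compiles_in x C"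
begin

abbreviation (input) "L \<equiv> vbound I"

lemma holds_input_mem: "holds_input I (input_mem I)"
  using length_encode_vmk[OF inst] by (simp add: holds_input_def input_mem_def)

lemma small_input_mem: "small_vals L (input_mem I)"
proof -
  have "bit_len (encode_vmk I ! i) \<le> L" if "i < length (encode_vmk I)" for i
    using bit_len_input[OF nth_mem[OF that]] vbound_ge(1)[of I] by linarith
  then show ?thesis using vbound_ge(6)[of I] by (auto simp: small_vals_def input_mem_def)
qed

lemma coins_le: "coins I \<le> radix I"
proof -
  have "wbits I \<le> wmax I" unfolding wmax_def by (rule less_imp_le[OF less_exp])
  then have "coins I \<le> wmax I * (2 * verts I * verts I)" unfolding coins_def by (rule mult_le_mono1)
  also have "\<dots> \<le> radix I" using radix_ge(2)[of I] by (simp add: mult.commute)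
  finally show ?thesis .
qed

lemma prelude_runs:
  "\<exists>\<sigma>. regs I (coin_value (coins I) \<omega>) \<sigma> \<and> small_vals L \<sigma> \<and>
     xruns prelude (\<lambda>_. 0) (input_mem I) \<omega> \<sigma> (input_mem I) (sdrop (coins I) \<omega>)
       (26 * L ^ C + (coins I * (10 * L) + 2 * L))"
proof -
  let ?M = "input_mem I" and ?n = "length (items I)" and ?d = "vdim I" and ?N = "verts I" and ?k = "num_small I"
  note L2 = vbound_ge(6)[of I]
  note sM = small_input_mem
  note hd = input_header[OF inst holds_input_mem]
  note it = input_item[OF inst holds_input_mem]
  have nL: "?n \<le> L" using vbound_ge(5)[of I] by (simp add: verts_def)
  have k: "?k < ?N" by (rule ks.k_less)
  have NK: "?N \<le> radix I" by (rule radix_ge)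
  have WK: "wbits I \<le> radix I"
    using radix_ge(6)[of I] less_exp[of "wbits I"] unfolding wmax_def by linarith
  have st: "bit_len (2 + 2 * ?d) \<le> L"
  proof -
    \<comment> \<open>Two bits are kept in reserve so that \<open>2 + 2 * ?d\<close> still has
      length at most \<open>L\<close>; \<open>ubound I\<close> alone is at least 32.\<close>
    have "bit_len ?d \<le> L - 2"
    proof -
      have "1 < length (encode_vmk I)" by (simp add: encode_vmk_def)
      then have "bit_len ?d \<le> input_size (encode_vmk I)"
        using bit_len_input[of "encode_vmk I ! 1" "encode_vmk I"] by (simp add: encode_vmk_def)
      moreover have "32 * 1 \<le> ubound I" using ubound_ge(1)[of I] radix_ge(5)[of I] by linarith
      moreover have "1 * ubound I \<le> verts I * ubound I" by (intro mult_le_mono1) (simp add: Suc_le_eq)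
      ultimately show ?thesis unfolding vbound_def by linarith
    qed
    moreover have "1 \<le> bit_len ?d" by (rule bit_len_pos)
    ultimately have "?d < 2 ^ (L - 2)" by (subst bit_len_le_iff[symmetric]) linarith+
    moreover have "(2::nat) ^ 2 * 2 ^ (L - 2) = 2 ^ L"
      by (simp only: power_add[symmetric] le_add_diff_inverse[OF L2])
    then have "(2::nat) ^ L = 4 * 2 ^ (L - 2)" by simp
    ultimately have "2 + 2 * ?d < 2 ^ L" by linarith
    then show ?thesis using L2 by (subst bit_len_le_iff) auto
  qed
  have addr: "bit_len x \<le> L" if "x \<le> base4 I + (psize I + 1)" for x by (rule address_bound[OF inst that])
  have pL: "bit_len (2 ^ ?k) \<le> L" by (rule addr) simp
  have bL: "bit_len (base I) \<le> L" using base_le[of I] by (intro addr) linarith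
  have zL: "bit_len (zsize I) \<le> L"
  proof (rule addr)
    have "1 * zsize I \<le> verts I * zsize I" by (intro mult_le_mono1) (simp add: Suc_le_eq)
    then show "zsize I \<le> base4 I + (psize I + 1)" unfolding base4_def by linarith
  qed
  have kL: "bit_len x \<le> L" if "x \<le> 32 * radix I" for x by (rule bit_len_le_vbound'[OF that])
  have Cx: "compiles_in x C" if "x \<in> set exprs" for x using C(2) that by blast
  let ?s0 = "\<lambda>_. 0 :: nat"
  have s0: "small_vals L ?s0" using L2 by (simp add: small_vals_def)
  let ?s1 = "?s0(1 := ?n)"
  have 1: "xruns (xset 1 (XL (XC 0))) ?s0 ?M \<omega> ?s1 ?M \<omega> (2 * L ^ C) \<and> small_vals L ?s1"
    by (rule xset_step[OF Cx _ L2 s0 sM]; use hd NK kL[of ?n] in \<open>simp add: exprs_def verts_def\<close>)+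
  let ?s2 = "?s1(2 := ?d)"
  have 2: "xruns (xset 2 (XL (XC 1))) ?s1 ?M \<omega> ?s2 ?M \<omega> (2 * L ^ C) \<and> small_vals L ?s2"
    by (rule xset_step[OF Cx _ L2 1[THEN conjunct2] sM]; use hd sM in \<open>simp add: exprs_def small_vals_def; metis\<close>)+
  let ?s3 = "?s2(3 := 2 + 2 * ?d)"
  have 3: "xruns (xset 3 (XC 2 |+| XC 2 |*| XV 2)) ?s2 ?M \<omega> ?s3 ?M \<omega> (2 * L ^ C) \<and> small_vals L ?s3"
    by (rule xset_step[OF Cx _ L2 2[THEN conjunct2] sM]; use st in \<open>simp add: exprs_def\<close>)+
  let ?s4 = "?s3(4 := ?k)"
  have v4: "xeval (XS 30 (XV 1) (x_flag (XV 30))) ?s3 ?M = ?k"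
  proof -
    have "xeval (XS 30 (XV 1) (x_flag (XV 30))) ?s3 ?M = (\<Sum>v<?n. of_bool (v \<in> small_items I) * 1)"
      using it(1) by (simp add: x_flag_def)
    also have "\<dots> = ?k"
      by (subst sum_of_bool_mult_subset) (auto simp: num_small_def item_less(1))
    finally show ?thesis .
  qed
  have 4: "xruns (xset 4 (XS 30 (XV 1) (x_flag (XV 30)))) ?s3 ?M \<omega> ?s4 ?M \<omega> (2 * L ^ C) \<and> small_vals L ?s4"
    by (rule xset_step[OF Cx _ L2 3[THEN conjunct2] sM _ v4]; use kL[of ?k] k NK nL in \<open>simp add: exprs_def\<close>)+
  let ?s5 = "?s4(5 := 2 ^ ?k)"
  have 5: "xruns (xset 5 (xpow2 (XV 4))) ?s4 ?M \<omega> ?s5 ?M \<omega> (2 * L ^ C) \<and> small_vals L ?s5"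
    by (rule xset_step[OF Cx _ L2 4[THEN conjunct2] sM]; use pL vbound_ge(7)[of I] in \<open>simp add: exprs_def\<close>)+
  let ?s6 = "?s5(6 := ?N)"
  have 6: "xruns (xset 6 (XV 1 |+| XC 1)) ?s5 ?M \<omega> ?s6 ?M \<omega> (2 * L ^ C) \<and> small_vals L ?s6"
    by (rule xset_step[OF Cx _ L2 5[THEN conjunct2] sM]; use kL[of ?N] NK in \<open>simp add: exprs_def verts_def\<close>)+
  let ?s7 = "?s6(18 := wbits I)"
  have N6: "6 * ?N * ?N \<le> L" using vbound_ge(4)[of I] by simp
  have 7: "xruns (xset 18 x_W_bits) ?s6 ?M \<omega> ?s7 ?M \<omega> (2 * L ^ C) \<and> small_vals L ?s7"
    by (rule xset_step[OF Cx _ L2 6[THEN conjunct2] sM];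
        use kL[of "wbits I"] WK N6 in \<open>simp add: exprs_def x_W_bits_def wbits_def\<close>)+
  let ?s8 = "?s7(7 := wmax I)"
  have 8: "xruns (xset 7 (xpow2 (XV 18))) ?s7 ?M \<omega> ?s8 ?M \<omega> (2 * L ^ C) \<and> small_vals L ?s8"
    by (rule xset_step[OF Cx _ L2 7[THEN conjunct2] sM];
        use kL[of "wmax I"] radix_ge(6)[of I] WK vbound_ge(3)[of I] in \<open>simp add: exprs_def wmax_def\<close>)+
  let ?s9 = "?s8(8 := radix I)"
  have v9: "xeval x_radix ?s8 ?M = radix I"
    using it(2) by (simp add: x_radix_def radix_def items_profit_def x_profit_def)
  have 9: "xruns (xset 8 x_radix) ?s8 ?M \<omega> ?s9 ?M \<omega> (2 * L ^ C) \<and> small_vals L ?s9"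
    by (rule xset_step[OF Cx _ L2 8[THEN conjunct2] sM _ v9];
        use kL[of "radix I"] nL in \<open>simp add: exprs_def x_radix_def\<close>)+
  let ?s10 = "?s9(9 := 4 * ?N * ?N)"
  have 10: "xruns (xset 9 (XC 4 |*| XV 6 |*| XV 6)) ?s9 ?M \<omega> ?s10 ?M \<omega> (2 * L ^ C) \<and> small_vals L ?s10"
    by (rule xset_step[OF Cx _ L2 9[THEN conjunct2] sM];
        use kL[of "4 * ?N * ?N"] radix_ge(7)[of I] in \<open>simp add: exprs_def\<close>)+
  let ?s11 = "?s10(11 := base I)"
  have 11: "xruns (xset 11 (XC 4 |+| XV 1 |*| XV 3)) ?s10 ?M \<omega> ?s11 ?M \<omega> (2 * L ^ C) \<and> small_vals L ?s11"
    by (rule xset_step[OF Cx _ L2 10[THEN conjunct2] sM]; use bL in \<open>simp add: exprs_def base_def\<close>)+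
  let ?s12 = "?s11(12 := zsize I)"
  have 12: "xruns (xset 12 (XV 6 |*| XV 6 |*| XV 5)) ?s11 ?M \<omega> ?s12 ?M \<omega> (2 * L ^ C) \<and> small_vals L ?s12"
    by (rule xset_step[OF Cx _ L2 11[THEN conjunct2] sM]; use zL in \<open>simp add: exprs_def\<close>)+
  have coL: "bit_len (coins I) \<le> L" using coins_le radix_ge(5)[of I] by (intro kL) linarith
  let ?s13 = "?s12(14 := coins I)"
  have 13: "xruns (xset 14 (XV 18 |*| (XC 2 |*| XV 6 |*| XV 6))) ?s12 ?M \<omega> ?s13 ?M \<omega> (2 * L ^ C) \<and> small_vals L ?s13"
    by (rule xset_step[OF Cx _ L2 12[THEN conjunct2] sM];
        use coL[unfolded coins_def] in \<open>simp add: exprs_def coins_def\<close>)+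
  let ?R = "coin_value (coins I) \<omega>"
  let ?s14 = "?s13(10 := ?R, 14 := 0)"
  have cL: "coins I < L" using coins_le vbound_ge(3)[of I] radix_ge(5)[of I] by linarith
  have 14: "xruns xflip ?s13 ?M \<omega> ?s14 ?M (sdrop (coins I) \<omega>) (coins I * (10 * L) + 2 * L)"
    by (rule xruns_xflip[OF L2 cL]) auto
  have RL: "bit_len ?R \<le> L"
  proof -
    have "(2::nat) ^ coins I \<le> 2 ^ L" using cL by (intro power_increasing) auto
    then have "?R < 2 ^ L" using coin_value_less[of "coins I" \<omega>] by linarith
    then show ?thesis using L2 by (subst bit_len_le_iff) auto
  qed
  have "small_vals L ?s14" by (rule small_vals_upd[OF small_vals_upd[OF 13[THEN conjunct2] RL]]) (use L2 in simp)
  moreover have "regs I ?R ?s14" by (simp add: regs_def)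
  moreover have "xruns prelude ?s0 ?M \<omega> ?s14 ?M (sdrop (coins I) \<omega>)
      (2 * L ^ C + (2 * L ^ C + (2 * L ^ C + (2 * L ^ C + (2 * L ^ C + (2 * L ^ C + (2 * L ^ C + (2 * L ^ C +
      (2 * L ^ C + (2 * L ^ C + (2 * L ^ C + (2 * L ^ C + (2 * L ^ C + (coins I * (10 * L) + 2 * L))))))))))))))"
    unfolding prelude_def
    by (rule xruns_Seq[OF 1[THEN conjunct1]] xruns_Seq[OF 2[THEN conjunct1]] xruns_Seq[OF 3[THEN conjunct1]] xruns_Seq[OF 4[THEN conjunct1]] xruns_Seq[OF 5[THEN conjunct1]]
      xruns_Seq[OF 6[THEN conjunct1]] xruns_Seq[OF 7[THEN conjunct1]] xruns_Seq[OF 8[THEN conjunct1]] xruns_Seq[OF 9[THEN conjunct1]] xruns_Seq[OF 10[THEN conjunct1]]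
      xruns_Seq[OF 11[THEN conjunct1]] xruns_Seq[OF 12[THEN conjunct1]] xruns_Seq[OF 13[THEN conjunct1]] 14)+
  ultimately show ?thesis by (intro exI[of _ ?s14]) (simp add: algebra_simps)
qed

theorem alg_runs:
  defines "R \<equiv> \<lambda>\<omega>. coin_value (coins I) \<omega>"
  shows "\<exists>\<sigma> M. xruns alg (\<lambda>_. 0) (input_mem I) \<omega> \<sigma> M (sdrop (coins I) \<omega>) (2 ^ num_small I * L ^ (C + 8)) \<and>
    (\<sigma> 0 \<noteq> 0 \<longleftrightarrow> ks.accepts I (radix I) (wt I (R \<omega>)) (bins I) (goal_profit I))"
proof -
  let ?N = "verts I" and ?k = "num_small I" and ?p = "psize I" and ?Z = "zsize I" and ?R = "R \<omega>"
  let ?\<omega> = "sdrop (coins I) \<omega>"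
  note L2 = vbound_ge(6)[of I]
  have Cx: "compiles_in x C" if "x \<in> set exprs" for x using C(2) that by blast
  have addr: "bit_len x \<le> L" if "x \<le> base4 I + (psize I + 1)" for x by (rule address_bound[OF inst that])
  from prelude_runs[of \<omega>] obtain \<sigma>0 where \<sigma>0: "regs I ?R \<sigma>0" "small_vals L \<sigma>0"
    "xruns prelude (\<lambda>_. 0) (input_mem I) \<omega> \<sigma>0 (input_mem I) ?\<omega> (26 * L ^ C + (coins I * (10 * L) + 2 * L))"
    unfolding R_def by blast
  define M0 where "M0 = input_mem I"
  note h0 = holds_input_mem[folded M0_def] and m0 = small_input_mem[folded M0_def]
  have Zb: "base I + ?Z \<le> base3 I" "base I + ?Z + ?k * ?Z = base3 I" by (simp_all add: base3_def)
  define \<sigma>1 where "\<sigma>1 = \<sigma>0(16 := base I, 17 := ?Z, 13 := ?Z)"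
  define M1 where "M1 = fillmem M0 (base I) ?Z (zt I ?R)"
  note r0 = regsD[OF \<sigma>0(1)]
  have 1: "xruns (xtable (XV 11) (XV 12) x_cell) \<sigma>0 M0 ?\<omega> \<sigma>1 M1 ?\<omega>
      (2 * L ^ C + (2 * L ^ C + (?Z * (10 * L + L ^ C) + 4 * L))) \<and> small_vals L \<sigma>1 \<and> small_vals L M1"
    unfolding \<sigma>1_def M1_def
  proof (rule xruns_xtable[OF Cx Cx Cx L2 \<sigma>0(2) m0])
    show "bit_len (base I + ?Z) \<le> L" using Zb base_le[of I] by (intro addr) linarith
    fix i assume i: "i < ?Z"
    have h: "holds_input I (fillmem M0 (base I) i (zt I ?R))" by (rule holds_input_fillmem[OF h0 order_refl])
    show "xeval x_cell (\<sigma>0(16 := base I, 17 := ?Z, 13 := i)) (fillmem M0 (base I) i (zt I ?R)) = zt I ?R i"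
      using ev_cell[OF inst h, of ?R "\<sigma>0(16 := base I, 17 := ?Z, 13 := i)"] \<sigma>0(1) i by (simp add: zt_first)
    show "loops_le x_cell (\<sigma>0(16 := base I, 17 := ?Z, 13 := i)) (fillmem M0 (base I) i (zt I ?R)) L"
      using \<sigma>0(1) by (intro loops_cell[OF inst h, of ?R]) simp
    show "bit_len (zt I ?R i) \<le> L" using i by (intro bit_len_zt) simp
  qed (use r0 in \<open>simp_all add: exprs_def\<close>)
  have r1: "regs I ?R \<sigma>1" using \<sigma>0(1) by (simp add: \<sigma>1_def)
  define \<sigma>2 where "\<sigma>2 = \<sigma>1(16 := base I + ?Z, 17 := ?k * ?Z, 13 := ?k * ?Z)"
  define M2 where "M2 = fillmem M1 (base I + ?Z) (?k * ?Z) (\<lambda>i. zt I ?R (?Z + i))"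
  have 2: "xruns (xtable (XV 11 |+| XV 12) (XV 4 |*| XV 12) x_zeta) \<sigma>1 M1 ?\<omega> \<sigma>2 M2 ?\<omega>
      (2 * L ^ C + (2 * L ^ C + (?k * ?Z * (10 * L + L ^ C) + 4 * L))) \<and> small_vals L \<sigma>2 \<and> small_vals L M2"
    unfolding \<sigma>2_def M2_def
  proof (rule xruns_xtable[OF Cx Cx Cx L2 1[THEN conjunct2, THEN conjunct1] 1[THEN conjunct2, THEN conjunct2]])
    show "bit_len (base I + ?Z + ?k * ?Z) \<le> L" using Zb base_le[of I] by (intro addr) linarith
    fix i assume i: "i < ?k * ?Z"
    show "xeval x_zeta (\<sigma>1(16 := base I + ?Z, 17 := ?k * ?Z, 13 := i)) (fillmem M1 (base I + ?Z) i (\<lambda>i. zt I ?R (?Z + i)))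
        = zt I ?R (?Z + i)"
      using ev_zeta[of I ?R "\<sigma>1(16 := base I + ?Z, 17 := ?k * ?Z, 13 := i)" M0] r1 i by (simp add: M1_def)
    show "loops_le x_zeta (\<sigma>1(16 := base I + ?Z, 17 := ?k * ?Z, 13 := i)) (fillmem M1 (base I + ?Z) i (\<lambda>i. zt I ?R (?Z + i))) L"
      using r1 i by (intro loops_zeta[of I ?R]) simp_all
    show "bit_len (zt I ?R (?Z + i)) \<le> L" using i by (intro bit_len_zt) simp
  qed (use regsD[OF r1] in \<open>simp_all add: exprs_def\<close>)
  have r2: "regs I ?R \<sigma>2" using r1 by (simp add: \<sigma>2_def)
  have M2: "M2 = fillmem M0 (base I) ((?k + 1) * ?Z) (zt I ?R)"
    unfolding M2_def M1_def fillmem_append by simp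
  have M2z: "M2 (base I + c) = zt I ?R c" if "c < (?k + 1) * ?Z" for c
    unfolding M2 using that by (rule fillmem_in)
  define \<sigma>3 where "\<sigma>3 = \<sigma>2(16 := base3 I, 17 := ?N * ?Z, 13 := ?N * ?Z)"
  define M3 where "M3 = fillmem M2 (base3 I) (?N * ?Z) (ht I ?R)"
  have 3: "xruns (xtable x_base3 (XV 6 |*| XV 12) x_bird) \<sigma>2 M2 ?\<omega> \<sigma>3 M3 ?\<omega>
      (2 * L ^ C + (2 * L ^ C + (?N * ?Z * (10 * L + L ^ C) + 4 * L))) \<and> small_vals L \<sigma>3 \<and> small_vals L M3"
    unfolding \<sigma>3_def M3_def
  proof (rule xruns_xtable[OF Cx Cx Cx L2 2[THEN conjunct2, THEN conjunct1] 2[THEN conjunct2, THEN conjunct2]])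
    show "xeval x_base3 \<sigma>2 M2 = base3 I" by (rule ev_bases[OF r2])
    show "bit_len (base3 I + ?N * ?Z) \<le> L" by (intro addr) (simp add: base4_def)
    fix i assume i: "i < ?N * ?Z"
    show "xeval x_bird (\<sigma>2(16 := base3 I, 17 := ?N * ?Z, 13 := i)) (fillmem M2 (base3 I) i (ht I ?R)) = ht I ?R i"
      using ev_bird[of I ?R "\<sigma>2(16 := base3 I, 17 := ?N * ?Z, 13 := i)" M2] r2 i M2z by simp
    show "loops_le x_bird (\<sigma>2(16 := base3 I, 17 := ?N * ?Z, 13 := i)) (fillmem M2 (base3 I) i (ht I ?R)) L"
      using r2 by (intro loops_bird[of I ?R]) simp
    show "bit_len (ht I ?R i) \<le> L" using i by (rule bit_len_ht)
  qed (use regsD[OF r2] in \<open>simp_all add: exprs_def x_base3_def\<close>)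
  have r3: "regs I ?R \<sigma>3" using r2 by (simp add: \<sigma>3_def)
  have M3h: "M3 (base3 I + c) = ht I ?R c" if "c < ?N * ?Z" for c
    unfolding M3_def using that by (rule fillmem_in)
  define \<sigma>4 where "\<sigma>4 = \<sigma>3(16 := base4 I, 17 := ?p + 1, 13 := ?p + 1)"
  define M4 where "M4 = fillmem M3 (base4 I) (?p + 1) (pt I ?R)"
  have 4: "xruns (xtable x_base4 (XV 5 |+| XC 1) x_total) \<sigma>3 M3 ?\<omega> \<sigma>4 M4 ?\<omega>
      (2 * L ^ C + (2 * L ^ C + ((?p + 1) * (10 * L + L ^ C) + 4 * L))) \<and> small_vals L \<sigma>4 \<and> small_vals L M4"
    unfolding \<sigma>4_def M4_def
  proof (rule xruns_xtable[OF Cx Cx Cx L2 3[THEN conjunct2, THEN conjunct1] 3[THEN conjunct2, THEN conjunct2]])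
    show "xeval x_base4 \<sigma>3 M3 = base4 I" by (rule ev_bases[OF r3])
    show "bit_len (base4 I + (?p + 1)) \<le> L" by (intro addr) simp
    fix i assume i: "i < ?p + 1"
    show "xeval x_total (\<sigma>3(16 := base4 I, 17 := ?p + 1, 13 := i)) (fillmem M3 (base4 I) i (pt I ?R)) = pt I ?R i"
      using ev_total[of I ?R "\<sigma>3(16 := base4 I, 17 := ?p + 1, 13 := i)" M3] r3 i M3h by simp
    show "loops_le x_total (\<sigma>3(16 := base4 I, 17 := ?p + 1, 13 := i)) (fillmem M3 (base4 I) i (pt I ?R)) L"
      by (rule loops_total)
    show "bit_len (pt I ?R i) \<le> L" using i by (intro bit_len_pt) simp
  qed (use regsD[OF r3] in \<open>simp_all add: exprs_def x_base4_def x_base3_def\<close>)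
  have r4: "regs I ?R \<sigma>4" using r3 by (simp add: \<sigma>4_def)
  have h4: "holds_input I M4"
    unfolding M4_def M3_def M2 using base_le[of I] by (intro holds_input_fillmem h0) auto
  define v where "v = xeval x_answer \<sigma>4 M4"
  have 5: "xruns (xset 0 x_answer) \<sigma>4 M4 ?\<omega> (\<sigma>4(0 := v)) M4 ?\<omega> (2 * L ^ C)"
    unfolding v_def using 4 L2 by (intro xruns_xset Cx loops_answer[OF r4]) (auto simp: exprs_def)
  have "M4 (base4 I + ?p) = pt I ?R ?p" unfolding M4_def by (rule fillmem_in) simp
  from ev_answer[OF inst h4 r4 this]
  have ans: "(\<sigma>4(0 := v)) 0 \<noteq> 0 \<longleftrightarrow> ks.accepts I (radix I) (wt I ?R) (bins I) (goal_profit I)"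
    by (simp add: v_def)
  let ?E = "L ^ C"
  have run: "xruns alg (\<lambda>_. 0) (input_mem I) \<omega> (\<sigma>4(0 := v)) M4 ?\<omega>
     (26 * ?E + (coins I * (10 * L) + 2 * L) + (2 * ?E + (2 * ?E + (?Z * (10 * L + ?E) + 4 * L)) +
      (2 * ?E + (2 * ?E + (?k * ?Z * (10 * L + ?E) + 4 * L)) + (2 * ?E + (2 * ?E + (?N * ?Z * (10 * L + ?E) + 4 * L)) +
      (2 * ?E + (2 * ?E + ((?p + 1) * (10 * L + ?E) + 4 * L)) + 2 * ?E)))))"
    unfolding alg_def
    by (rule xruns_Seq[OF \<sigma>0(3)[folded M0_def]] xruns_Seq[OF 1[THEN conjunct1]] xruns_Seq[OF 2[THEN conjunct1]] xruns_Seq[OF 3[THEN conjunct1]] xruns_Seq[OF 4[THEN conjunct1]] 5 |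
        simp only: M0_def[symmetric])+
  \<comment> \<open>Every table has at most \<open>L * ?p\<close> cells, and
    \<open>L \<le> ?E\<close>. All terms together are at most \<open>128 * (L * ?p * ?E)\<close>,
    and \<open>128 = 2 ^ 7 \<le> L ^ 7\<close> yields the exponent \<open>C + 8\<close>.\<close>
  have "26 * ?E + (coins I * (10 * L) + 2 * L) + (2 * ?E + (2 * ?E + (?Z * (10 * L + ?E) + 4 * L)) +
      (2 * ?E + (2 * ?E + (?k * ?Z * (10 * L + ?E) + 4 * L)) + (2 * ?E + (2 * ?E + (?N * ?Z * (10 * L + ?E) + 4 * L)) +
      (2 * ?E + (2 * ?E + ((?p + 1) * (10 * L + ?E) + 4 * L)) + 2 * ?E)))) \<le> 2 ^ ?k * L ^ (C + 8)" (is "?T \<le> _")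
  proof -
    have LL: "L ^ 2 \<le> ?E" using C(1) L2 by (intro power_increasing) auto
    have L1: "1 * L \<le> L * L" using L2 by (intro mult_le_mono1) linarith
    moreover have LL': "L * L \<le> ?E" using LL by (simp add: power2_eq_square)
    ultimately have LE: "L \<le> ?E" by linarith
    have m: "coins I * (10 * L) \<le> 10 * ?E"
    proof -
      have "coins I \<le> L" using coins_le vbound_ge(3)[of I] by linarith
      then have "coins I * (10 * L) \<le> L * (10 * L)" by (rule mult_le_mono1)
      moreover have "L * (10 * L) = 10 * (L * L)" by simp
      ultimately show ?thesis using LL' by linarith
    qed
    have N3: "?N * (?N * ?N) \<le> L" by (rule vbound_ge)
    have a: "?N * ?Z \<le> L * ?p"
    proof -
      have "?N * (?N * ?N) * ?p \<le> L * ?p" using N3 by (rule mult_le_mono1)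
      then show ?thesis by (simp only: mult.assoc)
    qed
    have b: "?k * ?Z \<le> L * ?p" using mult_le_mono1[of ?k ?N ?Z] ks.k_less[of I] a by linarith
    have c: "?Z \<le> L * ?p"
    proof -
      have "1 \<le> ?N" by (simp add: Suc_le_eq)
      then have "1 * ?Z \<le> ?N * ?Z" by (rule mult_le_mono1)
      then show ?thesis using a by linarith
    qed
    have d: "?p + 1 \<le> L * ?p"
    proof -
      have "2 * ?p \<le> L * ?p" using L2 by (rule mult_le_mono1)
      moreover have "1 \<le> ?p" by simp
      ultimately show ?thesis by linarith
    qed
    have s: "x * (10 * L + ?E) \<le> 11 * (L * ?p * ?E)" if "x \<le> L * ?p" for x
    proof -
      have "x * (10 * L + ?E) \<le> L * ?p * (11 * ?E)" using that LE by (intro mult_le_mono) linarith+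
      then show ?thesis by simp
    qed
    have "1 * ?E \<le> L * ?p * ?E" using L2 by (intro mult_le_mono1) (simp add: Suc_le_eq)
    then have "?T \<le> 128 * (L * ?p * ?E)"
      using m LE s[OF a] s[OF b] s[OF c] s[OF d] by linarith
    also have "\<dots> \<le> L ^ 7 * (L * ?p * ?E)"
      using power_mono[OF L2, of 7] by (intro mult_le_mono1) simp
    also have "\<dots> = 2 ^ ?k * L ^ (C + 8)"
      by (simp add: power_add power_numeral_reduce)
    finally show ?thesis .
  qed
  then have "xruns alg (\<lambda>_. 0) (input_mem I) \<omega> (\<sigma>4(0 := v)) M4 ?\<omega> (2 ^ ?k * L ^ (C + 8))"
    by (rule xruns_mono[OF run])
  then show ?thesis using ans by blast
qed

end

section \<open>Correctness and running time\<close>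

lemma prob_accept:
  assumes inst: "vmk_instance I"
  shows "measure coin_space {\<omega>. ks.accepts I (radix I) (wt I (coin_value (coins I) \<omega>)) (bins I) (goal_profit I)
    \<longleftrightarrow> vmk_yes I} \<ge> 2 / 3"
proof -
  let ?u = "2 * verts I * verts I" and ?m = "coins I" and ?W = "wmax I"
  let ?acc = "\<lambda>R. ks.accepts I (radix I) (wt I R) (bins I) (goal_profit I)"
  define G where "G = {R. R < 2 ^ ?m \<and> (?acc R \<longleftrightarrow> vmk_yes I)}"
  \<comment> \<open>The coins provide exactly one base-\<open>?W\<close> digit for each of the
    \<open>?u\<close> ground elements, so the weights are uniform and independent.\<close>
  have Wu: "?W ^ ?u = 2 ^ ?m" by (simp add: wmax_def coins_def power_mult)
  have K: "2 * verts I * verts I * ?W + verts I * items_profit I \<le> radix I" by (simp add: radix_def)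
  have acc: "?acc R \<Longrightarrow> vmk_yes I" for R
    using ks.accepts_imp_solution[of I ?W "items_profit I" "radix I" "wt I R"] K set_profit_le wt_less
      solution_imp_yes by blast
  have GB: "G = {..<2 ^ ?m} - {R. R < 2 ^ ?m \<and> ?acc R \<noteq> vmk_yes I}" by (auto simp: G_def)
  have fin: "finite {R. R < 2 ^ ?m \<and> ?acc R \<noteq> vmk_yes I}" by simp
  \<comment> \<open>Only yes-instances can fail. There at most \<open>?u * ?W ^ (?u - 1)\<close>
    numbers do, and \<open>3 * ?u < ?W\<close>.\<close>
  have bad: "3 * card {R. R < 2 ^ ?m \<and> ?acc R \<noteq> vmk_yes I} \<le> 2 ^ ?m"
  proof (cases "vmk_yes I")
    case False
    then have "{R. R < 2 ^ ?m \<and> ?acc R \<noteq> vmk_yes I} = {}" using acc by blast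
    then show ?thesis by (simp only: card.empty)
  next
    case True
    let ?F = "ks.elements I ` ks.solutions I (bins I) (goal_profit I)"
    have F: "?F \<noteq> {}" "?F \<subseteq> Pow {..<?u}"
      using yes_imp_solution[OF inst True] ks.elements_less by (auto simp: ks.solutions_def)
    have iso: "?acc R" if "isolated ?F (wt I R)" for R
      using ks.isolated_imp_accepts[of I ?W "items_profit I" "radix I" "wt I R"] K set_profit_le wt_less that by blast
    have "{R. R < 2 ^ ?m \<and> ?acc R \<noteq> vmk_yes I} \<subseteq> {R. R < ?W ^ ?u \<and> \<not> isolated ?F (wt I R)}"
      using iso True Wu by auto
    then have "card {R. R < 2 ^ ?m \<and> ?acc R \<noteq> vmk_yes I} \<le> card {R. R < ?W ^ ?u \<and> \<not> isolated ?F (wt I R)}"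
      by (intro card_mono) auto
    also have "\<dots> \<le> ?u * ?W ^ (?u - 1)"
      by (rule isolation_lemma[OF F]) (simp add: wmax_def)
    finally have "3 * card {R. R < 2 ^ ?m \<and> ?acc R \<noteq> vmk_yes I} \<le> (3 * ?u) * ?W ^ (?u - 1)" by simp
    also have "\<dots> \<le> ?W * ?W ^ (?u - 1)"
      using wmax_bounds(1)[of I] by (intro mult_le_mono1) simp
    also have "\<dots> = ?W ^ ?u"
    proof -
      have "?u = Suc (?u - 1)" by simp
      then show ?thesis by (metis power_Suc)
    qed
    finally show ?thesis using Wu by simp
  qed
  have "card G = 2 ^ ?m - card {R. R < 2 ^ ?m \<and> ?acc R \<noteq> vmk_yes I}"
    unfolding GB by (subst card_Diff_subset) auto
  then have "2 * 2 ^ ?m \<le> 3 * card G" using bad by linarith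
  then have "real (2 * 2 ^ ?m) \<le> real (3 * card G)" by (simp only: of_nat_le_iff)
  then have "2 * 2 ^ ?m \<le> 3 * real (card G)" by simp
  then have "2 / 3 \<le> real (card G) / 2 ^ ?m" by (simp add: pos_le_divide_eq)
  also have "\<dots> = measure coin_space {\<omega>. coin_value ?m \<omega> \<in> G}"
    by (rule prob_coin_value[symmetric]) (auto simp: G_def)
  also have "{\<omega>. coin_value ?m \<omega> \<in> G} = {\<omega>. ?acc (coin_value ?m \<omega>) \<longleftrightarrow> vmk_yes I}"
    using coin_value_less by (auto simp: G_def)
  finally show ?thesis .
qed

text \<open>Replaces an arbitrary polynomial by a pure power whose exponent depends on
  \<open>q\<close> only; the coefficient sum is absorbed through
  \<open>poly q 1 \<le> s ^ poly q 1\<close>.\<close>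

lemma poly_nat_le_power:
  fixes q :: "nat poly"
  assumes "2 \<le> s"
  shows "poly q s \<le> s ^ (poly q 1 + degree q)"
proof -
  have "poly q s = (\<Sum>i\<le>degree q. coeff q i * s ^ i)" by (rule poly_altdef)
  also have "\<dots> \<le> (\<Sum>i\<le>degree q. coeff q i * s ^ degree q)"
    using assms by (intro sum_mono mult_le_mono2 power_increasing) auto
  also have "\<dots> = poly q 1 * s ^ degree q" by (simp add: poly_altdef sum_distrib_right)
  also have "\<dots> \<le> s ^ poly q 1 * s ^ degree q"
  proof (rule mult_le_mono1)
    have "poly q 1 \<le> 2 ^ poly q 1" by (rule less_imp_le[OF less_exp])
    also have "\<dots> \<le> s ^ poly q 1" using assms by (rule power_mono) simp
    finally show "poly q 1 \<le> s ^ poly q 1" .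
  qed
  finally show ?thesis by (simp add: power_add)
qed

text \<open>The place where the profit bound enters: it bounds \<open>radix I\<close>, and with it
  the lengths of all evaluated polynomials.\<close>

lemma vbound_poly:
  assumes inst: "vmk_instance I" and s: "s = input_size (encode_vmk I)"
    and profit: "\<And>v. v \<in> all_items I \<Longrightarrow> item_profit I v \<le> s ^ e"
  shows "vbound I \<le> s ^ (4 * e + 50)"
proof -
  let ?N = "verts I"
  have base: "base I \<le> s" using base_le_input_size[OF inst] s by simp
  then have s4: "4 \<le> s" by (simp add: base_def)
  have Ns: "?N \<le> s"
  proof -
    have "length (items I) * 1 \<le> length (items I) * (2 + 2 * vdim I)" by (intro mult_le_mono2) simp
    then show ?thesis using base unfolding base_def verts_def by linarith
  qed
  have pw: "s ^ a \<le> s ^ b" if "a \<le> b" for a b using s4 that by (intro power_increasing) auto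
  \<comment> \<open>The header alone makes \<open>s\<close> at least 4, so constants turn into
    powers of \<open>s\<close>.\<close>
  have four: "4 ^ a * x \<le> s ^ a * x" for a x using s4 by (intro mult_le_mono1 power_mono) auto
  have NN: "?N * ?N \<le> s ^ 2" using Ns by (simp add: power2_eq_square mult_le_mono)
  have W: "wmax I \<le> s ^ 4"
  proof -
    have "wmax I \<le> 12 * (?N * ?N)" using wmax_bounds(2)[of I] by simp
    also have "\<dots> \<le> 4 ^ 2 * s ^ 2" using NN by simp
    also have "\<dots> \<le> s ^ 2 * s ^ 2" by (rule four)
    finally show ?thesis by (simp add: power_add[symmetric])
  qed
  have Q: "items_profit I \<le> s * s ^ e"
  proof -
    have "items_profit I \<le> of_nat (card {..<length (items I)}) * s ^ e"
      unfolding items_profit_def using profit by (intro sum_bounded_above) (simp add: all_items_def)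
    also have "\<dots> \<le> s * s ^ e" using Ns by (intro mult_le_mono1) (simp add: verts_def)
    finally show ?thesis .
  qed
  have K: "radix I \<le> s ^ (e + 9)"
  proof -
    have "radix I = 2 * ((?N * ?N) * wmax I) + ?N * items_profit I" by (simp add: radix_def)
    also have "\<dots> \<le> 2 * (s ^ 2 * s ^ 4) + s * (s * s ^ e)"
      using NN W Ns Q by (intro add_mono mult_le_mono) auto
    also have "s ^ 2 * s ^ 4 = s ^ 6" by (simp flip: power_add)
    also have "s * (s * s ^ e) = s ^ (e + 2)" by simp
    also have "2 * s ^ 6 + s ^ (e + 2) \<le> 4 ^ 1 * s ^ (e + 8)" using pw[of 6 "e + 8"] pw[of "e + 2" "e + 8"] by simp
    also have "\<dots> \<le> s ^ 1 * s ^ (e + 8)" by (rule four)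
    also have "\<dots> = s ^ (1 + (e + 8))" by (rule power_add[symmetric])
    also have "1 + (e + 8) = e + 9" by simp
    finally show ?thesis .
  qed
  have "vbound I = s + 64 * (?N * (?N * ?N) * radix I ^ 4)"
    by (simp add: vbound_def ubound_def s)
  also have "\<dots> \<le> s + 4 ^ 3 * (s * s ^ 2 * (s ^ (e + 9)) ^ 4)"
    using Ns NN K by (intro add_mono mult_le_mono power_mono) auto
  also have "\<dots> \<le> s + s ^ 3 * (s * s ^ 2 * (s ^ (e + 9)) ^ 4)"
    by (intro add_left_mono four)
  also have "s ^ 3 * (s * s ^ 2 * (s ^ (e + 9)) ^ 4) = s ^ 3 * (s ^ 1 * s ^ 2 * s ^ ((e + 9) * 4))"
    by (simp only: power_mult power_one_right)
  also have "\<dots> = s ^ (3 + (1 + 2 + (e + 9) * 4))" by (simp only: power_add)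
  also have "3 + (1 + 2 + (e + 9) * 4) = 4 * e + 42" by simp
  also have "s + s ^ (4 * e + 42) \<le> 4 ^ 1 * s ^ (4 * e + 49)"
    using pw[of 1 "4 * e + 49"] pw[of "4 * e + 42" "4 * e + 49"] by simp
  also have "\<dots> \<le> s ^ 1 * s ^ (4 * e + 49)" by (rule four)
  also have "\<dots> = s ^ (1 + (4 * e + 49))" by (rule power_add[symmetric])
  also have "1 + (4 * e + 49) = 4 * e + 50" by simp
  finally show ?thesis .
qed

text \<open>The program is fixed before \<open>q\<close>: \<open>alg\<close> and its exponent
  \<open>C\<close> mention no profit bound, and \<open>q\<close> influences only the power of the
  input size that bounds \<open>vbound I\<close>.\<close>

theorem theorem6:
  shows "\<exists>A::prog. \<forall>q::nat poly. \<exists>c::nat. \<forall>I::vmk.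
    vmk_instance I \<and>
    (\<forall>v\<in>all_items I. item_profit I v \<le> poly q (input_size (encode_vmk I))) \<longrightarrow>
    monte_carlo_decides A (encode_vmk I) (vmk_yes I)
      (2 ^ num_small I * input_size (encode_vmk I) ^ c)"
proof -
  obtain C where C: "2 \<le> C" "\<forall>x\<in>set exprs. compiles_in x C" using compiles_in_list by blast
  have "monte_carlo_decides alg (encode_vmk I) (vmk_yes I)
      (2 ^ num_small I * input_size (encode_vmk I) ^ ((4 * (poly q 1 + degree q) + 50) * (C + 8)))"
    if inst: "vmk_instance I" and profit: "\<forall>v\<in>all_items I. item_profit I v \<le> poly q (input_size (encode_vmk I))"
    for q :: "nat poly" and I
  proof -
    let ?s = "input_size (encode_vmk I)" and ?e = "poly q 1 + degree q"
    let ?T = "2 ^ num_small I * ?s ^ ((4 * ?e + 50) * (C + 8))"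
    let ?acc = "\<lambda>\<omega>. ks.accepts I (radix I) (wt I (coin_value (coins I) \<omega>)) (bins I) (goal_profit I)"
    have s2: "2 \<le> ?s" using base_le_input_size[OF inst] by (simp add: base_def)
    have "vbound I \<le> ?s ^ (4 * ?e + 50)"
      using profit poly_nat_le_power[OF s2, of q] by (intro vbound_poly[OF inst refl]) (meson order_trans)
    then have "vbound I ^ (C + 8) \<le> (?s ^ (4 * ?e + 50)) ^ (C + 8)" by (rule power_mono) simp
    then have T: "2 ^ num_small I * vbound I ^ (C + 8) \<le> ?T" by (simp add: power_mult)
    have run: "\<exists>t \<omega>' m. exec alg (init_state (encode_vmk I)) \<omega> t \<omega>' m \<and> m \<le> ?T \<and> (fst t 0 \<noteq> 0 \<longleftrightarrow> ?acc \<omega>)" for \<omega>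
    proof -
      from alg_runs[OF inst C, of \<omega>] obtain \<sigma> M where
        r: "xruns alg (\<lambda>_. 0) (input_mem I) \<omega> \<sigma> M (sdrop (coins I) \<omega>) (2 ^ num_small I * vbound I ^ (C + 8))"
        and a: "\<sigma> 0 \<noteq> 0 \<longleftrightarrow> ?acc \<omega>" by blast
      from r[unfolded xruns_def, THEN spec, of "\<lambda>_. 0"] obtain R' where
        R': "\<forall>v. R' (gl v) = \<sigma> v" and
        "runs alg (\<lambda>_. 0, input_mem I) \<omega> (R', M) (sdrop (coins I) \<omega>) (2 ^ num_small I * vbound I ^ (C + 8))"
        by auto
      then obtain m where m: "m \<le> 2 ^ num_small I * vbound I ^ (C + 8)"
        and "exec alg (\<lambda>_. 0, input_mem I) \<omega> (R', M) (sdrop (coins I) \<omega>) m"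
        unfolding runs_def by auto
      moreover have "m \<le> ?T" using m T by (rule le_trans)
      moreover have "R' (gl 0) = \<sigma> 0" using R' ..
      moreover have "init_state (encode_vmk I) = (\<lambda>_. 0, input_mem I)"
        by (simp add: init_state_def input_mem_def)
      moreover have "gl 0 = 0" by (simp add: gl_def)
      ultimately show ?thesis using a
        by (intro exI[of _ "(R', M)"] exI[of _ "sdrop (coins I) \<omega>"] exI[of _ m] conjI) simp_all
    qed
    have "halts_within alg (encode_vmk I) \<omega> ?T" for \<omega>
      using run[of \<omega>] unfolding halts_within_def by blast
    \<comment> \<open>By determinism the run found above is the only one, so \<open>answers\<close>
      cannot be witnessed by a different result.\<close>
    moreover have "answers alg (encode_vmk I) \<omega> (vmk_yes I) \<longleftrightarrow> (?acc \<omega> \<longleftrightarrow> vmk_yes I)" for \<omega>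
      using run[of \<omega>] exec_deterministic unfolding answers_def by blast
    ultimately show ?thesis using prob_accept[OF inst] by (simp add: monte_carlo_decides_def)
  qed
  then show ?thesis by blast
qed

end
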